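(* Let $p,q\in(1,\infty)$ and $r\ge1$ with $\frac1p+\frac1q=\frac1r$, and let $n,m\in\mathbb{N}$ with $0<n-\frac1r<m$. For integers $k$ write $\mathcal{S}_{k,m}h(t)=t^{m-k}\int_0^\infty\frac{s^{k-1}}{(s+t)^m}h(s)\,ds$, $t>0$. For $f\in L^p(\mathbb{R}^+)$ and $g\in L^q(\mathbb{R}^+)$ let $$(f\otimes g)(t)=f(t)\;\mathrm{p.v.}\!\int_0^\infty\frac{g(s)}{s-t}ds+g(t)\;\mathrm{p.v.}\!\int_0^\infty\frac{f(s)}{s-t}ds,\qquad t>0,$$ so that $f\otimes g\in L^r(\mathbb{R}^+)$. Then, for any $f\in L^p(\mathbb{R}^+)$ and $g\in L^q(\mathbb{R}^+)$, $$\mathcal{S}_{n,m}(f\otimes g)=\sum_{i=n}^m\binom mi\sum_{j=0}^{i-n}\mathcal{S}_{i-j,m}f\cdot\mathcal{S}_{n+j,m}g-\sum_{i=0}^{n-2}\binom mi\sum_{j=0}^{n-2-i}\mathcal{S}_{n-j-1,m}f\cdot\mathcal{S}_{i+j+1,m}g,$$ where the products on the right are pointwise products of functions (an empty sum is $0$).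
   Context: p.v. denotes the Cauchy principal value (limit as $\varepsilon\to0^+$ of the integral over $(0,t-\varepsilon)\cup(t+\varepsilon,\infty)$). The half-line transform $f\mapsto\mathrm{p.v.}\int_0^\infty\frac{f(s)}{s-t}ds$ is bounded on $L^a(\mathbb{R}^+)$ for $1<a<\infty$, and $\mathcal{S}_{k,m}$ is bounded on $L^a(\mathbb{R}^+)$ for $a\ge1$ and $0<k-\frac1a<m$. *)

theory Defs
  imports "HOL-Analysis.Analysis"
begin

text \<open>
  Functions on \<open>\<real>\<^sup>+ = (0,\<infinity>)\<close> are represented by total functions \<open>real \<Rightarrow> complex\<close> whose values
  outside \<open>{0<..}\<close> play no role; this covers real-valued functions as well.
  The elements of \<open>L\<^sup>p\<close> are functions, not equivalence classes.
\<close>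

definition Lp_half_line :: "real \<Rightarrow> (real \<Rightarrow> complex) set" where
  "Lp_half_line p =
     {f. f \<in> borel_measurable (lebesgue_on {0<..}) \<and>
         integrable (lebesgue_on {0<..}) (\<lambda>s. norm (f s) powr p)}"

definition truncated_transform :: "(real \<Rightarrow> complex) \<Rightarrow> real \<Rightarrow> real \<Rightarrow> complex" where
  "truncated_transform f t \<epsilon> =
     (LINT s:{0<..<t - \<epsilon>} \<union> {t + \<epsilon><..}|lebesgue. f s / of_real (s - t))"

definition pv_exists :: "(real \<Rightarrow> complex) \<Rightarrow> real \<Rightarrow> bool" where
  "pv_exists f t \<longleftrightarrow> (\<exists>L. (truncated_transform f t \<longlongrightarrow> L) (at_right 0))"

text \<open>
  The value of \<open>p.v. \<integral>\<^sub>0\<^sup>\<infinity> f(s)/(s-t) ds\<close>; it is meaningful only where \<open>pv_exists f t\<close>,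
  which for \<open>f\<close> in \<open>L\<^sup>p\<close>, \<open>1 < p < \<infinity>\<close>, is almost everywhere.
\<close>

definition pv_transform :: "(real \<Rightarrow> complex) \<Rightarrow> real \<Rightarrow> complex" where
  "pv_transform f t = Lim (at_right 0) (truncated_transform f t)"

definition pv_prod :: "(real \<Rightarrow> complex) \<Rightarrow> (real \<Rightarrow> complex) \<Rightarrow> real \<Rightarrow> complex" where
  "pv_prod f g t = f t * pv_transform g t + g t * pv_transform f t"

definition stieltjes :: "int \<Rightarrow> nat \<Rightarrow> (real \<Rightarrow> complex) \<Rightarrow> real \<Rightarrow> complex" where
  "stieltjes k m h t =
     of_real (t powi (int m - k)) *
     (LINT s:{0<..}|lebesgue. of_real (s powi (k - 1) / (s + t) ^ m) * h s)"

end

theory Submission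
  imports Defs "HOL-Complex_Analysis.Cauchy_Integral_Theorem"
begin

text \<open>
  Write \<open>C f (z) = \<integral> f t / (t - z) dt\<close>. For \<open>f \<ge> 0\<close> the function \<open>W = - i C f\<close> maps the upper half-plane into
  the right half-plane, so \<open>W\<^sup>p\<close> is holomorphic and its integral over horizontal lines vanishes; for
  \<open>1 < p \<le> 2\<close> the inequality \<open>\<bar>w\<bar>\<^sup>p \<le> A (Re w)\<^sup>p - B Re (w\<^sup>p)\<close> on \<open>Re w > 0\<close> then bounds \<open>C f\<close> on such lines by the
  Poisson integral of \<open>f\<close> (M. Riesz), and duality gives all \<open>p > 1\<close>. With \<open>C\<^sub>y f (x) = C f (x + iy)\<close> and \<open>P\<^sub>s\<close> the Poisson integral, the relations
  \<open>C\<^sub>y (P\<^sub>s f) = P\<^sub>s (C\<^sub>y f) = C\<^bsub>y+s\<^esub> f\<close> make the conjugate Poisson integral of \<open>f\<close> the Poisson integral of some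
  \<open>v \<in> L\<^sup>p\<close>, and at Lebesgue points the truncated transforms converge to \<open>v\<close> as well.

  For the identity, put \<open>\<phi> s = s\<^bsup>n-1\<^esup> / (s + t)\<^sup>m\<close> and replace principal values by conjugate Poisson integrals.
  Fubini and the oddness of the kernel turn \<open>\<integral> \<phi> (f Hg + g Hf)\<close> into a double integral of
  \<open>f x g u (\<phi> x - \<phi> u) / (u - x)\<close>, and expanding \<open>(u + t)\<^sup>m\<close> and \<open>(x + t)\<^sup>m\<close> by the binomial theorem writes that
  quotient as the sum of products of Stieltjes kernels in the statement.
\<close>

subsection \<open>\<open>L\<^sup>p\<close> on the line, Cauchy and Poisson kernels\<close>

text \<open>Norms enter only through their \<open>p\<close>-th powers \<open>pmass\<close>: sums
  cost a factor \<open>2 powr p\<close>, and in place of Hoelder's inequality Young's inequality is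
  applied to \<open>c f\<close> and \<open>g / c\<close> with a scalar \<open>c\<close> chosen for
  the occasion. No constant has to be sharp. Two obstacles shape the argument. The
  \<open>p\<close>-th power of \<open>W\<close> has a vanishing line integral only if it decays at
  infinity, and in the duality step a term can be absorbed into the left-hand side only if it is
  finite; bounded functions of bounded support provide both, with bounds that do not depend on the
  truncation. The case \<open>r = 1\<close> is reached because \<phi> is bounded as well as
  decaying.\<close>

definition pmass :: "real \<Rightarrow> (real \<Rightarrow> complex) \<Rightarrow> ennreal" where
  "pmass p f = (\<integral>\<^sup>+x. ennreal (norm (f x) powr p) \<partial>lborel)"

definition Lp :: "real \<Rightarrow> (real \<Rightarrow> complex) set" where
  "Lp p = {f \<in> borel_measurable borel. pmass p f < \<infinity>}"

definition cauchy_tr :: "(real \<Rightarrow> complex) \<Rightarrow> complex \<Rightarrow> complex" where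
  "cauchy_tr f z = (LINT t|lborel. f t / (of_real t - z))"

text \<open>This is \<open>1 / pi\<close> times the imaginary part of the Cauchy kernel
  \<open>1 / (u - \<i> * s)\<close>; the real part, without that factor, is
  \<open>conj_kernel\<close> below.\<close>

definition poisson_kernel :: "real \<Rightarrow> real \<Rightarrow> real" where
  "poisson_kernel s u = s / (pi * (u\<^sup>2 + s\<^sup>2))"

definition poisson :: "(real \<Rightarrow> complex) \<Rightarrow> real \<Rightarrow> real \<Rightarrow> complex" where
  "poisson f s x = (LINT t|lborel. of_real (poisson_kernel s (t - x)) * f t)"

lemma LpD [measurable_dest]: "f \<in> Lp p \<Longrightarrow> f \<in> borel_measurable borel"
  by (simp add: Lp_def)

lemma Lp_finite: "f \<in> Lp p \<Longrightarrow> pmass p f < \<infinity>"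
  by (simp add: Lp_def)

lemma LpI: "f \<in> borel_measurable borel \<Longrightarrow> pmass p f < \<infinity> \<Longrightarrow> f \<in> Lp p"
  by (simp add: Lp_def)

lemma Lp_iff_integrable:
  "f \<in> Lp p \<longleftrightarrow> f \<in> borel_measurable borel \<and> integrable lborel (\<lambda>x. norm (f x) powr p)"
  unfolding Lp_def pmass_def integrable_iff_bounded by auto

lemma Lp_powr_integrable: "f \<in> Lp p \<Longrightarrow> integrable lborel (\<lambda>x. norm (f x) powr p)"
  by (simp add: Lp_iff_integrable)

lemma pmass_mono:
  assumes "0 \<le> p" "\<And>x. norm (f x) \<le> norm (g x)"
  shows "pmass p f \<le> pmass p g"
  unfolding pmass_def by (intro nn_integral_mono ennreal_leI powr_mono2 assms) auto

lemma Lp_mono: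
  assumes "0 \<le> p" "g \<in> Lp p" "f \<in> borel_measurable borel" "\<And>x. norm (f x) \<le> norm (g x)"
  shows "f \<in> Lp p"
  using assms by (auto intro!: LpI intro: order.strict_trans1[OF pmass_mono Lp_finite])

lemma pmass_cmult:
  assumes [measurable]: "f \<in> borel_measurable borel"
  shows "pmass p (\<lambda>x. c * f x) = ennreal (norm c powr p) * pmass p f"
  unfolding pmass_def by (subst nn_integral_cmult[symmetric]) (auto simp: norm_mult powr_mult ennreal_mult)

lemma powr_add_le:
  fixes a b p :: real
  assumes "0 \<le> a" "0 \<le> b" "0 \<le> p"
  shows "(a + b) powr p \<le> 2 powr p * (a powr p + b powr p)"
proof -
  have "(a + b) powr p \<le> (2 * max a b) powr p"
    using assms by (intro powr_mono2) auto
  also have "\<dots> = 2 powr p * max a b powr p"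
    using assms by (simp add: powr_mult)
  also have "max a b powr p \<le> a powr p + b powr p"
    by (simp add: max_def)
  finally show ?thesis by simp
qed

lemma pmass_add:
  assumes [measurable]: "f \<in> borel_measurable borel" "g \<in> borel_measurable borel" and "0 \<le> p"
  shows "pmass p (\<lambda>x. f x + g x) \<le> ennreal (2 powr p) * (pmass p f + pmass p g)"
proof -
  have "norm (f x + g x) powr p \<le> 2 powr p * (norm (f x) powr p + norm (g x) powr p)" for x
    by (rule order_trans[OF powr_mono2 powr_add_le]) (use assms in \<open>auto intro: norm_triangle_ineq\<close>)
  then have "pmass p (\<lambda>x. f x + g x) \<le> (\<integral>\<^sup>+x. ennreal (2 powr p * (norm (f x) powr p + norm (g x) powr p)) \<partial>lborel)"
    unfolding pmass_def by (intro nn_integral_mono ennreal_leI) auto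
  also have "\<dots> = ennreal (2 powr p) * (pmass p f + pmass p g)"
    unfolding pmass_def
    by (subst nn_integral_add[symmetric] nn_integral_cmult[symmetric], auto intro!: nn_integral_cong simp: ennreal_mult)+
  finally show ?thesis .
qed

lemma Lp_cmult: "f \<in> Lp p \<Longrightarrow> (\<lambda>x. c * f x) \<in> Lp p"
  by (intro LpI) (auto simp: pmass_cmult Lp_finite ennreal_mult_less_top dest: LpD Lp_finite)

lemma Lp_add: "f \<in> Lp p \<Longrightarrow> g \<in> Lp p \<Longrightarrow> 0 \<le> p \<Longrightarrow> (\<lambda>x. f x + g x) \<in> Lp p"
  by (intro LpI order.strict_trans1[OF pmass_add]) (auto simp: ennreal_mult_less_top dest: LpD Lp_finite)

lemma Lp_diff: "f \<in> Lp p \<Longrightarrow> g \<in> Lp p \<Longrightarrow> 0 \<le> p \<Longrightarrow> (\<lambda>x. f x - g x) \<in> Lp p"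
  using Lp_add[OF _ Lp_cmult[of g p "-1"], of f] by simp

section \<open>Young's inequality and pairing with kernels that decay like
  \<open>1 / (1 + \<bar>t\<bar>)\<close>\<close>

lemma Young_pmass:
  assumes [measurable]: "f \<in> borel_measurable borel" "g \<in> borel_measurable borel"
    and "1 < p" "1 < q" "1/p + 1/q = (1::real)"
  shows "(\<integral>\<^sup>+x. ennreal (norm (f x) * norm (g x)) \<partial>lborel) \<le> pmass p f + pmass q g"
proof -
  have "norm (f x) * norm (g x) \<le> norm (f x) powr p + norm (g x) powr q" for x
  proof -
    have "norm (f x) powr p / p \<le> norm (f x) powr p" "norm (g x) powr q / q \<le> norm (g x) powr q"
      using assms mult_left_mono[of 1 p "norm (f x) powr p"] mult_left_mono[of 1 q "norm (g x) powr q"]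
      by (auto simp: divide_le_eq)
    then show ?thesis
      using Youngs_inequality[OF assms(3,4,5), of "norm (f x)" "norm (g x)"] by simp
  qed
  then have "(\<integral>\<^sup>+x. ennreal (norm (f x) * norm (g x)) \<partial>lborel) \<le> (\<integral>\<^sup>+x. ennreal (norm (f x) powr p + norm (g x) powr q) \<partial>lborel)"
    by (intro nn_integral_mono ennreal_leI)
  also have "\<dots> = pmass p f + pmass q g"
    unfolding pmass_def by (subst nn_integral_add[symmetric]) auto
  finally show ?thesis .
qed

lemma Lp_mult_integrable:
  assumes "f \<in> Lp p" "g \<in> Lp q" "1 < p" "1 < q" "1/p + 1/q = (1::real)"
  shows "integrable lborel (\<lambda>x. f x * g x)"
proof (rule integrableI_bounded)
  show [measurable]: "(\<lambda>x. f x * g x) \<in> borel_measurable lborel"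
    using assms(1,2)[THEN LpD] by auto
  have "(\<integral>\<^sup>+ x. ennreal (norm (f x * g x)) \<partial>lborel) \<le> pmass p f + pmass q g"
    using Young_pmass[OF LpD[OF assms(1)] LpD[OF assms(2)] assms(3-5)] by (simp add: norm_mult)
  also have "\<dots> < \<infinity>"
    using assms(1,2)[THEN Lp_finite] by simp
  finally show "(\<integral>\<^sup>+ x. ennreal (norm (f x * g x)) \<partial>lborel) < \<infinity>" .
qed

lemma nn_integral_reflect:
  fixes f :: "real \<Rightarrow> ennreal"
  assumes [measurable]: "f \<in> borel_measurable borel"
  shows "(\<integral>\<^sup>+x. f (- x) \<partial>lborel) = (\<integral>\<^sup>+x. f x \<partial>lborel)"
  using nn_integral_real_affine[of f "-1" 0] by simp

lemma nn_integral_shift: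
  fixes f :: "real \<Rightarrow> ennreal"
  assumes [measurable]: "f \<in> borel_measurable borel"
  shows "(\<integral>\<^sup>+x. f (x - a) \<partial>lborel) = (\<integral>\<^sup>+x. f x \<partial>lborel)"
  using nn_integral_real_affine[of f "1" "-a"] by simp

lemma nn_integral_decay:
  assumes "1 < (q::real)"
  shows "(\<integral>\<^sup>+t. ennreal ((1 / (1 + \<bar>t\<bar>)) powr q) \<partial>lborel) < \<infinity>"
proof -
  define f where "f t = (1 / (1 + \<bar>t\<bar>)) powr q" for t :: real
  have [measurable]: "f \<in> borel_measurable borel"
    unfolding f_def by measurable
  define F where "F t = - ((1 + t) powr (1 - q)) / (q - 1)" for t :: real
  define g where "g t = (1 + t) powr (- q)" for t :: real
  have "(\<integral>\<^sup>+t. ennreal (g t) * indicator {0..} t \<partial>lborel) = 0 - F 0"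
  proof (rule nn_integral_FTC_atLeast)
    show "DERIV F t :> g t" if "0 \<le> t" for t
    proof -
      have "DERIV (\<lambda>t. 1 + t) t :> 1"
        by (auto intro!: derivative_eq_intros)
      from DERIV_fun_powr[OF this, of "1 - q"]
      have "DERIV (\<lambda>t. (1 + t) powr (1 - q)) t :> (1 - q) * (1 + t) powr (- q)"
        using that by simp
      from DERIV_cdivide[OF DERIV_minus[OF this], of "q - 1"]
      have "DERIV F t :> - ((1 - q) * (1 + t) powr (- q)) / (q - 1)"
        unfolding F_def .
      also have "- ((1 - q) * (1 + t) powr (- q)) / (q - 1) = g t"
        using assms by (simp add: g_def field_simps)
      finally show ?thesis .
    qed
    have "((\<lambda>t. (1 + t) powr (1 - q)) \<longlongrightarrow> 0) at_top"
      by (intro tendsto_neg_powr filterlim_tendsto_add_at_top[OF tendsto_const filterlim_ident]) (use assms in auto)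
    then show "(F \<longlongrightarrow> 0) at_top"
      unfolding F_def using tendsto_divide[OF tendsto_minus[OF _] tendsto_const, of _ 0 _ "q - 1"] assms
      by fastforce
  qed (auto simp: g_def)
  also have "(\<integral>\<^sup>+t. ennreal (g t) * indicator {0..} t \<partial>lborel) = (\<integral>\<^sup>+t. ennreal (f t) * indicator {0..} t \<partial>lborel)"
    by (intro nn_integral_cong) (auto simp: f_def g_def powr_minus_divide powr_divide split: split_indicator)
  finally have 1: "(\<integral>\<^sup>+t. ennreal (f t) * indicator {0..} t \<partial>lborel) < \<infinity>"
    by simp
  have 2: "(\<integral>\<^sup>+t. ennreal (f (-t)) * indicator {0..} (-t) \<partial>lborel) < \<infinity>"
    using 1 by (subst nn_integral_reflect) auto
  have "(\<integral>\<^sup>+t. ennreal (f t) \<partial>lborel) \<le> (\<integral>\<^sup>+t. ennreal (f t) * indicator {0..} t + ennreal (f (-t)) * indicator {0..} (-t) \<partial>lborel)"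
    by (intro nn_integral_mono) (auto simp: f_def split: split_indicator)
  also have "\<dots> < \<infinity>"
    using 1 2 by (subst nn_integral_add) auto
  finally show ?thesis by (simp add: f_def)
qed

text \<open>The mass of the model majorant centred at \<open>0\<close>; by translation invariance it
  bounds every function below a translate of that majorant, whatever the centre.\<close>

definition decay_const :: "real \<Rightarrow> real \<Rightarrow> ennreal" where
  "decay_const K q = pmass q (\<lambda>t. of_real (K / (1 + \<bar>t\<bar>)))"

lemma decay_const_finite: assumes "1 < q" "0 \<le> K" shows "decay_const K q < \<infinity>"
proof -
  have "decay_const K q = pmass q (\<lambda>t. of_real K * of_real (1 / (1 + \<bar>t\<bar>)))"
    unfolding decay_const_def by simp
  also have "\<dots> < \<infinity>"
    using nn_integral_decay[OF assms(1)]
    by (subst pmass_cmult) (auto simp: pmass_def ennreal_mult_less_top simp del: of_real_divide of_real_add)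
  finally show ?thesis .
qed

lemma pmass_decay_le:
  assumes "0 \<le> q" "\<And>t. norm (g t) \<le> K / (1 + \<bar>t - x\<bar>)" "0 \<le> K"
  shows "pmass q g \<le> decay_const K q"
proof -
  have "pmass q g \<le> pmass q (\<lambda>t. of_real (K / (1 + \<bar>t - x\<bar>)))"
    using assms by (intro pmass_mono) (auto simp del: of_real_divide of_real_add)
  also have "\<dots> = decay_const K q"
    unfolding decay_const_def pmass_def
    using nn_integral_shift[of "\<lambda>t. ennreal (norm (complex_of_real (K / (1 + \<bar>t\<bar>))) powr q)" x] by simp
  finally show ?thesis .
qed

lemma Lp_decay:
  assumes "1 < q" "g \<in> borel_measurable borel" "\<And>t. norm (g t) \<le> K / (1 + \<bar>t - x\<bar>)"
  shows "g \<in> Lp q"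
proof (rule LpI)
  have "0 \<le> K"
    using order_trans[OF norm_ge_zero assms(3), of x] by simp
  then show "pmass q g < \<infinity>"
    using pmass_decay_le[of q g K x] decay_const_finite[of q K] assms by (simp add: le_less_trans)
qed (use assms in auto)

lemma conj_exponent:
  assumes "1 < (p::real)"
  obtains q where "1 < q" "1 / p + 1 / q = (1::real)"
proof
  show "1 < p / (p - 1)" "1 / p + 1 / (p / (p - 1)) = 1"
    using assms by (auto simp: field_simps)
qed

lemma Lp_mult_decay_integrable:
  assumes "f \<in> Lp p" "1 < p" "g \<in> borel_measurable borel" "\<And>t. norm (g t) \<le> K / (1 + \<bar>t - x\<bar>)"
  shows "integrable lborel (\<lambda>t. f t * g t)"
proof -
  obtain q where "1 < q" "1 / p + 1 / q = (1::real)"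
    using conj_exponent assms(2) by blast
  then show ?thesis
    using Lp_mult_integrable[OF assms(1) Lp_decay[OF _ assms(3,4)]] assms(2) by blast
qed

text \<open>What matters is that \<open>B\<close> is uniform in the centre \<open>x\<close>: this is
  the row bound that \<open>integrable_kernel_product\<close> asks for.\<close>

lemma Lp_mult_decay_bound:
  assumes "f \<in> Lp p" "1 < p" "0 \<le> K"
  obtains B where "0 \<le> B" "\<And>(g :: real \<Rightarrow> complex) x. g \<in> borel_measurable borel \<Longrightarrow> (\<And>t. norm (g t) \<le> K / (1 + \<bar>t - x\<bar>)) \<Longrightarrow>
     (LINT t|lborel. norm (f t * g t)) \<le> B"
proof -
  obtain q where q: "1 < q" "1 / p + 1 / q = (1::real)"
    using conj_exponent assms(2) by blast
  define B where "B = enn2real (pmass p f + decay_const K q)"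
  show ?thesis
  proof
    show "0 \<le> B" by (simp add: B_def)
    fix g :: "real \<Rightarrow> complex" and x assume g: "g \<in> borel_measurable borel" "\<And>t. norm (g t) \<le> K / (1 + \<bar>t - x\<bar>)"
    have "(LINT t|lborel. norm (f t * g t)) = enn2real (\<integral>\<^sup>+t. ennreal (norm (f t) * norm (g t)) \<partial>lborel)"
      using g LpD[OF assms(1)] by (subst integral_eq_nn_integral) (auto simp: norm_mult)
    also have "\<dots> \<le> B"
      unfolding B_def
    proof (rule enn2real_mono)
      show "pmass p f + decay_const K q < top"
        using Lp_finite[OF assms(1)] decay_const_finite[OF q(1) assms(3)] by simp
      show "(\<integral>\<^sup>+t. ennreal (norm (f t) * norm (g t)) \<partial>lborel) \<le> pmass p f + decay_const K q"
        by (rule order_trans[OF Young_pmass[OF LpD[OF assms(1)] g(1) assms(2) q]])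
           (intro add_left_mono pmass_decay_le[of q g K x], use q assms g in auto)
    qed
    finally show "(LINT t|lborel. norm (f t * g t)) \<le> B" .
  qed
qed

text \<open>The majorant has finite \<open>q\<close>-mass for every \<open>q > 1\<close>, so the
  kernel pairs with all of \<open>L\<^sup>p\<close>. It is symmetric in \<open>t\<close> and
  \<open>Re z\<close>, hence serves integration in either variable.\<close>

lemma cauchy_kernel_bound:
  assumes "Im z \<noteq> 0"
  shows "norm (1 / (of_real t - z)) \<le> (1 + 1 / \<bar>Im z\<bar>) / (1 + \<bar>t - Re z\<bar>)"
proof -
  have "\<bar>t - Re z\<bar> \<le> norm (of_real t - z)" "\<bar>Im z\<bar> \<le> norm (of_real t - z)"
    using abs_Re_le_cmod[of "of_real t - z"] abs_Im_le_cmod[of "of_real t - z"] by auto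
  moreover from this have "1 \<le> norm (of_real t - z) / \<bar>Im z\<bar>"
    using assms by (simp add: le_divide_eq)
  ultimately have "1 + \<bar>t - Re z\<bar> \<le> (1 + 1 / \<bar>Im z\<bar>) * norm (of_real t - z)"
    by (simp add: algebra_simps)
  moreover have "norm (of_real t - z) > 0"
    using \<open>\<bar>Im z\<bar> \<le> norm (of_real t - z)\<close> assms by linarith
  ultimately show ?thesis
    by (simp add: norm_divide field_simps)
qed

lemma poisson_kernel_nonneg: "0 \<le> s \<Longrightarrow> 0 \<le> poisson_kernel s u"
  by (auto simp: poisson_kernel_def intro!: divide_nonneg_nonneg)

lemma poisson_kernel_measurable [measurable]: "poisson_kernel s \<in> borel_measurable borel"
  unfolding poisson_kernel_def by measurable

lemma poisson_kernel_norm: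
  assumes "0 < s"
  shows "poisson_kernel s u = (s / pi) * norm (1 / (of_real u - \<i> * of_real s)) ^ 2"
  using assms by (simp add: poisson_kernel_def norm_divide cmod_power2 power_divide)

text \<open>By \<open>poisson_kernel_norm\<close> the kernel is a product of two Cauchy kernels; one
  of them cancels the factor \<open>s\<close>, the other supplies the decay.\<close>

lemma poisson_kernel_bound:
  assumes "0 < s"
  shows "poisson_kernel s u \<le> (1 + 1 / s) / (1 + \<bar>u\<bar>)"
proof -
  let ?N = "norm (1 / (of_real u - \<i> * of_real s))"
  have 0: "?N \<le> (1 + 1 / s) / (1 + \<bar>u\<bar>)"
    using cauchy_kernel_bound[of "\<i> * of_real s" u] assms by simp
  have "s \<le> norm (of_real u - \<i> * of_real s)"
    using abs_Im_le_cmod[of "of_real u - \<i> * of_real s"] assms by simp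
  then have 1: "s * ?N \<le> 1"
    using assms by (simp add: norm_divide field_simps)
  have "poisson_kernel s u = (s * ?N) * ?N / pi"
    unfolding poisson_kernel_norm[OF assms] by (simp add: power2_eq_square)
  also have "\<dots> \<le> 1 * ?N / 1"
    using 1 pi_ge_two by (intro frac_le mult_right_mono) auto
  finally show ?thesis using 0 by simp
qed

lemma cauchy_integrable:
  assumes "f \<in> Lp p" "1 < p" "Im z \<noteq> 0"
  shows "integrable lborel (\<lambda>t. f t / (of_real t - z))"
  using Lp_mult_decay_integrable[OF assms(1,2) _ cauchy_kernel_bound[OF assms(3)]]
  by simp

lemma poisson_integrable:
  assumes "f \<in> Lp p" "1 < p" "0 < s"
  shows "integrable lborel (\<lambda>t. of_real (poisson_kernel s (t - x)) * f t)"
proof -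
  have "integrable lborel (\<lambda>t. f t * of_real (poisson_kernel s (t - x)))"
    using assms poisson_kernel_bound[OF assms(3)] poisson_kernel_nonneg[of s]
    by (intro Lp_mult_decay_integrable[OF assms(1,2), where x = x]) auto
  then show ?thesis by (simp add: mult.commute)
qed

lemma cauchy_tr_measurable [measurable]:
  assumes [measurable]: "f \<in> borel_measurable borel"
  shows "(\<lambda>x. cauchy_tr f (Complex x y)) \<in> borel_measurable borel"
proof -
  have [measurable]: "(\<lambda>x. Complex x y) \<in> borel_measurable borel"
    unfolding Complex_eq by measurable
  show ?thesis
    unfolding cauchy_tr_def by measurable
qed

lemma poisson_measurable [measurable]:
  assumes [measurable]: "f \<in> borel_measurable borel"
  shows "(\<lambda>x. poisson f s x) \<in> borel_measurable borel"
  unfolding poisson_def by measurable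

subsection \<open>Integrals of kernel products\<close>

lemma of_real_neq_nonreal: "Im z \<noteq> 0 \<Longrightarrow> of_real t \<noteq> z" "Im z \<noteq> 0 \<Longrightarrow> of_real t - z \<noteq> 0"
  by (auto simp: complex_eq_iff)

lemma cauchy_kernel_Lp:
  assumes "1 < p" "Im z \<noteq> 0"
  shows "(\<lambda>t. 1 / (of_real t - z)) \<in> Lp p"
  by (rule Lp_decay[OF assms(1) _ cauchy_kernel_bound[OF assms(2)]]) auto

lemma cauchy_kernel_product_integrable:
  assumes "Im a \<noteq> 0" "Im b \<noteq> 0"
  shows "integrable lborel (\<lambda>t. 1 / ((of_real t - a) * (of_real t - b)))"
  using Lp_mult_integrable[OF cauchy_kernel_Lp[of 2 a] cauchy_kernel_Lp[of 2 b]] assms by simp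

lemma tendsto_integral_symmetric:
  fixes k :: "real \<Rightarrow> complex"
  assumes "integrable lborel k"
  shows "((\<lambda>R. LINT t|lborel. indicator {-R..R} t *\<^sub>R k t) \<longlongrightarrow> integral\<^sup>L lborel k) at_top"
proof (rule integral_dominated_convergence_at_top)
  show "\<forall>\<^sub>F R in at_top. AE t in lborel. norm (indicator {-R..R} t *\<^sub>R k t) \<le> norm (k t)"
    by (intro always_eventually allI AE_I2) (auto split: split_indicator)
  show "AE t in lborel. ((\<lambda>R. indicator {-R..R} t *\<^sub>R k t) \<longlongrightarrow> k t) at_top"
  proof (rule AE_I2)
    fix t
    have "\<forall>\<^sub>F R in at_top. k t = indicator {-R..R} t *\<^sub>R k t"
      using eventually_ge_at_top[of "\<bar>t\<bar>"] by eventually_elim (auto split: split_indicator)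
    then show "((\<lambda>R. indicator {-R..R} t *\<^sub>R k t) \<longlongrightarrow> k t) at_top"
      by (rule Lim_transform_eventually[OF tendsto_const])
  qed
  show *: "k \<in> borel_measurable lborel"
    by (rule borel_measurable_integrable[OF assms])
  show "(\<lambda>t. indicator {-R..R} t *\<^sub>R k t) \<in> borel_measurable lborel" for R
    using * by (intro borel_measurable_scaleR borel_measurable_indicator) auto
qed (rule integrable_norm[OF assms])

text \<open>A limit is asked only of the difference of the values of \<open>F\<close> at
  \<open>R\<close> and \<open>-R\<close>: a single logarithm diverges at either end, and the
  abstract primitive of a contour argument is controlled only through this difference.\<close>

lemma integral_real_line_FTC:
  fixes k F :: "complex \<Rightarrow> complex"
  assumes "integrable lborel (\<lambda>t. k (of_real t))" "continuous_on UNIV (\<lambda>t. k (of_real t))"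
    and "\<And>t. (F has_field_derivative k (of_real t)) (at (of_real t))"
    and "((\<lambda>R. F (of_real R) - F (- of_real R)) \<longlongrightarrow> L) at_top"
  shows "(LINT t|lborel. k (of_real t)) = L"
proof -
  have "(LINT t|lborel. indicator {-R..R} t *\<^sub>R k (of_real t)) = F (of_real R) - F (- of_real R)" if "0 \<le> R" for R
  proof -
    have "(LINT t|lborel. indicator {-R..R} t *\<^sub>R k (of_real t)) = F (of_real R) - F (of_real (- R))"
    proof (rule integral_FTC_atLeastAtMost)
      show "((\<lambda>t. F (of_real t)) has_vector_derivative k (of_real t)) (at t within {-R..R})" for t
        by (rule has_vector_derivative_real_field[OF assms(3)])
    qed (use that assms(2) in \<open>auto intro: continuous_on_subset\<close>)
    then show ?thesis by simp
  qed
  then have "((\<lambda>R. LINT t|lborel. indicator {-R..R} t *\<^sub>R k (of_real t)) \<longlongrightarrow> L) at_top"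
    by (intro Lim_transform_eventually[OF assms(4)] eventually_mono[OF eventually_ge_at_top[of 0]]) auto
  then show ?thesis
    using tendsto_unique[OF _ tendsto_integral_symmetric[OF assms(1)]] trivial_limit_at_top_linorder by blast
qed

text \<open>After factoring out \<open>R\<close> the real logarithms \<open>ln R\<close> cancel.
  What remains is the half turn from \<open>- (R + a)\<close> to \<open>R + a\<close>, whose
  direction is decided by the side of the real axis on which \<open>a\<close> lies.\<close>

lemma Ln_symmetric_limit:
  assumes "Im a \<noteq> 0"
  shows "((\<lambda>R. Ln (of_real R - a) - Ln (- of_real R - a)) \<longlongrightarrow> of_real (sgn (Im a) * pi) * \<i>) at_top"
proof -
  have "((\<lambda>R. a * of_real (inverse R)) \<longlongrightarrow> a * of_real 0) at_top"
    by (intro tendsto_intros tendsto_inverse_0_at_top filterlim_ident)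
  then have *: "((\<lambda>R. a * of_real (inverse R)) \<longlongrightarrow> 0) at_top"
    by simp
  have "((\<lambda>R. Ln (1 - a * of_real (inverse R)) - Ln (1 + a * of_real (inverse R)) + of_real (sgn (Im a) * pi) * \<i>)
      \<longlongrightarrow> Ln (1 - 0) - Ln (1 + 0) + of_real (sgn (Im a) * pi) * \<i>) at_top"
    by (intro tendsto_intros *) auto
  moreover have "\<forall>\<^sub>F R in at_top. Ln (1 - a * of_real (inverse R)) - Ln (1 + a * of_real (inverse R)) + of_real (sgn (Im a) * pi) * \<i>
     = Ln (of_real R - a) - Ln (- of_real R - a)"
    using eventually_gt_at_top[of 0]
  proof eventually_elim
    case (elim R)
    have nz: "1 - a * of_real (inverse R) \<noteq> 0" "1 + a * of_real (inverse R) \<noteq> 0" "of_real R + a \<noteq> 0"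
      using assms elim by (auto simp: complex_eq_iff)
    have "Ln (of_real R - a) = Ln (of_real R * (1 - a * of_real (inverse R)))"
      using elim by (simp add: algebra_simps)
    also have "\<dots> = of_real (ln R) + Ln (1 - a * of_real (inverse R))"
      using nz elim by (subst Ln_times_of_real) (auto simp: Ln_of_real)
    finally have 1: "Ln (of_real R - a) = of_real (ln R) + Ln (1 - a * of_real (inverse R))" .
    have "Ln (of_real R + a) = Ln (of_real R * (1 + a * of_real (inverse R)))"
      using elim by (simp add: algebra_simps)
    also have "\<dots> = of_real (ln R) + Ln (1 + a * of_real (inverse R))"
      using nz elim by (subst Ln_times_of_real) (auto simp: Ln_of_real)
    finally have 2: "Ln (of_real R + a) = of_real (ln R) + Ln (1 + a * of_real (inverse R))" .
    have "Ln (- of_real R - a) = Ln (- (of_real R + a))"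
      by simp
    also have "\<dots> = Ln (of_real R + a) - of_real (sgn (Im a) * pi) * \<i>"
      using assms by (subst Ln_minus[OF nz(3)]) (auto simp: sgn_if)
    finally show ?case using 1 2 by simp
  qed
  ultimately show ?thesis
    by (auto intro: Lim_transform_eventually)
qed

text \<open>Partial fractions and logarithmic primitives take the place of residues: poles on the
  same side give \<open>0\<close>, poles on opposite sides give a multiple of
  \<open>2 * pi * \<i> / (a - b)\<close>.\<close>

lemma integral_cauchy_kernel_product:
  assumes "Im a \<noteq> 0" "Im b \<noteq> 0"
  shows "(LINT t|lborel. 1 / ((of_real t - a) * (of_real t - b))) =
     of_real ((sgn (Im a) - sgn (Im b)) * pi) * \<i> / (a - b)"
proof (cases "a = b")
  case False
  have "(LINT t|lborel. 1 / ((of_real t - a) * (of_real t - b))) =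
      (of_real (sgn (Im a) * pi) * \<i> - of_real (sgn (Im b) * pi) * \<i>) / (a - b)"
  proof (rule integral_real_line_FTC[where F = "\<lambda>z. (Ln (z - a) - Ln (z - b)) / (a - b)" and k = "\<lambda>z. 1 / ((z - a) * (z - b))"])
    fix t
    have "of_real t - a \<notin> \<real>\<^sub>\<le>\<^sub>0" "of_real t - b \<notin> \<real>\<^sub>\<le>\<^sub>0"
      using assms by (auto simp: complex_nonpos_Reals_iff)
    then show "((\<lambda>z. (Ln (z - a) - Ln (z - b)) / (a - b)) has_field_derivative 1 / ((of_real t - a) * (of_real t - b))) (at (of_real t))"
      using assms False of_real_neq_nonreal
      by (auto intro!: derivative_eq_intros simp: divide_simps)
  next
    have "((\<lambda>R. ((Ln (of_real R - a) - Ln (- of_real R - a)) - (Ln (of_real R - b) - Ln (- of_real R - b))) / (a - b))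
       \<longlongrightarrow> (of_real (sgn (Im a) * pi) * \<i> - of_real (sgn (Im b) * pi) * \<i>) / (a - b)) at_top"
      using False by (intro tendsto_intros Ln_symmetric_limit assms) auto
    then show "((\<lambda>R. (Ln (of_real R - a) - Ln (of_real R - b)) / (a - b) - (Ln (- of_real R - a) - Ln (- of_real R - b)) / (a - b))
       \<longlongrightarrow> (of_real (sgn (Im a) * pi) * \<i> - of_real (sgn (Im b) * pi) * \<i>) / (a - b)) at_top"
      unfolding diff_divide_distrib[symmetric] by (simp add: algebra_simps)
  next
    show "continuous_on UNIV (\<lambda>t. 1 / ((complex_of_real t - a) * (complex_of_real t - b)))"
      using assms of_real_neq_nonreal by (auto intro!: continuous_intros)
  qed (rule cauchy_kernel_product_integrable[OF assms])
  then show ?thesis by (simp add: algebra_simps)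
next
  \<comment> \<open>For a double pole the partial fractions degenerate and the primitive is
    rational; the claimed value is \<open>0\<close> because the two signs agree.\<close>
  case True
  have "(LINT t|lborel. 1 / ((of_real t - a) * (of_real t - b))) = 0"
  proof (rule integral_real_line_FTC[where F = "\<lambda>z. - (1 / (z - a))" and k = "\<lambda>z. 1 / ((z - a) * (z - b))"])
    fix t
    show "((\<lambda>z. - (1 / (z - a))) has_field_derivative 1 / ((of_real t - a) * (of_real t - b))) (at (of_real t))"
      using assms of_real_neq_nonreal
      by (auto intro!: derivative_eq_intros simp: True)
  next
    have "filterlim (\<lambda>R. of_real R - a) at_infinity at_top" "filterlim (\<lambda>R. - of_real R - a) at_infinity at_top"
    proof -
      have top: "filterlim (\<lambda>R. - norm a + R) at_top at_top"
        by (intro filterlim_tendsto_add_at_top[OF tendsto_const filterlim_ident])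
      have "\<forall>\<^sub>F R in at_top. - norm a + R \<le> norm (of_real R - a)" "\<forall>\<^sub>F R in at_top. - norm a + R \<le> norm (- of_real R - a)"
      proof (safe intro!: always_eventually)
        fix R :: real
        show "- norm a + R \<le> norm (of_real R - a)"
          using norm_triangle_ineq2[of "of_real R" a] by simp
        show "- norm a + R \<le> norm (- of_real R - a)"
          using norm_triangle_ineq2[of "- of_real R" a] by simp
      qed
      then show "filterlim (\<lambda>R. of_real R - a) at_infinity at_top" "filterlim (\<lambda>R. - of_real R - a) at_infinity at_top"
        unfolding filterlim_at_infinity_conv_norm_at_top by (auto intro: filterlim_at_top_mono[OF top])
    qed
    then have "((\<lambda>R. 1 / (- of_real R - a) - 1 / (of_real R - a)) \<longlongrightarrow> 0 - 0) at_top"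
      by (intro tendsto_diff tendsto_divide_0[OF tendsto_const])
    then show "((\<lambda>R. - (1 / (of_real R - a)) - - (1 / (- of_real R - a))) \<longlongrightarrow> 0) at_top"
      by simp
  next
    show "continuous_on UNIV (\<lambda>t. 1 / ((complex_of_real t - a) * (complex_of_real t - b)))"
      using assms of_real_neq_nonreal by (auto intro!: continuous_intros)
  qed (rule cauchy_kernel_product_integrable[OF assms])
  then show ?thesis by (simp add: True)
qed

section \<open>The Poisson kernel: total mass, contraction property, composition with the Cauchy
  transform\<close>

lemma poisson_kernel_factor:
  assumes "0 < s"
  shows "complex_of_real (poisson_kernel s (t - x)) =
    of_real (s / pi) * (1 / ((of_real x - Complex t s) * (of_real x - Complex t (- s))))"
proof -
  have "(of_real x - Complex t s) * (of_real x - Complex t (- s)) = of_real ((t - x)\<^sup>2 + s\<^sup>2)"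
    by (simp add: complex_eq_iff power2_eq_square algebra_simps)
  then show ?thesis by (simp only: poisson_kernel_def) simp
qed

lemma poisson_kernel_integrable: "0 < s \<Longrightarrow> integrable lborel (\<lambda>x. poisson_kernel s (t - x))"
  and poisson_kernel_integral: "0 < s \<Longrightarrow> (LINT x|lborel. poisson_kernel s (t - x)) = 1"
proof -
  assume s: "0 < s"
  have int: "integrable lborel (\<lambda>x. complex_of_real (poisson_kernel s (t - x)))"
    unfolding poisson_kernel_factor[OF s] using s
    by (intro integrable_mult_right cauchy_kernel_product_integrable) auto
  from integrable_Re[OF this] show "integrable lborel (\<lambda>x. poisson_kernel s (t - x))"
    by simp
  have "complex_of_real (LINT x|lborel. poisson_kernel s (t - x)) = (LINT x|lborel. complex_of_real (poisson_kernel s (t - x)))"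
    by (rule integral_complex_of_real[symmetric])
  also have "\<dots> = of_real (s / pi) * (of_real (2 * pi) * \<i> / (Complex t s - Complex t (- s)))"
    unfolding poisson_kernel_factor[OF s] using s
    by (subst integral_mult_right_zero, subst integral_cauchy_kernel_product) auto
  also have "Complex t s - Complex t (- s) = of_real (2 * s) * \<i>"
    by (simp add: complex_eq_iff)
  also have "of_real (s / pi) * (of_real (2 * pi) * \<i> / (of_real (2 * s) * \<i>)) = complex_of_real 1"
    using s by (simp add: field_simps)
  finally show "(LINT x|lborel. poisson_kernel s (t - x)) = 1"
    by (simp only: of_real_eq_iff)
qed

lemma poisson_kernel_commute: "poisson_kernel s (t - x) = poisson_kernel s (x - t)"
  by (simp add: poisson_kernel_def power2_commute)

lemma poisson_kernel_nn_integral: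
  "0 < s \<Longrightarrow> (\<integral>\<^sup>+x. ennreal (poisson_kernel s (t - x)) \<partial>lborel) = 1"
  using poisson_kernel_integral[of s t] poisson_kernel_nonneg[of s]
  by (subst nn_integral_eq_integral) (auto intro: poisson_kernel_integrable)

text \<open>The convex function \<open>a powr p\<close> lies above its tangent at \<open>u\<close>.
  With \<open>u\<close> the mean of \<open>norm f\<close>, integrating the tangent proves Jensen's
  inequality for the probability density \<open>poisson_kernel\<close>.\<close>

lemma powr_tangent:
  fixes a u p :: real
  assumes "1 < p" "0 \<le> a" "0 \<le> u"
  shows "p * u powr (p - 1) * a \<le> a powr p + (p - 1) * u powr p"
proof -
  have "a * u powr (p - 1) \<le> a powr p / p + (u powr (p - 1)) powr (p / (p - 1)) / (p / (p - 1))"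
    using assms by (intro Youngs_inequality) (auto simp: field_simps)
  also have "(u powr (p - 1)) powr (p / (p - 1)) = u powr p"
    using assms by (simp add: powr_powr)
  finally show ?thesis
    using assms by (simp add: field_simps)
qed

lemma poisson_powr_le:
  assumes "f \<in> Lp p" "1 < p" "0 < s"
  shows "norm (poisson f s x) powr p \<le> (LINT t|lborel. poisson_kernel s (t - x) * norm (f t) powr p)" (is "_ \<le> ?R")
    and "integrable lborel (\<lambda>t. poisson_kernel s (t - x) * norm (f t) powr p)"
proof -
  let ?k = "\<lambda>t. poisson_kernel s (t - x)"
  define U where "U = (LINT t|lborel. ?k t * norm (f t))"
  note [measurable] = LpD[OF assms(1)]
  have int: "integrable lborel (\<lambda>t. ?k t * norm (f t))"
    using integrable_norm[OF poisson_integrable[OF assms, of x]] assms poisson_kernel_nonneg[of s]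
    by (simp add: norm_mult)
  have k: "integrable lborel ?k" "(LINT t|lborel. ?k t) = 1"
    using poisson_kernel_integrable[OF assms(3), of x] poisson_kernel_integral[OF assms(3), of x]
    by (auto simp: poisson_kernel_commute)
  show int2: "integrable lborel (\<lambda>t. ?k t * norm (f t) powr p)"
  proof (rule Bochner_Integration.integrable_bound)
    show "integrable lborel (\<lambda>t. (1 + 1 / s) * norm (f t) powr p)"
      by (intro integrable_mult_right Lp_powr_integrable assms)
    show "AE t in lborel. norm (?k t * norm (f t) powr p) \<le> norm ((1 + 1 / s) * norm (f t) powr p)"
    proof (rule AE_I2)
      fix t
      have "?k t \<le> (1 + 1 / s) / (1 + \<bar>t - x\<bar>)"
        using poisson_kernel_bound[OF assms(3)] .
      also have "\<dots> \<le> (1 + 1 / s) / 1"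
        using assms by (intro divide_left_mono) auto
      finally show "norm (?k t * norm (f t) powr p) \<le> norm ((1 + 1 / s) * norm (f t) powr p)"
        using assms poisson_kernel_nonneg[of s "t - x"] by (auto intro!: mult_right_mono simp: abs_mult)
    qed
  qed simp
  have U0: "0 \<le> U"
    unfolding U_def using assms poisson_kernel_nonneg[of s] by (intro integral_nonneg_AE AE_I2) auto
  have "norm (poisson f s x) \<le> U"
    unfolding poisson_def U_def using poisson_integrable[OF assms, of x] assms poisson_kernel_nonneg[of s]
    by (intro order_trans[OF integral_norm_bound]) (auto simp: norm_mult)
  then have "norm (poisson f s x) powr p \<le> U powr p"
    using assms by (intro powr_mono2) auto
  \<comment> \<open>The tangent is taken at the mean \<open>U\<close> itself, so that its integral
    against a kernel of mass one is exactly \<open>U powr p\<close>.\<close>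
  also have "U powr p = (LINT t|lborel. p * U powr (p - 1) * (?k t * norm (f t)) - (p - 1) * U powr p * ?k t)"
  proof -
    have "U powr p = p * U powr (p - 1) * U - (p - 1) * U powr p"
    proof (cases "U = 0")
      case False
      then show ?thesis using U0 by (simp add: powr_diff algebra_simps)
    qed simp
    then show ?thesis
      using int k by (simp add: U_def)
  qed
  also have "\<dots> \<le> ?R"
  proof (rule integral_mono)
    fix t
    have "p * U powr (p - 1) * norm (f t) - (p - 1) * U powr p \<le> norm (f t) powr p"
      using powr_tangent[OF assms(2) norm_ge_zero U0, of "f t"] by simp
    from mult_left_mono[OF this, of "?k t"]
    show "p * U powr (p - 1) * (?k t * norm (f t)) - (p - 1) * U powr p * ?k t \<le> ?k t * norm (f t) powr p"
      using assms poisson_kernel_nonneg[of s "t - x"] by (simp add: algebra_simps)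
  qed (use int k int2 in auto)
  finally show "norm (poisson f s x) powr p \<le> ?R" .
qed

text \<open>Jensen's inequality pointwise, then Tonelli: the kernel has mass one in \<open>x\<close>
  as well as in \<open>t\<close>.\<close>

lemma poisson_contraction:
  assumes "f \<in> Lp p" "1 < p" "0 < s"
  shows "pmass p (poisson f s) \<le> pmass p f"
proof -
  note [measurable] = LpD[OF assms(1)]
  have "pmass p (poisson f s) \<le> (\<integral>\<^sup>+x. \<integral>\<^sup>+t. ennreal (poisson_kernel s (t - x)) * ennreal (norm (f t) powr p) \<partial>lborel \<partial>lborel)"
    unfolding pmass_def
  proof (rule nn_integral_mono)
    fix x
    have "ennreal (norm (poisson f s x) powr p) \<le> ennreal (LINT t|lborel. poisson_kernel s (t - x) * norm (f t) powr p)"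
      by (intro ennreal_leI poisson_powr_le assms)
    also have "\<dots> = (\<integral>\<^sup>+t. ennreal (poisson_kernel s (t - x) * norm (f t) powr p) \<partial>lborel)"
      using assms poisson_kernel_nonneg[of s]
      by (subst nn_integral_eq_integral) (auto intro: poisson_powr_le)
    also have "\<dots> = (\<integral>\<^sup>+t. ennreal (poisson_kernel s (t - x)) * ennreal (norm (f t) powr p) \<partial>lborel)"
      using assms poisson_kernel_nonneg[of s] by (intro nn_integral_cong ennreal_mult) auto
    finally show "ennreal (norm (poisson f s x) powr p) \<le> \<dots>" .
  qed
  also have "\<dots> = (\<integral>\<^sup>+t. \<integral>\<^sup>+x. ennreal (poisson_kernel s (t - x)) * ennreal (norm (f t) powr p) \<partial>lborel \<partial>lborel)"
    by (rule lborel_pair.Fubini'[symmetric]) auto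
  also have "\<dots> = pmass p f"
    unfolding pmass_def using poisson_kernel_nn_integral[OF assms(3)]
    by (simp add: nn_integral_multc)
  finally show ?thesis .
qed

lemma poisson_Lp:
  assumes "f \<in> Lp p" "1 < p" "0 < s"
  shows "poisson f s \<in> Lp p"
  using poisson_contraction[OF assms] Lp_finite[OF assms(1)] LpD[OF assms(1)]
  by (intro LpI) auto

text \<open>As a function of \<open>x\<close>, \<open>1 / (x - z)\<close> extends to a bounded
  holomorphic function on the lower half-plane, so its Poisson integral at height \<open>s\<close>
  is its value at \<open>t - \<i> * s\<close>.\<close>

lemma poisson_cauchy_kernel:
  assumes "0 < s" "0 < Im z"
  shows "(LINT x|lborel. of_real (poisson_kernel s (t - x)) / (of_real x - z)) = 1 / (of_real t - (z + \<i> * of_real s))"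
proof -
  define a b where "a = Complex t s" and "b = Complex t (- s)"
  have ab: "a - b = of_real (2 * s) * \<i>"
    by (simp add: a_def b_def complex_eq_iff)
  have "a - b \<noteq> 0"
    using assms unfolding ab by simp
  have "z - b \<noteq> 0"
    using assms by (auto simp: b_def complex_eq_iff)
  \<comment> \<open>Partial fractions in the poles \<open>a\<close> and \<open>b\<close> of the
    Poisson kernel. The pair \<open>a\<close>, \<open>z\<close> lies in the upper half-plane and
    contributes nothing; only the pair \<open>z\<close>, \<open>b\<close> is separated by the real
    axis.\<close>
  have pf: "of_real (poisson_kernel s (t - x)) / (of_real x - z) =
    of_real (s / pi) / (a - b) * (1 / ((of_real x - a) * (of_real x - z)) - 1 / ((of_real x - z) * (of_real x - b)))" for x :: real
  proof -
    define A B Z where "A = of_real x - a" and "B = of_real x - b" and "Z = of_real x - z"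
    have "A \<noteq> 0" "B \<noteq> 0" "Z \<noteq> 0"
      unfolding A_def B_def Z_def using assms by (auto simp: a_def b_def complex_eq_iff)
    moreover have "a - b = B - A"
      by (simp add: A_def B_def)
    moreover have "B - A \<noteq> 0"
      using \<open>a - b \<noteq> 0\<close> calculation by simp
    ultimately show ?thesis
      unfolding poisson_kernel_factor[OF assms(1)] a_def[symmetric] b_def[symmetric]
        A_def[symmetric] B_def[symmetric] Z_def[symmetric]
      by (simp add: divide_simps)
  qed
  have "Im a \<noteq> 0" "Im b \<noteq> 0" "Im z \<noteq> 0"
    using assms by (auto simp: a_def b_def)
  note int = cauchy_kernel_product_integrable[OF this(1,3)] cauchy_kernel_product_integrable[OF this(3,2)]
    and val = integral_cauchy_kernel_product[OF this(1,3)] integral_cauchy_kernel_product[OF this(3,2)]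
  have "(LINT x|lborel. of_real (poisson_kernel s (t - x)) / (of_real x - z)) =
    of_real (s / pi) / (a - b) * (0 - of_real (2 * pi) * \<i> / (z - b))"
    unfolding pf using int val assms by (simp add: a_def b_def)
  also have "\<dots> = - (1 / (z - b))"
    unfolding ab using assms \<open>z - b \<noteq> 0\<close> by (simp add: divide_simps)
  also have "\<dots> = 1 / (of_real t - (z + \<i> * of_real s))"
  proof -
    have "of_real t - (z + \<i> * of_real s) = - (z - b)"
      by (simp add: b_def complex_eq_iff)
    then show ?thesis by (simp only: divide_minus_right)
  qed
  finally show ?thesis .
qed

lemma Lp_norm: "f \<in> Lp p \<Longrightarrow> (\<lambda>t. of_real (norm (f t))) \<in> Lp p"
  by (auto simp: Lp_def pmass_def)

lemma cauchy_tr_poisson: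
  assumes "f \<in> Lp p" "1 < p" "0 < s" "0 < Im z"
  shows "cauchy_tr (poisson f s) z = cauchy_tr f (z + \<i> * of_real s)"
proof -
  note [measurable] = LpD[OF assms(1)]
  let ?F = "\<lambda>x t. of_real (poisson_kernel s (t - x)) * f t / (of_real x - z)"
  have "integrable (lborel \<Otimes>\<^sub>M lborel) (case_prod ?F)"
  proof (rule lborel_pair.Fubini_integrable)
    show "case_prod ?F \<in> borel_measurable (lborel \<Otimes>\<^sub>M lborel)"
      by measurable
    \<comment> \<open>Absolute convergence: the inner integral of the norms is the Poisson integral
      of \<open>norm f\<close>, which is again in \<open>L\<^sup>p\<close> and therefore pairs with
      the Cauchy kernel.\<close>
    have "integrable lborel (\<lambda>x. norm (poisson (\<lambda>t. of_real (norm (f t))) s x / (of_real x - z)))"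
      using assms by (intro integrable_norm cauchy_integrable[OF poisson_Lp[OF Lp_norm]]) auto
    moreover have "(LINT t|lborel. norm (?F x t)) = norm (poisson (\<lambda>t. of_real (norm (f t))) s x / (of_real x - z))" for x
    proof -
      have "poisson (\<lambda>t. of_real (norm (f t))) s x = of_real (LINT t|lborel. poisson_kernel s (t - x) * norm (f t))"
        unfolding poisson_def by (simp flip: integral_complex_of_real)
      moreover have "0 \<le> (LINT t|lborel. poisson_kernel s (t - x) * norm (f t))"
        using assms poisson_kernel_nonneg[of s] by (intro integral_nonneg_AE AE_I2) auto
      ultimately show ?thesis
        using assms poisson_kernel_nonneg[of s] by (simp add: norm_divide norm_mult)
    qed
    ultimately show "integrable lborel (\<lambda>x. LINT t|lborel. norm (case_prod ?F (x, t)))"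
      by simp
    show "AE x in lborel. integrable lborel (\<lambda>t. case_prod ?F (x, t))"
      using poisson_integrable[OF assms(1-3)] by simp
  qed
  note swap = lborel_pair.Fubini_integral[OF this]
  have inner: "(LINT x|lborel. ?F x t) = f t / (of_real t - (z + \<i> * of_real s))" for t
  proof -
    have "(LINT x|lborel. ?F x t) = (LINT x|lborel. f t * (of_real (poisson_kernel s (t - x)) / (of_real x - z)))"
      by (simp add: mult.commute)
    also have "\<dots> = f t * (1 / (of_real t - (z + \<i> * of_real s)))"
      by (simp only: integral_mult_right_zero poisson_cauchy_kernel[OF assms(3,4)])
    finally show ?thesis by simp
  qed
  have "cauchy_tr (poisson f s) z = (LINT x|lborel. LINT t|lborel. ?F x t)"
    by (simp add: cauchy_tr_def poisson_def)
  also have "\<dots> = (LINT t|lborel. LINT x|lborel. ?F x t)"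
    using swap by simp
  also have "\<dots> = cauchy_tr f (z + \<i> * of_real s)"
    unfolding cauchy_tr_def by (simp only: inner)
  finally show ?thesis .
qed

text \<open>The form in which Fubini's theorem is prepared below: an integrable weight in one
  variable and rows that are uniformly bounded in \<open>L\<^sup>1\<close> in the other.\<close>

lemma integrable_kernel_product:
  fixes a :: "real \<Rightarrow> complex" and k :: "real \<Rightarrow> real \<Rightarrow> complex"
  assumes a: "integrable lborel a" and [measurable]: "case_prod k \<in> borel_measurable (lborel \<Otimes>\<^sub>M lborel)"
    and k: "\<And>x. integrable lborel (k x)" "\<And>x. (LINT u|lborel. norm (k x u)) \<le> B"
  shows "integrable (lborel \<Otimes>\<^sub>M lborel) (\<lambda>(x, u). a x * k x u)"
proof (rule lborel_pair.Fubini_integrable)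
  note [measurable] = borel_measurable_integrable[OF a]
  show "(\<lambda>(x, u). a x * k x u) \<in> borel_measurable (lborel \<Otimes>\<^sub>M lborel)"
    by measurable
  show "AE x in lborel. integrable lborel (\<lambda>u. case (x, u) of (x, u) \<Rightarrow> a x * k x u)"
    using k(1) by (auto intro!: AE_I2 integrable_mult_right)
  show "integrable lborel (\<lambda>x. LINT u|lborel. norm (case (x, u) of (x, u) \<Rightarrow> a x * k x u))"
  proof (rule Bochner_Integration.integrable_bound)
    show "integrable lborel (\<lambda>x. norm (a x) * B)"
      using a by (intro integrable_mult_left integrable_norm)
    show "AE x in lborel. norm (LINT u|lborel. norm (case (x, u) of (x, u) \<Rightarrow> a x * k x u)) \<le> norm (norm (a x) * B)"
    proof (rule AE_I2)
      fix x
      have "0 \<le> (LINT u|lborel. norm (k x u))" by simp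
      moreover from this have "0 \<le> B" using k(2)[of x] by linarith
      ultimately show "norm (LINT u|lborel. norm (case (x, u) of (x, u) \<Rightarrow> a x * k x u)) \<le> norm (norm (a x) * B)"
        using mult_left_mono[OF k(2)[of x] norm_ge_zero[of "a x"]] by (simp add: norm_mult abs_mult)
    qed
  qed measurable
qed

text \<open>The companion of \<open>cauchy_tr_poisson\<close>, with the average taken after the
  transform. The roles in Fubini change: the Poisson kernel is the integrable weight, and the rows
  are \<open>f\<close> times a Cauchy kernel.\<close>

lemma poisson_cauchy_tr:
  assumes "f \<in> Lp p" "1 < p" "0 < s" "0 < y"
  shows "poisson (\<lambda>x. cauchy_tr f (Complex x y)) s x = cauchy_tr f (Complex x (y + s))"
proof -
  note [measurable] = LpD[OF assms(1)]
  have [measurable]: "(\<lambda>x. Complex x y) \<in> borel_measurable borel"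
    unfolding Complex_eq by measurable
  let ?F = "\<lambda>\<xi> t. of_real (poisson_kernel s (\<xi> - x)) * (f t / (of_real t - Complex \<xi> y))"
  have K: "0 \<le> 1 + 1 / y" using assms by simp
  obtain B where B: "0 \<le> B" "\<And>(g :: real \<Rightarrow> complex) x. g \<in> borel_measurable borel \<Longrightarrow>
      (\<And>t. norm (g t) \<le> (1 + 1 / y) / (1 + \<bar>t - x\<bar>)) \<Longrightarrow> (LINT t|lborel. norm (f t * g t)) \<le> B"
    using Lp_mult_decay_bound[OF assms(1,2) K] by blast
  have bd: "(LINT t|lborel. norm (f t / (of_real t - Complex \<xi> y))) \<le> B" for \<xi>
    using B(2)[of "\<lambda>t. 1 / (of_real t - Complex \<xi> y)" \<xi>] cauchy_kernel_bound[of "Complex \<xi> y"] assms by simp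
  have "integrable (lborel \<Otimes>\<^sub>M lborel) (case_prod ?F)"
  proof (rule integrable_kernel_product)
    show "integrable lborel (\<lambda>\<xi>. complex_of_real (poisson_kernel s (\<xi> - x)))"
      using poisson_kernel_integrable[OF assms(3), of x] by (intro integrable_of_real) (simp add: poisson_kernel_commute)
    show "integrable lborel (\<lambda>t. f t / (of_real t - Complex \<xi> y))" for \<xi>
      using assms by (intro cauchy_integrable[OF assms(1,2)]) auto
  qed (measurable, rule bd)
  note swap = lborel_pair.Fubini_integral[OF this]
  have inner: "(LINT \<xi>|lborel. ?F \<xi> t) = f t / (of_real t - Complex x (y + s))" for t
  proof -
    have "(LINT \<xi>|lborel. ?F \<xi> t) = (LINT \<xi>|lborel. f t * (of_real (poisson_kernel s (\<xi> - x)) / (of_real t - Complex \<xi> y)))"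
      by (simp add: mult.commute)
    also have "\<dots> = f t * (LINT \<xi>|lborel. of_real (poisson_kernel s (\<xi> - x)) / (of_real t - Complex \<xi> y))"
      by (rule integral_mult_right_zero)
    \<comment> \<open>The reflection of \<xi> to \<open>x + t - \<xi>\<close> exchanges the
      arguments of the two kernels and produces the integral of
      \<open>poisson_cauchy_kernel\<close>.\<close>
    also have "(LINT \<xi>|lborel. of_real (poisson_kernel s (\<xi> - x)) / (of_real t - Complex \<xi> y)) =
        (LINT \<xi>|lborel. of_real (poisson_kernel s ((x + t + (- 1) * \<xi>) - x)) / (of_real t - Complex (x + t + (- 1) * \<xi>) y))"
      by (subst lborel_integral_real_affine[where c = "- 1" and t = "x + t"]) simp_all
    also have "\<dots> = (LINT \<xi>|lborel. of_real (poisson_kernel s (t - \<xi>)) / (of_real \<xi> - Complex x y))"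
      by (intro Bochner_Integration.integral_cong refl arg_cong2[where f = "(/)"] arg_cong[where f = "\<lambda>x. of_real (poisson_kernel s x)"])
         (auto simp: complex_eq_iff)
    also have "\<dots> = 1 / (of_real t - (Complex x y + \<i> * of_real s))"
      using assms by (intro poisson_cauchy_kernel) auto
    also have "Complex x y + \<i> * of_real s = Complex x (y + s)"
      by (simp add: complex_eq_iff)
    finally show ?thesis by simp
  qed
  have "poisson (\<lambda>x. cauchy_tr f (Complex x y)) s x = (LINT \<xi>|lborel. LINT t|lborel. ?F \<xi> t)"
    unfolding cauchy_tr_def poisson_def by (simp only: integral_mult_right_zero)
  also have "\<dots> = (LINT t|lborel. LINT \<xi>|lborel. ?F \<xi> t)"
    using swap by simp
  also have "\<dots> = cauchy_tr f (Complex x (y + s))"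
    unfolding cauchy_tr_def by (simp only: inner)
  finally show ?thesis .
qed

subsection \<open>\<open>L\<^sup>p\<close> bounds for the Cauchy transform\<close>

text \<open>Differentiation under the integral sign by an exact second-order expansion of
  \<open>1 / (t - w)\<close> at \<open>z\<close>: the error of the difference quotient is
  \<open>w - z\<close> times an integral that stays bounded near \<open>z\<close>.\<close>

lemma cauchy_tr_has_field_derivative:
  assumes f: "f \<in> Lp p" "1 < p" and z: "0 < Im z"
  shows "(cauchy_tr f has_field_derivative (LINT t|lborel. f t / (of_real t - z)^2)) (at z)"
proof -
  note [measurable] = LpD[OF f(1)]
  have far: "Im w \<le> norm (of_real t - w)" for w t
    using abs_Im_le_cmod[of "of_real t - w"] by simp
  have int: "integrable lborel (\<lambda>t. f t / (of_real t - w))" if "0 < Im w" for w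
    using cauchy_integrable[OF f] that by simp
  have bounded: "integrable lborel (\<lambda>t. f t / (of_real t - z) * h t)"
    if "h \<in> borel_measurable borel" "\<And>t. norm (h t) \<le> B" for B and h :: "real \<Rightarrow> complex"
  proof (rule Bochner_Integration.integrable_bound)
    show "integrable lborel (\<lambda>t. of_real B * (f t / (of_real t - z)))"
      using int[OF z] by (intro integrable_mult_right)
    show "AE t in lborel. norm (f t / (of_real t - z) * h t) \<le> norm (of_real B * (f t / (of_real t - z)))"
    proof (rule AE_I2)
      fix t
      have "norm (f t / (of_real t - z) * h t) \<le> norm (f t / (of_real t - z)) * \<bar>B\<bar>"
        unfolding norm_mult[of _ "h t"] using that(2)[of t] by (intro mult_left_mono) auto
      then show "norm (f t / (of_real t - z) * h t) \<le> norm (of_real B * (f t / (of_real t - z)))"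
        by (simp only: norm_mult[of "of_real B"] norm_of_real mult.commute)
    qed
  qed (use that in measurable)
  have inv: "norm (1 / (of_real t - w)) \<le> 1 / d" if "0 < d" "d \<le> Im w" for t w d
    using far[of w t] that by (simp add: norm_divide frac_le)
  \<comment> \<open>\<open>K\<close> bounds that remainder integral. The factor
    \<open>2 / Im z\<close> comes from restricting \<open>w\<close> to distance less than
    \<open>Im z / 2\<close> from \<open>z\<close>, which keeps \<open>Im w\<close> above
    \<open>Im z / 2\<close>.\<close>
  define K where "K = (LINT t|lborel. norm (f t / (of_real t - z) * (1 / (of_real t - z)))) * (2 / Im z)"
  have nz: "of_real t - w \<noteq> 0" if "0 < Im w" for w t
    using of_real_neq_nonreal(2)[of w t] that by auto
  show ?thesis
    unfolding has_field_derivative_iff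
  proof (rule Lim_null_comparison[THEN LIM_zero_cancel])
    show "\<forall>\<^sub>F w in at z. norm ((cauchy_tr f w - cauchy_tr f z) / (w - z) - (LINT t|lborel. f t / (of_real t - z)^2)) \<le> norm (w - z) * K"
      unfolding eventually_at
    proof (intro exI[of _ "Im z / 2"] conjI ballI impI)
      fix w assume w: "w \<noteq> z \<and> dist w z < Im z / 2"
      have "\<bar>Im (w - z)\<bar> \<le> norm (w - z)"
        by (rule abs_Im_le_cmod)
      then have Imw: "Im z / 2 \<le> Im w" "0 < Im w"
        using w z by (auto simp: dist_norm)
      have int2: "integrable lborel (\<lambda>t. f t / (of_real t - z) * (1 / (of_real t - z)))"
        using inv[of "Im z" z] z by (intro bounded) auto
      have int3: "integrable lborel (\<lambda>t. f t / (of_real t - z) * (1 / (of_real t - z)) * (1 / (of_real t - w)))"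
      proof -
        have "integrable lborel (\<lambda>t. f t / (of_real t - z) * (1 / (of_real t - z) * (1 / (of_real t - w))))"
        proof (rule bounded)
          show "norm (1 / (of_real t - z) * (1 / (of_real t - w))) \<le> 1 / Im z * (1 / (Im z / 2))" for t
            unfolding norm_mult using inv[of "Im z" z t] inv[of "Im z / 2" w t] Imw z by (intro mult_mono) auto
        qed auto
        then show ?thesis by (simp add: mult.assoc)
      qed
      have "cauchy_tr f w - cauchy_tr f z = (LINT t|lborel. f t / (of_real t - w) - f t / (of_real t - z))"
        unfolding cauchy_tr_def using int Imw z by (simp add: Bochner_Integration.integral_diff)
      also have "\<dots> = (LINT t|lborel. (w - z) * (f t / (of_real t - z) * (1 / (of_real t - z))) +
           (w - z)^2 * (f t / (of_real t - z) * (1 / (of_real t - z)) * (1 / (of_real t - w))))"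
      proof (intro Bochner_Integration.integral_cong refl)
        fix t
        define A B where "A = of_real t - z" and "B = of_real t - w"
        have "A \<noteq> 0" "B \<noteq> 0" "w - z = A - B"
          using nz[of z t] nz[of w t] z Imw by (auto simp: A_def B_def)
        then show "f t / (of_real t - w) - f t / (of_real t - z) = (w - z) * (f t / (of_real t - z) * (1 / (of_real t - z))) +
           (w - z)^2 * (f t / (of_real t - z) * (1 / (of_real t - z)) * (1 / (of_real t - w)))"
          unfolding A_def[symmetric] B_def[symmetric] by (simp add: divide_simps) (simp add: power2_eq_square algebra_simps)
      qed
      also have "\<dots> = (w - z) * (LINT t|lborel. f t / (of_real t - z) * (1 / (of_real t - z))) +
          (w - z)^2 * (LINT t|lborel. f t / (of_real t - z) * (1 / (of_real t - z)) * (1 / (of_real t - w)))"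
        by (simp only: Bochner_Integration.integral_add[OF integrable_mult_right[OF int2] integrable_mult_right[OF int3]]
            integral_mult_right_zero)
      finally have "(cauchy_tr f w - cauchy_tr f z) / (w - z) - (LINT t|lborel. f t / (of_real t - z)^2) =
          (w - z) * (LINT t|lborel. f t / (of_real t - z) * (1 / (of_real t - z)) * (1 / (of_real t - w)))"
        using w by (simp add: power2_eq_square field_simps)
      moreover have "norm (LINT t|lborel. f t / (of_real t - z) * (1 / (of_real t - z)) * (1 / (of_real t - w))) \<le> K"
      proof -
        have "norm (LINT t|lborel. f t / (of_real t - z) * (1 / (of_real t - z)) * (1 / (of_real t - w))) \<le>
            (LINT t|lborel. norm (f t / (of_real t - z) * (1 / (of_real t - z)) * (1 / (of_real t - w))))"
          by (rule integral_norm_bound)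
        also have "\<dots> \<le> (LINT t|lborel. norm (f t / (of_real t - z) * (1 / (of_real t - z))) * (2 / Im z))"
        proof (rule integral_mono)
          fix t
          show "norm (f t / (of_real t - z) * (1 / (of_real t - z)) * (1 / (of_real t - w)))
            \<le> norm (f t / (of_real t - z) * (1 / (of_real t - z))) * (2 / Im z)"
            using inv[of "Im z / 2" w t] Imw z
            by (subst norm_mult) (intro mult_left_mono, auto)
        qed (use int2 int3 in \<open>auto intro!: integrable_norm integrable_mult_left simp del: times_divide_eq_right\<close>)
        finally show ?thesis by (simp add: K_def)
      qed
      ultimately show "norm ((cauchy_tr f w - cauchy_tr f z) / (w - z) - (LINT t|lborel. f t / (of_real t - z)^2)) \<le> norm (w - z) * K"
        by (simp add: norm_mult mult_left_mono)
    qed (use z in auto)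
    have "((\<lambda>w. norm (w - z) * K) \<longlongrightarrow> norm (z - z) * K) (at z)"
      by (intro tendsto_intros)
    then show "((\<lambda>w. norm (w - z) * K) \<longlongrightarrow> 0) (at z)"
      by simp
  qed
qed

section \<open>Line integrals of decaying holomorphic functions and the pointwise inequality for
  powers\<close>

lemma open_upper_half_plane: "open {z. 0 < Im z}"
  using open_halfspace_Im_gt[of 0] by simp

lemma convex_upper_half_plane: "convex {z. 0 < Im z}"
  using convex_halfspace_Im_gt[of 0] by simp

lemma cauchy_tr_holomorphic:
  assumes "f \<in> Lp p" "1 < p"
  shows "cauchy_tr f holomorphic_on {z. 0 < Im z}"
  using cauchy_tr_has_field_derivative[OF assms] open_upper_half_plane
  by (auto simp: holomorphic_on_open)

text \<open>
  The primitive of \<open>g\<close> replaces a contour integral: moving from \<open>-R + iy\<close> to \<open>R + iy\<close> along three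
  sides of a rectangle changes it by \<open>O(R powr (1 - p))\<close>.
\<close>
lemma horizontal_line_integral_eq_0:
  assumes g: "g holomorphic_on {z. 0 < Im z}" and y: "0 < y"
    and int: "integrable lborel (\<lambda>x. g (Complex x y))" and p: "1 < (p::real)"
    and K: "\<And>z. 0 < Im z \<Longrightarrow> R0 \<le> norm z \<Longrightarrow> norm (g z) \<le> K * norm z powr (- p)"
  shows "(LINT x|lborel. g (Complex x y)) = 0"
proof -
  obtain G where "\<And>z. z \<in> {z. 0 < Im z} \<Longrightarrow> (G has_field_derivative g z) (at z within {z. 0 < Im z})"
    using holomorphic_convex_primitive'[OF convex_upper_half_plane open_upper_half_plane g] by blast
  then have G: "(G has_field_derivative g z) (at z)" if "0 < Im z" for z
    using that open_upper_half_plane by (metis at_within_open mem_Collect_eq)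
  \<comment> \<open>The sign of \<open>K\<close> follows from evaluating the bound at one point that
    is far enough up the imaginary axis.\<close>
  have K0: "0 \<le> K"
  proof -
    have "0 \<le> norm (g (\<i> * of_real (\<bar>R0\<bar> + 1)))" by simp
    also have "\<dots> \<le> K * norm (\<i> * complex_of_real (\<bar>R0\<bar> + 1)) powr (- p)"
      by (rule K) (auto simp: norm_mult simp del: of_real_add)
    finally have "0 \<le> K * (\<bar>R0\<bar> + 1) powr (- p)"
      by (simp add: norm_mult del: of_real_add)
    moreover have "0 < (\<bar>R0\<bar> + 1) powr (- p)"
      by (simp add: add_nonneg_pos)
    ultimately show ?thesis by (simp add: zero_le_mult_iff)
  qed
  have seg: "norm (G a - G b) \<le> K * R powr (- p) * norm (a - b)"
    if R: "0 < R" "R0 \<le> R" and far: "\<And>z. z \<in> closed_segment a b \<Longrightarrow> 0 < Im z \<and> R \<le> norm z" for a b R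
  proof (rule field_differentiable_bound[OF convex_closed_segment])
    fix z assume z: "z \<in> closed_segment a b"
    show "(G has_field_derivative g z) (at z within closed_segment a b)"
      using G far[OF z] by (auto intro: has_field_derivative_at_within)
    have "norm (g z) \<le> K * norm z powr (- p)"
      using K far[OF z] R by auto
    also have "\<dots> \<le> K * R powr (- p)"
      using far[OF z] R K0 p by (intro mult_left_mono powr_mono2') auto
    finally show "norm (g z) \<le> K * R powr (- p)" .
  qed auto
  \<comment> \<open>The detour runs up to height \<open>R\<close>, so every point on it has norm at
    least \<open>R\<close>. It has three sides of length at most \<open>2 * R\<close>, each with
    integrand at most \<open>K * R powr (- p)\<close>; hence the factor \<open>6\<close>.\<close>
  have key: "norm (G (Complex R y) - G (Complex (- R) y)) \<le> 6 * K * R powr (1 - p)"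
    if R: "0 < R" "R0 \<le> R" "y \<le> R" for R
  proof -
    have side: "0 < Im z \<and> R \<le> norm z" if "z \<in> closed_segment (Complex c y) (Complex c R)" "\<bar>c\<bar> = R" for z c
    proof -
      obtain u where u: "0 \<le> u" "u \<le> 1" "z = (1 - u) *\<^sub>R Complex c y + u *\<^sub>R Complex c R"
        using \<open>z \<in> _\<close> unfolding in_segment by blast
      have "(1 - u) * y + u * y \<le> (1 - u) * y + u * R"
        using u R by (intro add_left_mono mult_left_mono) auto
      moreover have "Im z = (1 - u) * y + u * R" "Re z = c"
        unfolding u(3) by (simp_all add: algebra_simps)
      ultimately show ?thesis
        using abs_Re_le_cmod[of z] y that(2) by (simp add: algebra_simps)
    qed
    have top: "0 < Im z \<and> R \<le> norm z" if "z \<in> closed_segment (Complex R R) (Complex (- R) R)" for z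
    proof -
      obtain u where u: "z = (1 - u) *\<^sub>R Complex R R + u *\<^sub>R Complex (- R) R"
        using \<open>z \<in> _\<close> unfolding in_segment by blast
      have "Im z = R"
        unfolding u by (simp add: algebra_simps)
      then show ?thesis
        using abs_Im_le_cmod[of z] R by simp
    qed
    have len: "norm (Complex c y - Complex c R) \<le> 2 * R" for c
    proof -
      have "Complex c y - Complex c R = \<i> * of_real (y - R)" by (simp add: complex_eq_iff)
      then show ?thesis using R y by (simp only: norm_mult norm_of_real) simp
    qed
    have len': "norm (Complex R R - Complex (- R) R) \<le> 2 * R"
    proof -
      have "Complex R R - Complex (- R) R = of_real (2 * R)" by (simp add: complex_eq_iff)
      then show ?thesis using R by (simp only: norm_of_real)
    qed
    let ?M = "K * R powr (- p)"
    have M: "0 \<le> ?M" using K0 by simp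
    have *: "norm (G (Complex c y) - G (Complex c R)) \<le> ?M * (2 * R)" if "\<bar>c\<bar> = R" for c
      using seg[OF R(1,2) side[OF _ that]] mult_left_mono[OF len M] order_trans by blast
    have "norm (G (Complex R R) - G (Complex (- R) R)) \<le> ?M * (2 * R)"
      using seg[OF R(1,2) top] mult_left_mono[OF len' M] order_trans by blast
    with *[of R] *[of "- R"] R have "norm (G (Complex R y) - G (Complex (- R) y)) \<le> 3 * (?M * (2 * R))"
      by (smt (verit) norm_minus_commute norm_triangle_ineq4 norm_triangle_ineq diff_add_eq diff_diff_eq2 norm_diff_triangle_ineq diff_add_cancel)
    also have "\<dots> = 6 * K * R powr (1 - p)"
      using R by (simp add: powr_diff powr_minus divide_inverse)
    finally show ?thesis .
  qed
  have eq: "of_real x + \<i> * of_real y = Complex x y" for x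
    by (simp add: complex_eq_iff)
  have "(LINT x|lborel. g (of_real x + \<i> * of_real y)) = 0"
  proof (rule integral_real_line_FTC[where k = "\<lambda>z. g (z + \<i> * of_real y)" and F = "\<lambda>z. G (z + \<i> * of_real y)"])
    show "integrable lborel (\<lambda>x. g (of_real x + \<i> * of_real y))"
      using int by (simp only: eq)
    have "continuous_on {z. 0 < Im z} g"
      by (rule holomorphic_on_imp_continuous_on[OF g])
    then show "continuous_on UNIV (\<lambda>t. g (of_real t + \<i> * of_real y))"
      by (rule continuous_on_compose2) (use y in \<open>auto intro!: continuous_intros\<close>)
    show "((\<lambda>z. G (z + \<i> * of_real y)) has_field_derivative g (of_real t + \<i> * of_real y)) (at (of_real t))" for t
      using y by (intro DERIV_shift[THEN iffD1] G) auto
    show "((\<lambda>R. G (of_real R + \<i> * of_real y) - G (- of_real R + \<i> * of_real y)) \<longlongrightarrow> 0) at_top"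
    proof (rule Lim_null_comparison)
      have eq': "- of_real R + \<i> * of_real y = Complex (- R) y" for R
        by (simp add: complex_eq_iff)
      show "\<forall>\<^sub>F R in at_top. norm (G (of_real R + \<i> * of_real y) - G (- of_real R + \<i> * of_real y)) \<le> 6 * K * R powr (1 - p)"
        using eventually_ge_at_top[of "max (max R0 y) 1"]
        by eventually_elim (simp only: eq eq', rule key, auto)
      show "((\<lambda>R. 6 * K * R powr (1 - p)) \<longlongrightarrow> 0) at_top"
        using p by (intro tendsto_mult_right_zero tendsto_neg_powr filterlim_ident) auto
    qed
  qed
  then show ?thesis by (simp only: eq)
qed

text \<open>In polar form, with \<theta> the argument of \<open>w\<close>, this is
  \<open>1 \<le> A * cos \<theta> powr p - B * cos (p * \<theta>)\<close> for \<theta> between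
  \<open>0\<close> and \<open>pi / 2\<close>. Away from \<open>pi / 2\<close> the first term can be
  made large; near \<open>pi / 2\<close> the angle \<open>p * \<theta>\<close> lies beyond
  \<open>pi / 2\<close> because \<open>p > 1\<close>, and at most at \<open>pi\<close> because
  \<open>p \<le> 2\<close>, so \<open>cos (p * \<theta>)\<close> is negative and the second term
  helps.\<close>

lemma norm_powr_le_Re_powr:
  assumes "1 < p" "p \<le> (2::real)"
  obtains A B where "0 \<le> A" "0 \<le> B"
    "\<And>w. 0 < Re w \<Longrightarrow> norm w powr p \<le> A * Re w powr p - B * Re (w powr of_real p)"
proof -
  \<comment> \<open>The threshold is the midpoint between \<open>pi / (2 * p)\<close>, where
    \<open>cos (p * \<theta>)\<close> changes sign, and \<open>pi / 2\<close>, where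
    \<open>cos \<theta>\<close> vanishes.\<close>
  define \<theta>0 where "\<theta>0 = (pi / (2 * p) + pi / 2) / 2"
  have lt: "pi / (2 * p) < pi / 2"
    using assms by (intro divide_strict_left_mono) auto
  have t0: "pi / 2 < p * \<theta>0" "\<theta>0 < pi / 2" "0 < \<theta>0"
  proof -
    have "pi / (2 * p) < \<theta>0" using lt by (simp add: \<theta>0_def)
    from mult_strict_left_mono[OF this, of p] show "pi / 2 < p * \<theta>0"
      using assms by simp
    show "\<theta>0 < pi / 2" using lt by (simp add: \<theta>0_def)
    show "0 < \<theta>0" using assms by (simp add: \<theta>0_def add_pos_pos)
  qed
  have pt0: "p * \<theta>0 \<le> pi"
    using mult_mono[of p 2 \<theta>0 "pi / 2"] assms t0 by simp
  define c where "c = - cos (p * \<theta>0)"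
  have c: "0 < c"
    using cos_monotone_0_pi[of "pi / 2" "p * \<theta>0"] t0 pt0 by (simp add: c_def)
  \<comment> \<open>Beyond \<open>\<theta>0\<close> the value \<open>1 / c\<close> makes
    \<open>- B * cos (p * \<theta>)\<close> at least \<open>1\<close>; below it, \<open>A\<close>
    makes the first term at least \<open>1 + B\<close>, which pays for
    \<open>B * cos (p * \<theta>) \<le> B\<close>.\<close>
  define B where "B = 1 / c"
  define A where "A = (1 + B) / cos \<theta>0 powr p"
  have cos0: "0 < cos \<theta>0"
    using t0 by (intro cos_gt_zero_pi) auto
  have B: "0 < B" using c by (simp add: B_def)
  have A: "0 < A" using B cos0 by (simp add: A_def)
  have ineq: "1 \<le> A * cos \<theta> powr p - B * cos (p * \<theta>)" if "0 \<le> \<theta>" "\<theta> < pi / 2" for \<theta>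
  proof (cases "\<theta> \<le> \<theta>0")
    case True
    have "cos \<theta>0 \<le> cos \<theta>"
      using True that t0 by (intro cos_monotone_0_pi_le) auto
    then have "A * cos \<theta>0 powr p \<le> A * cos \<theta> powr p"
      using A cos0 assms by (intro mult_left_mono powr_mono2) auto
    moreover have "A * cos \<theta>0 powr p = 1 + B"
      using cos0 by (simp add: A_def)
    moreover have "B * cos (p * \<theta>) \<le> B * 1"
      using B by (intro mult_left_mono) auto
    ultimately show ?thesis by linarith
  next
    case False
    have "p * \<theta> \<le> pi"
      using mult_mono[of p 2 \<theta> "pi / 2"] assms that by simp
    then have "cos (p * \<theta>) \<le> cos (p * \<theta>0)"
      using False assms t0 by (intro cos_monotone_0_pi_le mult_left_mono) auto
    then have "B * cos (p * \<theta>) \<le> B * (- c)"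
      using B by (intro mult_left_mono) (auto simp: c_def)
    also have "\<dots> = -1" using c by (simp add: B_def)
    finally have "B * cos (p * \<theta>) \<le> -1" .
    moreover have "0 \<le> A * cos \<theta> powr p" using A by simp
    ultimately show ?thesis by linarith
  qed
  show ?thesis
  proof
    fix w :: complex assume w: "0 < Re w"
    define \<theta> where "\<theta> = Im (Ln w)"
    have nz: "w \<noteq> 0" using w by auto
    have th: "\<bar>\<theta>\<bar> < pi / 2"
      unfolding \<theta>_def using Re_Ln_pos_lt[OF nz] w by simp
    have "w = exp (Ln w)" using nz by simp
    then have "Re w = Re (exp (Ln w))" by simp
    also have "\<dots> = norm w * cos \<bar>\<theta>\<bar>"
      using nz by (simp only: Re_exp Re_Ln) (simp add: \<theta>_def)
    finally have re: "Re w = norm w * cos \<bar>\<theta>\<bar>" .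
    have "w powr of_real p = exp (of_real p * Ln w)"
      using nz by (simp add: powr_def)
    then have "Re (w powr of_real p) = exp (p * ln (norm w)) * cos (p * \<theta>)"
      using nz by (simp add: Re_exp \<theta>_def)
    also have "exp (p * ln (norm w)) = norm w powr p"
      using nz by (simp add: powr_def)
    also have "cos (p * \<theta>) = cos (p * \<bar>\<theta>\<bar>)"
      by (simp add: abs_if)
    finally have rp: "Re (w powr of_real p) = norm w powr p * cos (p * \<bar>\<theta>\<bar>)" .
    have "0 < cos \<bar>\<theta>\<bar>" using th by (intro cos_gt_zero_pi) auto
    then have "Re w powr p = norm w powr p * cos \<bar>\<theta>\<bar> powr p"
      unfolding re by (simp add: powr_mult)
    moreover have "norm w powr p * 1 \<le> norm w powr p * (A * cos \<bar>\<theta>\<bar> powr p - B * cos (p * \<bar>\<theta>\<bar>))"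
      using ineq[of "\<bar>\<theta>\<bar>"] th by (intro mult_left_mono) auto
    ultimately show "norm w powr p \<le> A * Re w powr p - B * Re (w powr of_real p)"
      unfolding rp by (simp add: algebra_simps)
  qed (use A B in auto)
qed

text \<open>Bounded support yields decay of order \<open>1 / norm z\<close>. The first bound puts
  the transform on a horizontal line into \<open>L\<^sup>p\<close>; the second feeds
  \<open>horizontal_line_integral_eq_0\<close>.\<close>

lemma cauchy_tr_decay:
  assumes f: "integrable lborel f" and supp: "\<And>t. M < \<bar>t\<bar> \<Longrightarrow> f t = 0" and "0 < M"
  shows "0 < y \<Longrightarrow> norm (cauchy_tr f (Complex x y)) \<le> (LINT t|lborel. norm (f t)) * ((1 + 1 / y) * (1 + M)) / (1 + \<bar>x\<bar>)"
    and "2 * M \<le> norm z \<Longrightarrow> norm (cauchy_tr f z) \<le> (LINT t|lborel. norm (f t)) * 2 / norm z"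
proof -
  have main: "norm (cauchy_tr f z) \<le> (LINT t|lborel. norm (f t)) * c"
    if "\<And>t. \<bar>t\<bar> \<le> M \<Longrightarrow> norm (1 / (of_real t - z)) \<le> c" "0 \<le> c" for z c
  proof -
    have b: "norm (f t / (of_real t - z)) \<le> norm (f t) * c" for t
    proof (cases "\<bar>t\<bar> \<le> M")
      case True
      have "norm (f t) * norm (1 / (of_real t - z)) \<le> norm (f t) * c"
        by (intro mult_left_mono that True) auto
      then show ?thesis by (simp add: norm_divide)
    qed (use supp[of t] in auto)
    have int: "integrable lborel (\<lambda>t. norm (f t) * c)"
      using f by (intro integrable_mult_left integrable_norm)
    have "norm (cauchy_tr f z) \<le> (LINT t|lborel. norm (f t / (of_real t - z)))"
      unfolding cauchy_tr_def by (rule integral_norm_bound)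
    also have "\<dots> \<le> (LINT t|lborel. norm (f t) * c)"
      by (rule integral_mono'[OF int b]) (use that(2) in auto)
    finally show ?thesis by (simp only: integral_mult_left_zero)
  qed
  show "norm (cauchy_tr f (Complex x y)) \<le> (LINT t|lborel. norm (f t)) * ((1 + 1 / y) * (1 + M)) / (1 + \<bar>x\<bar>)" if "0 < y"
  proof -
    have "norm (1 / (of_real t - Complex x y)) \<le> ((1 + 1 / y) * (1 + M)) / (1 + \<bar>x\<bar>)" if t: "\<bar>t\<bar> \<le> M" for t
    proof -
      have "1 + \<bar>x\<bar> \<le> (1 + \<bar>t - x\<bar>) + M" using t by linarith
      also have "\<dots> \<le> (1 + \<bar>t - x\<bar>) + M * (1 + \<bar>t - x\<bar>)"
        using \<open>0 < M\<close> by (intro add_left_mono) (auto intro: mult_left_mono[of 1, simplified])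
      finally have *: "1 + \<bar>x\<bar> \<le> (1 + M) * (1 + \<bar>t - x\<bar>)" by (simp add: algebra_simps)
      have "norm (1 / (of_real t - Complex x y)) \<le> (1 + 1 / y) / (1 + \<bar>t - x\<bar>)"
        using cauchy_kernel_bound[of "Complex x y" t] \<open>0 < y\<close> by simp
      also have "\<dots> = ((1 + 1 / y) * (1 + M)) / ((1 + M) * (1 + \<bar>t - x\<bar>))"
        using \<open>0 < M\<close> by simp
      also have "\<dots> \<le> ((1 + 1 / y) * (1 + M)) / (1 + \<bar>x\<bar>)"
        using * \<open>0 < M\<close> \<open>0 < y\<close> by (intro divide_left_mono mult_pos_pos) auto
      finally show ?thesis .
    qed
    from main[OF this] show ?thesis
      using \<open>0 < M\<close> \<open>0 < y\<close> by simp
  qed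
  show "norm (cauchy_tr f z) \<le> (LINT t|lborel. norm (f t)) * 2 / norm z" if z: "2 * M \<le> norm z"
  proof -
    have "norm (1 / (of_real t - z)) \<le> 2 / norm z" if t: "\<bar>t\<bar> \<le> M" for t
    proof -
      have "norm z \<le> 2 * norm (of_real t - z)"
        using norm_triangle_ineq2[of z "of_real t"] z t by (simp add: norm_minus_commute)
      moreover have "0 < norm z" using z \<open>0 < M\<close> by linarith
      moreover from calculation have "0 < norm (of_real t - z)" by linarith
      ultimately show ?thesis
        unfolding norm_divide by (simp add: frac_le_eq divide_le_eq le_divide_eq mult.commute)
    qed
    from main[OF this] show ?thesis by simp
  qed
qed

section \<open>Reduction to truncated functions\<close>

lemma pmass_Fatou:
  assumes [measurable]: "\<And>n. u n \<in> borel_measurable borel" "v \<in> borel_measurable borel"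
    and lim: "AE x in lborel. (\<lambda>n. u n x) \<longlonglongrightarrow> v x"
    and B: "\<And>n::nat. pmass p (u n) \<le> B" and "0 < p"
  shows "pmass p v \<le> B"
proof -
  have "pmass p v \<le> (\<integral>\<^sup>+x. liminf (\<lambda>n. ennreal (norm (u n x) powr p)) \<partial>lborel)"
    unfolding pmass_def
  proof (rule nn_integral_mono_AE)
    show "AE x in lborel. ennreal (norm (v x) powr p) \<le> liminf (\<lambda>n. ennreal (norm (u n x) powr p))"
      using lim
    proof eventually_elim
      case (elim x)
      have "(\<lambda>n. ennreal (norm (u n x) powr p)) \<longlonglongrightarrow> ennreal (norm (v x) powr p)"
        using \<open>0 < p\<close> by (intro tendsto_ennrealI tendsto_powr' tendsto_norm elim tendsto_const) auto
      from lim_imp_Liminf[OF _ this] show ?case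
        by simp
    qed
  qed
  also have "\<dots> \<le> liminf (\<lambda>n. pmass p (u n))"
    unfolding pmass_def by (intro nn_integral_liminf) measurable
  also have "\<dots> \<le> B"
    by (intro order_trans[OF Liminf_le_Limsup] Limsup_bounded always_eventually) (auto simp: B)
  finally show ?thesis .
qed

text \<open>Domain and values are both cut, so that a measurable function becomes integrable with
  bounded support; values are kept or replaced by \<open>0\<close>, so nonnegativity
  survives.\<close>

definition truncation :: "nat \<Rightarrow> (real \<Rightarrow> complex) \<Rightarrow> real \<Rightarrow> complex" where
  "truncation n f t = (if \<bar>t\<bar> \<le> real n \<and> norm (f t) \<le> real n then f t else 0)"

lemma truncation_measurable [measurable]:
  assumes [measurable]: "f \<in> borel_measurable borel"
  shows "truncation n f \<in> borel_measurable borel"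
  unfolding truncation_def by measurable

lemma norm_truncation_le: "norm (truncation n f t) \<le> norm (f t)" "norm (truncation n f t) \<le> real n"
  and truncation_eq_0: "real n < \<bar>t\<bar> \<Longrightarrow> truncation n f t = 0"
  by (auto simp: truncation_def)

lemma cauchy_tr_truncation:
  assumes "f \<in> Lp p" "1 < p" "Im z \<noteq> 0"
  shows "(\<lambda>n::nat. cauchy_tr (truncation n f) z) \<longlonglongrightarrow> cauchy_tr f z"
  unfolding cauchy_tr_def
proof (rule integral_dominated_convergence)
  note [measurable] = LpD[OF assms(1)]
  show "integrable lborel (\<lambda>t. norm (f t / (of_real t - z)))"
    by (intro integrable_norm cauchy_integrable[OF assms])
  show "AE t in lborel. (\<lambda>n. truncation n f t / (of_real t - z)) \<longlonglongrightarrow> f t / (of_real t - z)"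
  proof (rule AE_I2)
    fix t
    have "\<forall>\<^sub>F n in sequentially. f t / (of_real t - z) = truncation n f t / (of_real t - z)"
      using eventually_ge_at_top[of "nat \<lceil>max \<bar>t\<bar> (norm (f t))\<rceil>"]
      by eventually_elim (auto simp: nat_le_iff ceiling_le_iff truncation_def)
    then show "(\<lambda>n. truncation n f t / (of_real t - z)) \<longlonglongrightarrow> f t / (of_real t - z)"
      by (rule Lim_transform_eventually[OF tendsto_const])
  qed
qed (use LpD[OF assms(1)] in \<open>auto simp: norm_divide norm_truncation_le intro!: AE_I2 divide_right_mono\<close>)

lemma truncation_Lp: "f \<in> Lp p \<Longrightarrow> 0 \<le> p \<Longrightarrow> truncation n f \<in> Lp p"
  by (rule Lp_mono[of p f]) (auto dest: LpD simp: norm_truncation_le)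

lemma truncation_integrable:
  assumes [measurable]: "f \<in> borel_measurable borel"
  shows "integrable lborel (truncation n f)"
proof (rule Bochner_Integration.integrable_bound)
  show "integrable lborel (\<lambda>t. indicator {- real n..real n} t *\<^sub>R real n)"
    by (rule borel_integrable_compact) (auto intro: compact_Icc)
  show "AE t in lborel. norm (truncation n f t) \<le> norm (indicator {- real n..real n} t *\<^sub>R real n)"
    by (rule AE_I2) (auto simp: truncation_def indicator_def)
qed auto

text \<open>\<open>K\<close> is uniform in the height \<open>y\<close> and corresponds to the
  \<open>p\<close>-th power of an operator norm. The class \<open>F\<close> is a parameter because
  the bound is first shown for truncated and for nonnegative functions.\<close>

definition cauchy_bounded :: "real \<Rightarrow> (real \<Rightarrow> complex) set \<Rightarrow> bool" where
  "cauchy_bounded p F \<longleftrightarrow> (\<exists>K\<ge>0. \<forall>f\<in>F. \<forall>y>0. pmass p (\<lambda>x. cauchy_tr f (Complex x y)) \<le> ennreal K * pmass p f)"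

text \<open>One constant serves all truncation levels, and truncation does not increase
  \<open>pmass\<close>, so Fatou's lemma carries the bound to the limit.\<close>

lemma cauchy_bounded_by_truncation:
  assumes p: "1 < p" and "F \<subseteq> Lp p"
    and "cauchy_bounded p {g. \<exists>f\<in>F. \<exists>n::nat. g = truncation n f}"
  shows "cauchy_bounded p F"
proof -
  obtain K where K: "0 \<le> K" "\<And>f n y. f \<in> F \<Longrightarrow> 0 < y \<Longrightarrow>
     pmass p (\<lambda>x. cauchy_tr (truncation n f) (Complex x y))
       \<le> ennreal K * pmass p (truncation n f)"
    using assms(3) unfolding cauchy_bounded_def by blast
  show ?thesis
    unfolding cauchy_bounded_def
  proof (intro exI[of _ K] conjI ballI allI impI)
    fix f and y :: real assume f: "f \<in> F" and y: "0 < y"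
    have fLp: "f \<in> Lp p" using assms f by blast
    note [measurable] = LpD[OF fLp]
    show "pmass p (\<lambda>x. cauchy_tr f (Complex x y)) \<le> ennreal K * pmass p f"
    proof (rule pmass_Fatou)
      show "AE x in lborel. (\<lambda>n. cauchy_tr (truncation n f) (Complex x y))
          \<longlonglongrightarrow> cauchy_tr f (Complex x y)"
        using y by (intro AE_I2 cauchy_tr_truncation[OF fLp p]) auto
      show "pmass p (\<lambda>x. cauchy_tr (truncation n f) (Complex x y))
          \<le> ennreal K * pmass p f" for n :: nat
        using p by (intro order_trans[OF K(2)[OF f y]] mult_left_mono pmass_mono) (auto simp: norm_truncation_le)
    qed (use p in auto)
  qed (fact K)
qed

lemma cauchy_bounded_nonneg:
  assumes p: "1 < p" "p \<le> 2"
  shows "cauchy_bounded p {f \<in> Lp p. \<forall>t. Im (f t) = 0 \<and> 0 \<le> Re (f t)}" (is "cauchy_bounded p ?F")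
proof (rule cauchy_bounded_by_truncation[OF p(1)])
  let ?T = "{g. \<exists>f\<in>?F. \<exists>n::nat. g = truncation n f}"
  obtain A B where AB: "0 \<le> A" "0 \<le> B"
    "\<And>w. 0 < Re w \<Longrightarrow> norm w powr p \<le> A * Re w powr p - B * Re (w powr of_real p)"
    using norm_powr_le_Re_powr[OF p] by blast
  show "cauchy_bounded p ?T"
    unfolding cauchy_bounded_def
  \<comment> \<open>\<open>A\<close> comes from the pointwise inequality and
    \<open>pi powr p\<close> from \<open>Re W\<close> being \<open>pi\<close> times the Poisson
    integral; neither depends on \<open>f\<close>, on \<open>n\<close> or on the height.\<close>
  proof (intro exI[of _ "A * pi powr p"] conjI ballI allI impI)
    fix f and y :: real assume "f \<in> ?T" and y: "0 < y"
    then obtain f0 and n :: nat where f0: "f0 \<in> ?F" "f = truncation n f0"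
      by auto
    define M where "M = real n + 1"
    have M: "0 < M" by (simp add: M_def)
    have real: "Im (f t) = 0" "0 \<le> Re (f t)" for t
      using f0 by (auto simp: truncation_def)
    have supp: "f t = 0" if "M < \<bar>t\<bar>" for t
      using that f0 by (auto simp: M_def truncation_eq_0)
    have fLp: "f \<in> Lp p"
      using f0 p by (auto intro: truncation_Lp)
    note [measurable] = LpD[OF fLp]
    have fint: "integrable lborel f"
      using f0 by (auto intro: truncation_integrable dest: LpD)
    define I where "I = (LINT t|lborel. norm (f t))"
    have I0: "0 \<le> I" by (simp add: I_def)
    have freal: "f t = of_real (Re (f t))" for t
      using real by (simp add: complex_eq_iff)
    show "pmass p (\<lambda>x. cauchy_tr f (Complex x y)) \<le> ennreal (A * pi powr p) * pmass p f"
    \<comment> \<open>Unless \<open>f\<close> vanishes almost everywhere, \<open>Re W\<close> is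
      strictly positive. This keeps \<open>W\<close> off the cut of the complex power and allows the
      pointwise inequality to be applied.\<close>
    proof (cases "AE t in lborel. f t = 0")
      case True
      then have "cauchy_tr f z = 0" for z
        unfolding cauchy_tr_def by (intro integral_eq_zero_AE) auto
      then show ?thesis by (simp add: pmass_def)
    next
      case False
      define W where "W z = - \<i> * cauchy_tr f z" for z
      have normW: "norm (W z) = norm (cauchy_tr f z)" for z
        by (simp add: W_def norm_mult)
      have ReW: "Re (W (Complex x v)) = pi * Re (poisson f v x)" "0 < Re (W (Complex x v))" if v: "0 < v" for x v
      proof -
        have eq: "Im (f t / (of_real t - Complex x v)) = pi * (poisson_kernel v (t - x) * Re (f t))" for t
        proof -
          have "Im (f t / (of_real t - Complex x v)) = Im (of_real (Re (f t)) / (of_real t - Complex x v))"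
            using freal[of t] by simp
          also have "\<dots> = pi * (poisson_kernel v (t - x) * Re (f t))"
            by (simp add: Im_divide poisson_kernel_def)
          finally show ?thesis .
        qed
        have intC: "integrable lborel (\<lambda>t. f t / (of_real t - Complex x v))"
          using cauchy_integrable[OF fLp p(1)] v by simp
        have re: "Re (W (Complex x v)) = (LINT t|lborel. Im (f t / (of_real t - Complex x v)))"
          unfolding W_def cauchy_tr_def using intC by simp
        have intP: "integrable lborel (\<lambda>t. of_real (poisson_kernel v (t - x)) * f t)"
          by (rule poisson_integrable[OF fLp p(1) v])
        have "Re (poisson f v x) = (LINT t|lborel. Re (of_real (poisson_kernel v (t - x)) * f t))"
          unfolding poisson_def by (rule integral_Re[OF intP, symmetric])
        then show "Re (W (Complex x v)) = pi * Re (poisson f v x)"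
          unfolding re eq by simp
        show "0 < Re (W (Complex x v))"
        proof -
          have nn: "0 \<le> Im (f t / (of_real t - Complex x v))" for t
            unfolding eq using v poisson_kernel_nonneg[of v] real by simp
          have "(LINT t|lborel. Im (f t / (of_real t - Complex x v))) \<noteq> 0"
          proof
            assume "(LINT t|lborel. Im (f t / (of_real t - Complex x v))) = 0"
            then have "AE t in lborel. Im (f t / (of_real t - Complex x v)) = 0"
              using integral_nonneg_eq_0_iff_AE[of lborel "\<lambda>t. Im (f t / (of_real t - Complex x v))"] nn intC by auto
            then have "AE t in lborel. f t = 0"
            proof eventually_elim
              case (elim t)
              have "0 < poisson_kernel v (t - x)"
                unfolding poisson_kernel_def using v by (intro divide_pos_pos mult_pos_pos add_nonneg_pos) auto
              with elim show "f t = 0"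
                unfolding eq using real by (simp add: complex_eq_iff)
            qed
            with False show False by contradiction
          qed
          moreover have "0 \<le> (LINT t|lborel. Im (f t / (of_real t - Complex x v)))"
            using nn by (intro integral_nonneg_AE AE_I2)
          ultimately show ?thesis unfolding re by simp
        qed
      qed
      have ReWpos: "0 < Re (W z)" if "0 < Im z" for z
        using ReW(2)[of "Im z" "Re z"] that by simp
      let ?C = "I * ((1 + 1 / y) * (1 + M))"
      have WLp: "(\<lambda>x. W (Complex x y)) \<in> Lp p"
      proof (rule Lp_decay[OF p(1)])
        show "norm (W (Complex x y)) \<le> ?C / (1 + \<bar>x - 0\<bar>)" for x
          using cauchy_tr_decay(1)[OF fint supp M y] by (simp add: normW I_def)
      qed (simp add: W_def)
      have npow: "norm (w powr of_real p) = norm w powr p" if "0 < Re w" for w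
        using that by (subst norm_powr_real_powr') auto
      have [measurable]: "(\<lambda>x. W (Complex x y)) \<in> borel_measurable borel"
        by (rule LpD[OF WLp])
      have holW: "(\<lambda>z. W z powr of_real p) holomorphic_on {z. 0 < Im z}"
      proof (intro holomorphic_intros)
        show "W holomorphic_on {z. 0 < Im z}"
          unfolding W_def by (intro holomorphic_intros cauchy_tr_holomorphic[OF fLp p(1)])
        show "W z \<notin> \<real>\<^sub>\<le>\<^sub>0" if "z \<in> {z. 0 < Im z}" for z
          using ReWpos[of z] that by (auto simp: complex_nonpos_Reals_iff)
      qed
      have cont: "continuous_on UNIV (\<lambda>x. W (Complex x y) powr of_real p)"
        using holomorphic_on_imp_continuous_on[OF holW]
        by (rule continuous_on_compose2) (use y in \<open>auto simp: Complex_eq intro!: continuous_intros\<close>)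
      have int1: "integrable lborel (\<lambda>x. norm (W (Complex x y)) powr p)"
        by (rule Lp_powr_integrable[OF WLp])
      have int2: "integrable lborel (\<lambda>x. W (Complex x y) powr of_real p)"
      proof (rule Bochner_Integration.integrable_bound[OF int1])
        show "(\<lambda>x. W (Complex x y) powr of_real p) \<in> borel_measurable lborel"
          using borel_measurable_continuous_onI[OF cont] by simp
        show "AE x in lborel. norm (W (Complex x y) powr of_real p) \<le> norm (norm (W (Complex x y)) powr p)"
          using npow[OF ReW(2)[OF y]] by simp
      qed
      have zero: "(LINT x|lborel. W (Complex x y) powr of_real p) = 0"
      proof (rule horizontal_line_integral_eq_0[OF holW y int2 p(1)])
        fix z :: complex assume z: "0 < Im z" "2 * M \<le> norm z"
        have nz: "0 < norm z" using z M by linarith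
        have "norm (W z powr of_real p) = norm (W z) powr p"
          by (rule npow[OF ReWpos[OF z(1)]])
        also have "\<dots> \<le> (I * 2 / norm z) powr p"
          using cauchy_tr_decay(2)[OF fint supp M z(2)] p by (intro powr_mono2) (auto simp: normW I_def)
        also have "\<dots> = (I * 2) powr p * norm z powr (- p)"
          using nz I0 by (simp add: powr_divide powr_minus_divide)
        finally show "norm (W z powr of_real p) \<le> (I * 2) powr p * norm z powr (- p)" .
      qed
      have int3: "integrable lborel (\<lambda>x. Re (W (Complex x y)) powr p)"
      proof (rule Bochner_Integration.integrable_bound[OF int1])
        show "AE x in lborel. norm (Re (W (Complex x y)) powr p) \<le> norm (norm (W (Complex x y)) powr p)"
          using p ReW(2)[OF y] by (intro AE_I2) (auto intro!: powr_mono2 complex_Re_le_cmod simp: less_imp_le)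
      qed measurable
      \<comment> \<open>On integration the holomorphic term vanishes by \<open>zero\<close>, and
        \<open>B\<close> disappears with it; only the Poisson integral \<open>Re W\<close> is
        left.\<close>
      have "(LINT x|lborel. norm (W (Complex x y)) powr p) \<le>
          (LINT x|lborel. A * Re (W (Complex x y)) powr p - B * Re (W (Complex x y) powr of_real p))"
        using int1 int2 int3 AB(3)[OF ReW(2)[OF y]] by (intro integral_mono) auto
      also have "\<dots> = A * (LINT x|lborel. Re (W (Complex x y)) powr p) - B * Re (LINT x|lborel. W (Complex x y) powr of_real p)"
        using int2 int3 by simp
      also have "\<dots> = (LINT x|lborel. A * Re (W (Complex x y)) powr p)"
        by (simp add: zero)
      finally have le: "(LINT x|lborel. norm (W (Complex x y)) powr p) \<le> (LINT x|lborel. A * Re (W (Complex x y)) powr p)" .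
      have "pmass p (\<lambda>x. cauchy_tr f (Complex x y)) = ennreal (LINT x|lborel. norm (W (Complex x y)) powr p)"
        unfolding pmass_def normW[symmetric] using int1 by (intro nn_integral_eq_integral) auto
      also have "\<dots> \<le> ennreal (LINT x|lborel. A * Re (W (Complex x y)) powr p)"
        by (rule ennreal_leI[OF le])
      also have "\<dots> = (\<integral>\<^sup>+x. ennreal (A * Re (W (Complex x y)) powr p) \<partial>lborel)"
        using int3 AB by (intro nn_integral_eq_integral[symmetric]) auto
      also have "\<dots> \<le> (\<integral>\<^sup>+x. ennreal (A * pi powr p) * ennreal (norm (poisson f y x) powr p) \<partial>lborel)"
      proof (rule nn_integral_mono)
        fix x
        have "0 \<le> Re (poisson f y x)"
          using ReW[OF y, of x] by (simp add: zero_less_mult_iff)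
        then have "A * Re (W (Complex x y)) powr p = A * pi powr p * Re (poisson f y x) powr p"
          unfolding ReW(1)[OF y] by (simp add: powr_mult)
        also have "\<dots> \<le> A * pi powr p * norm (poisson f y x) powr p"
          using AB p \<open>0 \<le> Re (poisson f y x)\<close> by (intro mult_left_mono powr_mono2 complex_Re_le_cmod) auto
        finally show "ennreal (A * Re (W (Complex x y)) powr p) \<le> ennreal (A * pi powr p) * ennreal (norm (poisson f y x) powr p)"
          using AB by (subst ennreal_mult[symmetric]) (auto intro: ennreal_leI)
      qed
      also have "\<dots> = ennreal (A * pi powr p) * pmass p (poisson f y)"
        unfolding pmass_def by (rule nn_integral_cmult) simp
      also have "\<dots> \<le> ennreal (A * pi powr p) * pmass p f"
        by (intro mult_left_mono poisson_contraction[OF fLp p(1) y]) auto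
      finally show ?thesis .
    qed
  qed (use AB in auto)
qed auto

section \<open>From nonnegative functions and \<open>p \<le> 2\<close> to complex functions and all
  \<open>p > 1\<close>\<close>

lemma borel_measurable_cnj [measurable]: "cnj \<in> borel_measurable borel"
  by (intro borel_measurable_continuous_onI continuous_intros)

lemma cauchy_tr_lincomb:
  assumes "f \<in> Lp p" "g \<in> Lp p" "1 < p" "Im z \<noteq> 0"
  shows "cauchy_tr (\<lambda>t. f t + c * g t) z = cauchy_tr f z + c * cauchy_tr g z"
proof -
  note int = cauchy_integrable[OF assms(1,3,4)] cauchy_integrable[OF assms(2,3,4)]
  have "cauchy_tr (\<lambda>t. f t + c * g t) z = (LINT t|lborel. f t / (of_real t - z) + c * (g t / (of_real t - z)))"
    unfolding cauchy_tr_def by (simp add: add_divide_distrib)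
  also have "\<dots> = cauchy_tr f z + c * cauchy_tr g z"
    unfolding cauchy_tr_def
    by (simp only: Bochner_Integration.integral_add[OF int(1) integrable_mult_right[OF int(2)]] integral_mult_right_zero)
  finally show ?thesis .
qed

lemma pmass_cauchy_tr_lincomb:
  assumes "f \<in> Lp p" "g \<in> Lp p" "1 < p" "0 < y" "norm c = 1"
    and "pmass p (\<lambda>x. cauchy_tr f (Complex x y)) \<le> A" "pmass p (\<lambda>x. cauchy_tr g (Complex x y)) \<le> B"
  shows "pmass p (\<lambda>x. cauchy_tr (\<lambda>t. f t + c * g t) (Complex x y)) \<le> ennreal (2 powr p) * (A + B)"
proof -
  note [measurable] = LpD[OF assms(1)] LpD[OF assms(2)]
  have "pmass p (\<lambda>x. cauchy_tr (\<lambda>t. f t + c * g t) (Complex x y)) =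
      pmass p (\<lambda>x. cauchy_tr f (Complex x y) + c * cauchy_tr g (Complex x y))"
    using assms by (subst cauchy_tr_lincomb[OF assms(1,2,3)]) auto
  also have "\<dots> \<le> ennreal (2 powr p) * (pmass p (\<lambda>x. cauchy_tr f (Complex x y)) + pmass p (\<lambda>x. c * cauchy_tr g (Complex x y)))"
    using assms by (intro pmass_add) auto
  also have "pmass p (\<lambda>x. c * cauchy_tr g (Complex x y)) = pmass p (\<lambda>x. cauchy_tr g (Complex x y))"
    using assms by (subst pmass_cmult) auto
  also have "ennreal (2 powr p) * (pmass p (\<lambda>x. cauchy_tr f (Complex x y)) + pmass p (\<lambda>x. cauchy_tr g (Complex x y)))
      \<le> ennreal (2 powr p) * (A + B)"
    by (intro mult_left_mono add_mono assms) auto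
  finally show ?thesis .
qed

lemma cauchy_bounded_le_2:
  assumes p: "1 < p" "p \<le> 2"
  shows "cauchy_bounded p (Lp p)"
proof -
  obtain K where K: "0 \<le> K" "\<And>f y. f \<in> Lp p \<Longrightarrow> \<forall>t. Im (f t) = 0 \<and> 0 \<le> Re (f t) \<Longrightarrow> 0 < y \<Longrightarrow>
      pmass p (\<lambda>x. cauchy_tr f (Complex x y)) \<le> ennreal K * pmass p f"
    using cauchy_bounded_nonneg[OF p] unfolding cauchy_bounded_def by blast
  show ?thesis
    unfolding cauchy_bounded_def
  \<comment> \<open>Four nonnegative pieces are combined in two rounds, positive with negative parts
    and then real with imaginary parts; each round costs \<open>2 powr p\<close> and adds two equal
    bounds.\<close>
  proof (intro exI[of _ "2 powr p * 2 powr p * 4 * K"] conjI ballI allI impI)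
    fix f and y :: real assume f: "f \<in> Lp p" and y: "0 < y"
    note [measurable] = LpD[OF f]
    have pos: "pmass p (\<lambda>x. cauchy_tr (\<lambda>t. of_real (max 0 (u (f t)))) (Complex x y)) \<le> ennreal K * pmass p f"
      "(\<lambda>t. of_real (max 0 (u (f t)))) \<in> Lp p"
      if u: "\<And>z. \<bar>u z\<bar> \<le> norm z" "u \<in> borel_measurable borel" for u :: "complex \<Rightarrow> real"
    proof -
      have le: "norm (complex_of_real (max 0 (u (f t)))) \<le> norm (f t)" for t
        using u(1)[of "f t"] by auto
      show L: "(\<lambda>t. of_real (max 0 (u (f t)))) \<in> Lp p"
      proof (rule Lp_mono[OF _ f _ le])
        note [measurable] = u(2)
        show "(\<lambda>t. complex_of_real (max 0 (u (f t)))) \<in> borel_measurable borel"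
          by measurable
      qed (use p in simp)
      have "pmass p (\<lambda>x. cauchy_tr (\<lambda>t. of_real (max 0 (u (f t)))) (Complex x y)) \<le> ennreal K * pmass p (\<lambda>t. of_real (max 0 (u (f t))))"
        by (rule K(2)[OF L _ y]) auto
      also have "\<dots> \<le> ennreal K * pmass p f"
        using p by (intro mult_left_mono pmass_mono le) auto
      finally show "pmass p (\<lambda>x. cauchy_tr (\<lambda>t. of_real (max 0 (u (f t)))) (Complex x y)) \<le> ennreal K * pmass p f" .
    qed
    note a = pos[of Re] and b = pos[of "\<lambda>z. - Re z"] and c = pos[of Im] and d = pos[of "\<lambda>z. - Im z"]
    note a = a[OF abs_Re_le_cmod] and c = c[OF abs_Im_le_cmod]
    have b: "pmass p (\<lambda>x. cauchy_tr (\<lambda>t. of_real (max 0 (- Re (f t)))) (Complex x y)) \<le> ennreal K * pmass p f"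
       "(\<lambda>t. of_real (max 0 (- Re (f t)))) \<in> Lp p"
       using b by (auto simp: abs_Re_le_cmod)
    have d: "pmass p (\<lambda>x. cauchy_tr (\<lambda>t. of_real (max 0 (- Im (f t)))) (Complex x y)) \<le> ennreal K * pmass p f"
       "(\<lambda>t. of_real (max 0 (- Im (f t)))) \<in> Lp p"
       using d by (auto simp: abs_Im_le_cmod)
    define f1 where "f1 t = complex_of_real (max 0 (Re (f t))) + (- 1) * complex_of_real (max 0 (- Re (f t)))" for t
    define f2 where "f2 t = complex_of_real (max 0 (Im (f t))) + (- 1) * complex_of_real (max 0 (- Im (f t)))" for t
    have f1: "f1 \<in> Lp p" unfolding f1_def using a b p by (intro Lp_add Lp_cmult) auto
    have f2: "f2 \<in> Lp p" unfolding f2_def using c d p by (intro Lp_add Lp_cmult) auto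
    have m1: "pmass p (\<lambda>x. cauchy_tr f1 (Complex x y)) \<le> ennreal (2 powr p) * (ennreal K * pmass p f + ennreal K * pmass p f)"
      unfolding f1_def using a b p y by (intro pmass_cauchy_tr_lincomb) auto
    have m2: "pmass p (\<lambda>x. cauchy_tr f2 (Complex x y)) \<le> ennreal (2 powr p) * (ennreal K * pmass p f + ennreal K * pmass p f)"
      unfolding f2_def using c d p y by (intro pmass_cauchy_tr_lincomb) auto
    have feq: "f = (\<lambda>t. f1 t + \<i> * f2 t)"
      by (rule ext) (auto simp: f1_def f2_def complex_eq_iff max_def)
    have "pmass p (\<lambda>x. cauchy_tr (\<lambda>t. f1 t + \<i> * f2 t) (Complex x y)) \<le>
        ennreal (2 powr p) * (ennreal (2 powr p) * (ennreal K * pmass p f + ennreal K * pmass p f) +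
          ennreal (2 powr p) * (ennreal K * pmass p f + ennreal K * pmass p f))"
      by (rule pmass_cauchy_tr_lincomb[OF f1 f2 p(1) y _ m1 m2]) simp
    also have "\<dots> = ennreal (2 powr p) * ennreal (2 powr p) * 4 * ennreal K * pmass p f"
      by (simp add: algebra_simps flip: mult_2)
    also have "\<dots> = ennreal (2 powr p * 2 powr p * 4 * K) * pmass p f"
      using K(1) by (simp add: ennreal_mult)
    finally show "pmass p (\<lambda>x. cauchy_tr f (Complex x y)) \<le> ennreal (2 powr p * 2 powr p * 4 * K) * pmass p f"
      using feq by simp
  qed (use K in simp)
qed

text \<open>The transform \<open>w\<close> of \<open>f\<close> on a line is tested against the
  extremal function \<open>h\<close> of Hoelder's inequality. Fubini moves the transform from
  \<open>f\<close> to \<open>h\<close>, where the bound for \<open>q\<close> applies, and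
  \<open>h\<close> has the same mass as \<open>w\<close>. Young's inequality with weight
  \<open>M\<close> then bounds \<open>pmass p w\<close> by a multiple of \<open>pmass p f\<close>
  plus half of itself.\<close>

lemma cauchy_bounded_dual:
  assumes pq: "1 < p" "1 < q" "1 / p + 1 / q = (1 :: real)" and q: "cauchy_bounded q (Lp q)"
  shows "cauchy_bounded p (Lp p)"
proof (rule cauchy_bounded_by_truncation[OF pq(1) order_refl])
  let ?T = "{g. \<exists>f\<in>Lp p. \<exists>n::nat. g = truncation n f}"
  obtain K where K: "0 \<le> K" "\<And>f y. f \<in> Lp q \<Longrightarrow> 0 < y \<Longrightarrow>
      pmass q (\<lambda>x. cauchy_tr f (Complex x y)) \<le> ennreal K * pmass q f"
    using q unfolding cauchy_bounded_def by blast
  \<comment> \<open>With \<open>M powr q = 2 * K + 1\<close> the factor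
    \<open>K * (1 / M) powr q\<close> is at most \<open>1 / 2\<close>, small enough for absorption;
    the summand \<open>1\<close> keeps \<open>M\<close> positive.\<close>
  define M where "M = (2 * K + 1) powr (1 / q)"
  have M0: "0 < M" using K by (simp add: M_def)
  have Mq: "K * (1 / M) powr q \<le> 1 / 2"
    using K pq by (simp add: M_def powr_divide powr_powr divide_le_eq)
  have conj: "(p - 1) * q = p" using pq by (simp add: field_simps)
  show "cauchy_bounded p ?T"
    unfolding cauchy_bounded_def
  proof (intro exI[of _ "2 * M powr p"] conjI ballI allI impI)
    fix f and y :: real assume "f \<in> ?T" and y: "0 < y"
    then obtain f0 and n :: nat where f0: "f0 \<in> Lp p" "f = truncation n f0"
      by auto
    define R where "R = real n + 1"
    have R: "0 < R" by (simp add: R_def)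
    have supp: "f t = 0" if "R < \<bar>t\<bar>" for t
      using that f0 by (auto simp: R_def truncation_eq_0)
    have fLp: "f \<in> Lp p"
      using f0 pq by (auto intro: truncation_Lp)
    note [measurable] = LpD[OF fLp]
    have fint: "integrable lborel f"
      using f0 by (auto intro: truncation_integrable dest: LpD)
    define w where "w x = cauchy_tr f (Complex x y)" for x
    have [measurable]: "w \<in> borel_measurable borel"
      unfolding w_def by measurable
    have wLp: "w \<in> Lp p"
    proof (rule Lp_decay[OF pq(1)])
      show "norm (w x) \<le> ((LINT t|lborel. norm (f t)) * ((1 + 1 / y) * (1 + R))) / (1 + \<bar>x - 0\<bar>)" for x
        using cauchy_tr_decay(1)[OF fint supp R y, of x] by (simp add: w_def)
    qed simp
    define h where "h x = of_real (norm (w x) powr (p - 1)) * sgn (w x)" for x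
    have [measurable]: "h \<in> borel_measurable borel"
      unfolding h_def sgn_div_norm by measurable
    have normh: "norm (h x) = norm (w x) powr (p - 1)" for x
      by (simp add: h_def norm_mult norm_sgn)
    have wh: "w x * cnj (h x) = of_real (norm (w x) powr p)" for x
    proof (cases "w x = 0")
      case False
      have "w x * cnj (h x) = of_real (norm (w x) powr (p - 1)) * (w x * cnj (w x) / of_real (norm (w x)))"
        by (simp add: h_def sgn_div_norm divide_inverse scaleR_conv_of_real mult_ac)
      also have "w x * cnj (w x) = of_real (norm (w x)) * of_real (norm (w x))"
        by (simp add: complex_norm_square[symmetric] flip: power2_eq_square)
      finally show ?thesis
        using False by (simp add: powr_diff)
    qed simp
    have hmass: "pmass q h = pmass p w"
      unfolding pmass_def normh using conj by (simp add: powr_powr)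
    have hLq: "h \<in> Lp q"
      using Lp_finite[OF wLp] hmass by (intro LpI) auto
    let ?F = "\<lambda>t x. cnj (h x) * (f t / (of_real t - Complex x y))"
    have [measurable]: "(\<lambda>x. Complex x y) \<in> borel_measurable borel"
      unfolding Complex_eq by measurable
    have K0: "0 \<le> 1 + 1 / y" using y by simp
    obtain B where B: "0 \<le> B" "\<And>(g :: real \<Rightarrow> complex) x. g \<in> borel_measurable borel \<Longrightarrow>
        (\<And>t. norm (g t) \<le> (1 + 1 / y) / (1 + \<bar>t - x\<bar>)) \<Longrightarrow> (LINT t|lborel. norm (h t * g t)) \<le> B"
      using Lp_mult_decay_bound[OF hLq pq(2) K0] by blast
    have kd: "norm (1 / (of_real t - Complex x y)) \<le> (1 + 1 / y) / (1 + \<bar>x - t\<bar>)" for t x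
      using cauchy_kernel_bound[of "Complex x y" t] y by (simp add: abs_minus_commute)
    have bd: "(LINT x|lborel. norm (h x * (1 / (of_real t - Complex x y)))) \<le> B" for t
      by (rule B(2)[OF _ kd]) measurable
    have hint: "integrable lborel (\<lambda>x. h x * (1 / (of_real t - Complex x y)))" for t
      by (rule Lp_mult_decay_integrable[OF hLq pq(2) _ kd]) measurable
    have "integrable (lborel \<Otimes>\<^sub>M lborel) (\<lambda>(t, x). f t * (cnj (h x) * (1 / (of_real t - Complex x y))))"
    proof (rule integrable_kernel_product[OF fint])
      show "integrable lborel (\<lambda>x. cnj (h x) * (1 / (of_real t - Complex x y)))" for t
        by (rule Bochner_Integration.integrable_bound[OF hint[of t]]) (auto simp: norm_mult norm_divide)
      show "(LINT x|lborel. norm (cnj (h x) * (1 / (of_real t - Complex x y)))) \<le> B" for t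
        using bd[of t] by (simp only: norm_mult complex_mod_cnj)
    qed measurable
    then have intF: "integrable (lborel \<Otimes>\<^sub>M lborel) (case_prod ?F)"
      by (simp add: mult.commute)
    note swap = lborel_pair.Fubini_integral[OF intF]
    \<comment> \<open>The adjoint relation: swapping the real parts in the Cauchy kernel amounts to
      conjugation and a sign, \<open>t - Complex x y = - cnj (x - Complex t y)\<close>.\<close>
    have inner: "(LINT x|lborel. ?F t x) = - (f t * cnj (cauchy_tr h (Complex t y)))" for t
    proof -
      have "cnj (cauchy_tr h (Complex t y)) = (LINT x|lborel. cnj (h x / (of_real x - Complex t y)))"
        unfolding cauchy_tr_def by (rule Bochner_Integration.integral_cnj[symmetric])
      also have "- (f t * \<dots>) = (LINT x|lborel. (- f t) * cnj (h x / (of_real x - Complex t y)))"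
        by (simp only: integral_mult_right_zero minus_mult_left)
      also have "\<dots> = (LINT x|lborel. ?F t x)"
      proof (intro Bochner_Integration.integral_cong refl)
        fix x
        have "of_real t - Complex x y = - cnj (of_real x - Complex t y)"
          by (simp add: complex_eq_iff)
        then show "(- f t) * cnj (h x / (of_real x - Complex t y)) = ?F t x"
          by (simp only: complex_cnj_divide divide_minus_right) simp
      qed
      finally show ?thesis by simp
    qed
    have "(LINT x|lborel. LINT t|lborel. ?F t x) = (LINT x|lborel. of_real (norm (w x) powr p))"
    proof (intro Bochner_Integration.integral_cong refl)
      fix x
      have "(LINT t|lborel. ?F t x) = cnj (h x) * w x"
        unfolding w_def cauchy_tr_def by (rule integral_mult_right_zero)
      then show "(LINT t|lborel. ?F t x) = of_real (norm (w x) powr p)"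
        using wh[of x] by (simp add: mult.commute)
    qed
    then have main: "complex_of_real (LINT x|lborel. norm (w x) powr p) = (LINT t|lborel. - (f t * cnj (cauchy_tr h (Complex t y))))"
      using swap by (simp only: inner integral_complex_of_real)
    have wmass: "pmass p w = ennreal (LINT x|lborel. norm (w x) powr p)"
      unfolding pmass_def using Lp_powr_integrable[OF wLp] by (intro nn_integral_eq_integral) auto
    define v where "v t = cauchy_tr h (Complex t y)" for t
    have [measurable]: "v \<in> borel_measurable borel"
      unfolding v_def by measurable
    have "0 \<le> (LINT x|lborel. norm (w x) powr p)"
      by (intro integral_nonneg_AE AE_I2) auto
    then have "pmass p w = ennreal (norm (complex_of_real (LINT x|lborel. norm (w x) powr p)))"
      unfolding wmass by simp
    also have "\<dots> \<le> (\<integral>\<^sup>+t. ennreal (norm (- (f t * cnj (v t)))) \<partial>lborel)"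
      unfolding main v_def
      using lborel_pair.integrable_fst'[OF intF] by (intro integral_norm_bound_ennreal) (simp only: prod.case inner)
    also have "\<dots> = (\<integral>\<^sup>+t. ennreal (norm (of_real M * f t) * norm (of_real (1 / M) * v t)) \<partial>lborel)"
      using M0 by (simp add: norm_mult norm_divide)
    also have "\<dots> \<le> pmass p (\<lambda>t. of_real M * f t) + pmass q (\<lambda>t. of_real (1 / M) * v t)"
      by (rule Young_pmass[OF _ _ pq]) measurable
    also have "\<dots> = ennreal (M powr p) * pmass p f + ennreal ((1 / M) powr q) * pmass q v"
      using M0 by (subst (1 2) pmass_cmult) (auto simp del: of_real_divide)
    also have "\<dots> \<le> ennreal (M powr p) * pmass p f + ennreal ((1 / M) powr q) * (ennreal K * pmass p w)"
      using K(2)[OF hLq y] unfolding hmass v_def by (intro add_left_mono mult_left_mono) auto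
    also have "ennreal ((1 / M) powr q) * (ennreal K * pmass p w) = ennreal (K * (1 / M) powr q) * pmass p w"
      using K(1) by (simp add: ennreal_mult mult_ac)
    also have "ennreal (M powr p) * pmass p f + ennreal (K * (1 / M) powr q) * pmass p w
        \<le> ennreal (M powr p) * pmass p f + ennreal (1 / 2) * pmass p w"
      using Mq by (intro add_left_mono mult_right_mono ennreal_leI) auto
    finally have le: "pmass p w \<le> ennreal (M powr p) * pmass p f + ennreal (1 / 2) * pmass p w" .
    \<comment> \<open>Passing to real numbers is what permits subtracting half of
      \<open>pmass p w\<close>; it is finite because the truncated \<open>f\<close> gives a decaying
      \<open>w\<close>.\<close>
    obtain a where a: "0 \<le> a" "pmass p w = ennreal a"
      using Lp_finite[OF wLp] by (cases "pmass p w") auto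
    obtain b where b: "0 \<le> b" "pmass p f = ennreal b"
      using Lp_finite[OF fLp] by (cases "pmass p f") auto
    have "ennreal a \<le> ennreal (M powr p * b + 1 / 2 * a)"
    proof -
      have "ennreal (M powr p * b + 1 / 2 * a) = ennreal (M powr p * b) + ennreal (1 / 2 * a)"
        using a b by (intro ennreal_plus) auto
      moreover have "ennreal (M powr p * b) = ennreal (M powr p) * ennreal b"
        by (rule ennreal_mult) (use b in auto)
      moreover have "ennreal (1 / 2 * a) = ennreal (1 / 2) * ennreal a"
        by (rule ennreal_mult) (use a in auto)
      ultimately show ?thesis using le unfolding a(2) b(2) by (simp only:)
    qed
    then have "a \<le> M powr p * b + 1 / 2 * a"
      using a b by (subst (asm) ennreal_le_iff) auto
    then have "a \<le> 2 * M powr p * b" by simp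
    then show "pmass p (\<lambda>x. cauchy_tr f (Complex x y)) \<le> ennreal (2 * M powr p) * pmass p f"
      using a b unfolding w_def[symmetric] by (simp add: ennreal_mult[symmetric] ennreal_leI)
  qed simp
qed

theorem cauchy_tr_bounded:
  assumes "1 < p"
  shows "cauchy_bounded p (Lp p)"
proof (cases "p \<le> 2")
  case False
  obtain q where q: "1 < q" "1 / p + 1 / q = (1::real)"
    using conj_exponent assms by blast
  have "1 / p < 1 / 2" using False by (intro divide_strict_left_mono) auto
  then have "1 / 2 < 1 / q" using q by linarith
  then have "q < 2" using q by (simp add: field_simps)
  then show ?thesis
    using cauchy_bounded_dual[OF assms q] cauchy_bounded_le_2[of q] q by simp
qed (use cauchy_bounded_le_2 assms in auto)

text \<open>Reduces the lower half-plane, needed for \<open>conj_poisson\<close>, to the upper one,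
  where the boundary theorem is proved.\<close>

lemma cauchy_tr_cnj:
  "cauchy_tr f (cnj z) = cnj (cauchy_tr (\<lambda>t. cnj (f t)) z)"
proof -
  have "cnj (cauchy_tr (\<lambda>t. cnj (f t)) z) = (LINT t|lborel. cnj (cnj (f t) / (of_real t - z)))"
    unfolding cauchy_tr_def by (rule Bochner_Integration.integral_cnj[symmetric])
  then show ?thesis by (simp add: cauchy_tr_def)
qed

lemma Lp_cnj: "f \<in> Lp p \<Longrightarrow> (\<lambda>t. cnj (f t)) \<in> Lp p"
  by (rule LpI) (auto simp: pmass_def Lp_def intro: measurable_compose[OF _ borel_measurable_cnj])

subsection \<open>Lebesgue points and boundary values\<close>

lemma AE_lborel_reflect:
  fixes P :: "real \<Rightarrow> bool"
  assumes "AE x in lborel. P x"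
  shows "AE x in lborel. P (- x)"
proof -
  obtain N where N: "{x \<in> space lborel. \<not> P x} \<subseteq> N" "emeasure lborel N = 0" "N \<in> sets lborel"
    using assms by (rule AE_E)
  have [measurable]: "N \<in> sets borel" using N(3) by simp
  have [measurable]: "{x. - x \<in> N} \<in> sets borel"
    by measurable
  have "emeasure lborel {x. - x \<in> N} = (\<integral>\<^sup>+x. indicator {x. - x \<in> N} x \<partial>lborel)"
    by (rule nn_integral_indicator[symmetric]) simp
  also have "\<dots> = (\<integral>\<^sup>+x. indicator N (- x) \<partial>lborel)"
    by (simp add: indicator_def)
  also have "\<dots> = (\<integral>\<^sup>+x. indicator N x \<partial>lborel)"
    by (rule nn_integral_reflect) measurable
  also have "\<dots> = 0" using N by simp
  finally show ?thesis
    by (intro AE_I[where N = "{x. - x \<in> N}"]) (use N(1) in auto)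
qed

text \<open>Lebesgue's differentiation theorem for intervals to the right of \<open>x\<close>,
  recast as an upper bound for nonnegative integrals, the only direction used below.\<close>

lemma AE_right_average:
  fixes \<phi> :: "real \<Rightarrow> real"
  assumes [measurable]: "\<phi> \<in> borel_measurable borel" and nn: "\<And>t. 0 \<le> \<phi> t"
    and int: "\<And>a b. set_integrable lborel {a..b} \<phi>"
  shows "AE x in lborel. \<forall>e>0. \<exists>d>0. \<forall>h. 0 < h \<and> h < d \<longrightarrow>
    (\<integral>\<^sup>+t. ennreal (\<phi> t) * indicator {x..x + h} t \<partial>lborel) \<le> ennreal ((\<phi> x + e) * h)"
proof -
  have "\<phi> integrable_on cbox a b" for a b
    using set_borel_integral_eq_integral(1)[OF int] by simp
  then obtain N where N: "negligible N"
    "\<And>x e. \<lbrakk>x \<notin> N; 0 < e\<rbrakk> \<Longrightarrow> \<exists>d>0. \<forall>h. 0 < h \<and> h < d \<longrightarrow>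
        norm (integral (cbox x (x + h *\<^sub>R One)) \<phi> /\<^sub>R h ^ DIM(real) - \<phi> x) < e"
    using integrable_ccontinuous_explicit[of \<phi>] by blast
  have "AE x in lborel. x \<notin> N"
    using AE_not_in[of N lebesgue] N(1) by (simp add: negligible_iff_null_sets AE_completion_iff)
  then show ?thesis
  proof eventually_elim
    case (elim x)
    show ?case
    proof (intro allI impI)
      fix e :: real assume "0 < e"
      from N(2)[OF elim this] obtain d where d: "0 < d" "\<And>h. 0 < h \<Longrightarrow> h < d \<Longrightarrow> \<bar>integral {x..x + h} \<phi> / h - \<phi> x\<bar> < e"
        by (auto simp: divide_inverse mult.commute)
      show "\<exists>d>0. \<forall>h. 0 < h \<and> h < d \<longrightarrow>
          (\<integral>\<^sup>+t. ennreal (\<phi> t) * indicator {x..x + h} t \<partial>lborel) \<le> ennreal ((\<phi> x + e) * h)"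
      proof (intro exI[of _ d] conjI allI impI d(1))
        fix h assume h: "0 < h \<and> h < d"
        have "(\<integral>\<^sup>+t. ennreal (\<phi> t) * indicator {x..x + h} t \<partial>lborel) = (\<integral>\<^sup>+t. ennreal (indicator {x..x + h} t *\<^sub>R \<phi> t) \<partial>lborel)"
          by (intro nn_integral_cong) (auto split: split_indicator)
        also have "\<dots> = ennreal (LINT t:{x..x + h}|lborel. \<phi> t)"
          using int[of x "x + h"] nn unfolding set_integrable_def set_lebesgue_integral_def
          by (intro nn_integral_eq_integral) auto
        also have "(LINT t:{x..x + h}|lborel. \<phi> t) = integral {x..x + h} \<phi>"
          by (rule set_borel_integral_eq_integral(2)[OF int])
        also have "ennreal (integral {x..x + h} \<phi>) \<le> ennreal ((\<phi> x + e) * h)"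
        proof (rule ennreal_leI)
          have "integral {x..x + h} \<phi> / h \<le> \<phi> x + e"
            using d(2)[of h] h by linarith
          then show "integral {x..x + h} \<phi> \<le> (\<phi> x + e) * h"
            using h by (simp add: divide_le_eq)
        qed
        finally show "(\<integral>\<^sup>+t. ennreal (\<phi> t) * indicator {x..x + h} t \<partial>lborel) \<le> ennreal ((\<phi> x + e) * h)" .
      qed
    qed
  qed
qed

text \<open>Averages to the left of \<open>x\<close> are averages to the right of \<open>- x\<close>
  for the reflected function.\<close>

lemma AE_symmetric_average:
  fixes \<phi> :: "real \<Rightarrow> real"
  assumes [measurable]: "\<phi> \<in> borel_measurable borel" and nn: "\<And>t. 0 \<le> \<phi> t"
    and int: "\<And>a b. set_integrable lborel {a..b} \<phi>"
  shows "AE x in lborel. \<forall>e>0. \<exists>d>0. \<forall>h. 0 < h \<and> h < d \<longrightarrow>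
    (\<integral>\<^sup>+t. ennreal (\<phi> t) * indicator {x - h..x + h} t \<partial>lborel) \<le> ennreal (2 * (\<phi> x + e) * h)"
proof -
  have int': "set_integrable lborel {a..b} (\<lambda>t. \<phi> (- t))" for a b
  proof -
    have eq: "indicator {- b..- a} (0 + - 1 * t) *\<^sub>R \<phi> (0 + - 1 * t) = indicator {a..b} t *\<^sub>R \<phi> (- t)" for t
      by (auto simp: indicator_def)
    show ?thesis
      using lborel_integrable_real_affine[OF int[of "- b" "- a", unfolded set_integrable_def], of "- 1" 0]
      unfolding set_integrable_def eq by simp
  qed
  have "AE x in lborel. \<forall>e>0. \<exists>d>0. \<forall>h. 0 < h \<and> h < d \<longrightarrow>
      (\<integral>\<^sup>+t. ennreal (\<phi> (- t)) * indicator {x..x + h} t \<partial>lborel) \<le> ennreal ((\<phi> (- x) + e) * h)"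
    using nn int' by (intro AE_right_average) auto
  from AE_lborel_reflect[OF this] AE_right_average[OF assms]
  show ?thesis
  proof eventually_elim
    case (elim x)
    show ?case
    proof (intro allI impI)
      fix e :: real assume e: "0 < e"
      obtain d1 where d1: "0 < d1" "\<And>h. 0 < h \<Longrightarrow> h < d1 \<Longrightarrow>
        (\<integral>\<^sup>+t. ennreal (\<phi> (- t)) * indicator {- x..- x + h} t \<partial>lborel) \<le> ennreal ((\<phi> x + e) * h)"
        using elim(1) e by auto
      obtain d2 where d2: "0 < d2" "\<And>h. 0 < h \<Longrightarrow> h < d2 \<Longrightarrow>
        (\<integral>\<^sup>+t. ennreal (\<phi> t) * indicator {x..x + h} t \<partial>lborel) \<le> ennreal ((\<phi> x + e) * h)"
        using elim(2) e by auto
      show "\<exists>d>0. \<forall>h. 0 < h \<and> h < d \<longrightarrow>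
        (\<integral>\<^sup>+t. ennreal (\<phi> t) * indicator {x - h..x + h} t \<partial>lborel) \<le> ennreal (2 * (\<phi> x + e) * h)"
      proof (intro exI[of _ "min d1 d2"] conjI allI impI)
        fix h assume h: "0 < h \<and> h < min d1 d2"
        have "(\<integral>\<^sup>+t. ennreal (\<phi> t) * indicator {x - h..x + h} t \<partial>lborel) \<le>
          (\<integral>\<^sup>+t. ennreal (\<phi> t) * indicator {- x..- x + h} (- t) + ennreal (\<phi> t) * indicator {x..x + h} t \<partial>lborel)"
          by (intro nn_integral_mono) (auto split: split_indicator)
        also have "\<dots> = (\<integral>\<^sup>+t. ennreal (\<phi> t) * indicator {- x..- x + h} (- t) \<partial>lborel) + (\<integral>\<^sup>+t. ennreal (\<phi> t) * indicator {x..x + h} t \<partial>lborel)"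
          by (rule nn_integral_add) measurable
        also have "(\<integral>\<^sup>+t. ennreal (\<phi> t) * indicator {- x..- x + h} (- t) \<partial>lborel) =
            (\<integral>\<^sup>+t. ennreal (\<phi> (- t)) * indicator {- x..- x + h} t \<partial>lborel)"
          using nn_integral_reflect[of "\<lambda>t. ennreal (\<phi> (- t)) * indicator {- x..- x + h} t"] by simp
        also have "\<dots> + (\<integral>\<^sup>+t. ennreal (\<phi> t) * indicator {x..x + h} t \<partial>lborel) \<le> ennreal ((\<phi> x + e) * h) + ennreal ((\<phi> x + e) * h)"
          using d1(2)[of h] d2(2)[of h] h by (intro add_mono) auto
        also have "\<dots> = ennreal (2 * (\<phi> x + e) * h)"
          using nn[of x] e h by (subst ennreal_plus[symmetric]) (auto simp: algebra_simps)
        finally show "(\<integral>\<^sup>+t. ennreal (\<phi> t) * indicator {x - h..x + h} t \<partial>lborel) \<le> ennreal (2 * (\<phi> x + e) * h)" .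
      qed (use d1 d2 in auto)
    qed
  qed
qed

text \<open>The averages of \<open>norm (f t - q)\<close> are controlled outside one null set for
  all \<open>q\<close> of a countable dense set; at a given \<open>x\<close>, such a
  \<open>q\<close> close to \<open>f x\<close> replaces \<open>f x\<close>.\<close>

lemma AE_lebesgue_point:
  fixes f :: "real \<Rightarrow> complex"
  assumes [measurable]: "f \<in> borel_measurable borel" and int: "\<And>a b. set_integrable lborel {a..b} f"
  shows "AE x in lborel. \<forall>e>0. \<exists>d>0. \<forall>h. 0 < h \<and> h < d \<longrightarrow>
    (\<integral>\<^sup>+t. ennreal (norm (f t - f x)) * indicator {x - h..x + h} t \<partial>lborel) \<le> ennreal (e * h)"
proof -
  obtain D :: "complex set" where D: "countable D" "\<And>X. open X \<Longrightarrow> X \<noteq> {} \<Longrightarrow> \<exists>d\<in>D. d \<in> X"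
    using countable_dense_setE by blast
  have "AE x in lborel. \<forall>q\<in>D. \<forall>e>0. \<exists>d>0. \<forall>h. 0 < h \<and> h < d \<longrightarrow>
    (\<integral>\<^sup>+t. ennreal (norm (f t - q)) * indicator {x - h..x + h} t \<partial>lborel) \<le> ennreal (2 * (norm (f x - q) + e) * h)"
  proof (subst AE_ball_countable[OF D(1)], rule ballI, rule AE_symmetric_average)
    fix q a b
    have "set_integrable lborel {a..b} (\<lambda>t. f t - q)"
      by (intro set_integral_diff int) (auto simp: set_integrable_def intro!: integrable_mult_indicator borel_integrable_compact compact_Icc)
    from set_integrable_norm[OF this]
    show "set_integrable lborel {a..b} (\<lambda>t. norm (f t - q))" .
  qed auto
  then show ?thesis
  proof eventually_elim
    case (elim x)
    show ?case
    proof (intro allI impI)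
      fix e :: real assume e: "0 < e"
      \<comment> \<open>Replacing \<open>f x\<close> by \<open>q\<close> leaves the coefficient
        \<open>4 * norm (f x - q) + e / 4\<close>, which is below \<open>3 * e / 4\<close>.\<close>
      obtain q where q: "q \<in> D" "q \<in> ball (f x) (e / 8)"
        using D(2)[of "ball (f x) (e / 8)"] e by auto
      then have qe: "norm (f x - q) < e / 8" by (simp add: dist_norm)
      have "0 < e / 8" using e by simp
      from elim[rule_format, OF q(1) this] obtain d where d: "0 < d" "\<And>h. 0 < h \<Longrightarrow> h < d \<Longrightarrow>
        (\<integral>\<^sup>+t. ennreal (norm (f t - q)) * indicator {x - h..x + h} t \<partial>lborel) \<le> ennreal (2 * (norm (f x - q) + e / 8) * h)"
        by blast
      show "\<exists>d>0. \<forall>h. 0 < h \<and> h < d \<longrightarrow>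
        (\<integral>\<^sup>+t. ennreal (norm (f t - f x)) * indicator {x - h..x + h} t \<partial>lborel) \<le> ennreal (e * h)"
      proof (intro exI[of _ d] conjI allI impI d(1))
        fix h assume h: "0 < h \<and> h < d"
        have "(\<integral>\<^sup>+t. ennreal (norm (f t - f x)) * indicator {x - h..x + h} t \<partial>lborel) \<le>
          (\<integral>\<^sup>+t. ennreal (norm (f t - q)) * indicator {x - h..x + h} t + ennreal (norm (f x - q)) * indicator {x - h..x + h} t \<partial>lborel)"
        proof (rule nn_integral_mono)
          fix t
          have "norm (f t - f x) \<le> norm (f t - q) + norm (f x - q)"
            using norm_triangle_ineq4[of "f t - q" "f x - q"] by simp
          then have "ennreal (norm (f t - f x)) \<le> ennreal (norm (f t - q)) + ennreal (norm (f x - q))"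
            using ennreal_leI by fastforce
          then show "ennreal (norm (f t - f x)) * indicator {x - h..x + h} t \<le>
             ennreal (norm (f t - q)) * indicator {x - h..x + h} t + ennreal (norm (f x - q)) * indicator {x - h..x + h} t"
            by (auto split: split_indicator)
        qed
        also have "\<dots> = (\<integral>\<^sup>+t. ennreal (norm (f t - q)) * indicator {x - h..x + h} t \<partial>lborel) + ennreal (norm (f x - q)) * ennreal (2 * h)"
          using h by (subst nn_integral_add) (auto simp: nn_integral_cmult_indicator)
        also have "\<dots> \<le> ennreal (2 * (norm (f x - q) + e / 8) * h) + ennreal (norm (f x - q) * (2 * h))"
          using d(2)[of h] h by (intro add_mono) (auto simp: ennreal_mult)
        also have "\<dots> = ennreal (2 * (norm (f x - q) + e / 8) * h + norm (f x - q) * (2 * h))"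
          using h e by (intro ennreal_plus[symmetric]) auto
        also have "\<dots> \<le> ennreal (e * h)"
        proof (rule ennreal_leI)
          have "(2 * (norm (f x - q) + e / 8) + 2 * norm (f x - q)) * h \<le> e * h"
            using qe h e by (intro mult_right_mono) auto
          then show "2 * (norm (f x - q) + e / 8) * h + norm (f x - q) * (2 * h) \<le> e * h"
            by (simp add: algebra_simps)
        qed
        finally show "(\<integral>\<^sup>+t. ennreal (norm (f t - f x)) * indicator {x - h..x + h} t \<partial>lborel) \<le> ennreal (e * h)" .
      qed
    qed
  qed
qed

text \<open>Take the least \<open>k\<close> with \<open>\<bar>u\<bar> \<le> 2 ^ k * s\<close>: if
  \<open>k > 0\<close>, minimality gives \<open>\<bar>u\<bar> > 2 ^ (k - 1) * s\<close>, and the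
  kernel is at most \<open>s / u\<^sup>2\<close>.\<close>

lemma poisson_kernel_le_dyadic:
  assumes "0 < s"
  obtains k :: nat where "\<bar>u\<bar> \<le> 2 ^ k * s" "poisson_kernel s u \<le> 4 / (4 ^ k * s)"
proof -
  obtain n :: nat where "\<bar>u\<bar> / s < 2 ^ n"
    using real_arch_pow[of 2 "\<bar>u\<bar> / s"] by auto
  then have ex: "\<exists>n::nat. \<bar>u\<bar> \<le> 2 ^ n * s"
    using assms by (intro exI[of _ n]) (simp add: field_simps)
  define k where "k = (LEAST n::nat. \<bar>u\<bar> \<le> 2 ^ n * s)"
  have k: "\<bar>u\<bar> \<le> 2 ^ k * s"
    unfolding k_def by (rule LeastI_ex[OF ex])
  have pk: "poisson_kernel s u \<le> s / (u\<^sup>2 + s\<^sup>2)"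
    unfolding poisson_kernel_def using assms pi_ge_two
    by (intro divide_left_mono) (auto intro!: mult_pos_pos add_nonneg_pos simp: mult_le_cancel_right1 not_sum_power2_lt_zero)
  have "poisson_kernel s u \<le> 4 / (4 ^ k * s)"
  proof (cases k)
    case 0
    have "s / (u\<^sup>2 + s\<^sup>2) \<le> s / s\<^sup>2"
      using assms by (intro divide_left_mono) (auto intro!: mult_pos_pos add_nonneg_pos)
    also have "\<dots> \<le> 4 / s"
      using assms by (simp add: power2_eq_square divide_right_mono)
    finally show ?thesis using pk 0 by simp
  next
    case (Suc j)
    then have "\<not> \<bar>u\<bar> \<le> 2 ^ j * s"
      using not_less_Least[of j "\<lambda>n. \<bar>u\<bar> \<le> 2 ^ n * s"] unfolding k_def by auto
    then have "(2 ^ j * s)\<^sup>2 \<le> \<bar>u\<bar>\<^sup>2"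
      using assms by (intro power_mono) auto
    then have "(2 ^ j * s)\<^sup>2 \<le> u\<^sup>2 + s\<^sup>2"
      unfolding power2_abs using zero_le_power2[of s] by linarith
    then have "s / (u\<^sup>2 + s\<^sup>2) \<le> s / (2 ^ j * s)\<^sup>2"
      using assms by (intro divide_left_mono) (auto intro!: mult_pos_pos add_nonneg_pos)
    also have "(2 ^ j * s)\<^sup>2 = 4 ^ j * (s * s)"
    proof -
      have "(2 ^ j * s)\<^sup>2 = (2 * 2) ^ j * (s * s)"
        unfolding power_mult_distrib power2_eq_square by (simp add: mult_ac)
      then show ?thesis by simp
    qed
    also have "s / (4 ^ j * (s * s)) = 4 / (4 ^ k * s)"
      using assms Suc by simp
    finally show ?thesis using pk by simp
  qed
  with k that show ?thesis by blast
qed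

text \<open>The kernel is dominated by a sum of multiples of interval indicators; level
  \<open>k\<close> contributes \<open>4 / (4 ^ k * s)\<close> times \<open>e * 2 ^ k * s\<close>,
  and the geometric series adds up to \<open>8 * e\<close>, independently of
  \<open>s\<close>.\<close>

lemma poisson_near_bound:
  fixes \<psi> :: "real \<Rightarrow> ennreal"
  assumes [measurable]: "\<psi> \<in> borel_measurable borel" and s: "0 < s" and e: "0 < e" and d: "0 < d"
    and avg: "\<And>h. 0 < h \<Longrightarrow> h \<le> d \<Longrightarrow> (\<integral>\<^sup>+t. \<psi> t * indicator {x - h..x + h} t \<partial>lborel) \<le> ennreal (e * h)"
  shows "(\<integral>\<^sup>+t. ennreal (poisson_kernel s (t - x)) * (\<psi> t * indicator {x - d..x + d} t) \<partial>lborel) \<le> ennreal (8 * e)"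
proof -
  define a where "a k = 4 / (4 ^ k * s)" for k :: nat
  \<comment> \<open>The radii are capped at \<open>d\<close> because averages are controlled only up
    to there.\<close>
  define m where "m k = min (2 ^ k * s) d" for k :: nat
  have m: "0 < m k" "m k \<le> d" "m k \<le> 2 ^ k * s" for k
    using s d by (auto simp: m_def)
  have "(\<integral>\<^sup>+t. ennreal (poisson_kernel s (t - x)) * (\<psi> t * indicator {x - d..x + d} t) \<partial>lborel)
     \<le> (\<integral>\<^sup>+t. (\<Sum>k. ennreal (a k) * (\<psi> t * indicator {x - m k..x + m k} t)) \<partial>lborel)"
  proof (rule nn_integral_mono)
    fix t
    obtain k where k: "\<bar>t - x\<bar> \<le> 2 ^ k * s" "poisson_kernel s (t - x) \<le> a k"
      using poisson_kernel_le_dyadic[OF s, of "t - x"] unfolding a_def by blast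
    have "ennreal (poisson_kernel s (t - x)) * (\<psi> t * indicator {x - d..x + d} t) \<le> ennreal (a k) * (\<psi> t * indicator {x - m k..x + m k} t)"
    proof (intro mult_mono ennreal_leI k(2))
      show "(indicator {x - d..x + d} t :: ennreal) \<le> indicator {x - m k..x + m k} t"
        using k(1) by (auto simp: m_def abs_le_iff split: split_indicator)
    qed auto
    also have "\<dots> \<le> (\<Sum>k. ennreal (a k) * (\<psi> t * indicator {x - m k..x + m k} t))"
      using sum_le_suminf[of "\<lambda>k. ennreal (a k) * (\<psi> t * indicator {x - m k..x + m k} t)" "{k}"] by simp
    finally show "ennreal (poisson_kernel s (t - x)) * (\<psi> t * indicator {x - d..x + d} t) \<le> \<dots>" .
  qed
  also have "\<dots> = (\<Sum>k. ennreal (a k) * (\<integral>\<^sup>+t. \<psi> t * indicator {x - m k..x + m k} t \<partial>lborel))"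
    by (subst nn_integral_suminf) (auto simp: nn_integral_cmult)
  also have "\<dots> \<le> (\<Sum>k. ennreal (4 * e * (1 / 2) ^ k))"
  proof (intro suminf_le)
    fix k
    have "ennreal (a k) * (\<integral>\<^sup>+t. \<psi> t * indicator {x - m k..x + m k} t \<partial>lborel) \<le> ennreal (a k) * ennreal (e * (2 ^ k * s))"
      using m[of k] e by (intro mult_left_mono order_trans[OF avg] ennreal_leI) auto
    also have "\<dots> = ennreal (4 * e * (1 / 2) ^ k)"
    proof -
      have "a k * (e * (2 ^ k * s)) = 4 * e * (2 ^ k / 4 ^ k)"
        using s by (simp add: a_def field_simps)
      also have "(2 ^ k / 4 ^ k :: real) = (1 / 2) ^ k"
        by (simp flip: power_divide)
      finally show ?thesis
        using s e by (subst ennreal_mult[symmetric]) (auto simp: a_def)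
    qed
    finally show "ennreal (a k) * (\<integral>\<^sup>+t. \<psi> t * indicator {x - m k..x + m k} t \<partial>lborel) \<le> ennreal (4 * e * (1 / 2) ^ k)" .
  qed auto
  also have "\<dots> = ennreal (8 * e)"
    using sums_mult[OF geometric_sums[of "1 / 2 :: real"], of "4 * e"] e by (intro suminf_ennreal_eq) auto
  finally show ?thesis .
qed

text \<open>Near a Lebesgue point \<open>poisson_near_bound\<close> applies. Away from it the kernel
  is at most \<open>s\<close> times a fixed weight, so the tail vanishes with
  \<open>s\<close>.\<close>

lemma AE_poisson_point:
  assumes f: "f \<in> Lp p" and p: "1 < p"
  shows "AE x in lborel. \<forall>e>0. \<forall>\<^sub>F s in at_right 0.
     (\<integral>\<^sup>+t. ennreal (poisson_kernel s (t - x)) * ennreal (norm (f t - f x)) \<partial>lborel) \<le> ennreal e"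
proof -
  note [measurable] = LpD[OF f]
  have "set_integrable lborel {a..b} f" for a b
  proof -
    define R where "R = 1 + max \<bar>a\<bar> \<bar>b\<bar>"
    have "integrable lborel (\<lambda>t. f t * of_real (indicator {a..b} t))"
    proof (rule Lp_mult_decay_integrable[OF f p, where x = 0 and K = R])
      show "norm (complex_of_real (indicator {a..b} t)) \<le> R / (1 + \<bar>t - 0\<bar>)" for t
        by (auto simp: R_def le_divide_eq split: split_indicator)
    qed measurable
    then show ?thesis
      by (simp add: set_integrable_def scaleR_conv_of_real mult.commute)
  qed
  from AE_lebesgue_point[OF LpD[OF f] this] show ?thesis
  proof eventually_elim
    case (elim x)
    show ?case
    proof (intro allI impI)
      fix e :: real assume e: "0 < e"
      \<comment> \<open>The near part will cost \<open>8 * (e / 16)\<close>, leaving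
        \<open>e / 2\<close> for the tail.\<close>
      have "0 < e / 16" using e by simp
      then obtain d0 where d0: "0 < d0" "\<And>h. 0 < h \<Longrightarrow> h < d0 \<Longrightarrow>
        (\<integral>\<^sup>+t. ennreal (norm (f t - f x)) * indicator {x - h..x + h} t \<partial>lborel) \<le> ennreal (e / 16 * h)"
        using elim by blast
      define d where "d = d0 / 2"
      have d: "0 < d" "d < d0" using d0 by (auto simp: d_def)
      \<comment> \<open>\<open>w\<close> dominates \<open>1 / (t - x)\<^sup>2\<close> outside the
        interval of radius \<open>d\<close>. The square is essential: the constant
        \<open>f x\<close> is subtracted from \<open>f\<close>, so \<open>w\<close> must itself be
        integrable, which it is as a product of two functions in \<open>L\<^sup>2\<close>.\<close>
      define w where "w t = ((1 + 1 / d) / (1 + \<bar>t - x\<bar>)) ^ 2" for t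
      have [measurable]: "w \<in> borel_measurable borel"
        unfolding w_def by measurable
      have wle: "w t \<le> (1 + 1 / d)^2 / (1 + \<bar>t - x\<bar>)" "0 \<le> w t" for t
      proof -
        have "(1 + \<bar>t - x\<bar>) ^ 1 \<le> (1 + \<bar>t - x\<bar>)^2"
          by (intro power_increasing) auto
        then show "w t \<le> (1 + 1 / d)^2 / (1 + \<bar>t - x\<bar>)"
          unfolding w_def power_divide by (intro divide_left_mono) (auto intro!: mult_pos_pos zero_less_power add_pos_nonneg)
      qed (simp add: w_def)
      define T where "T = (\<integral>\<^sup>+t. ennreal (w t) * ennreal (norm (f t - f x)) \<partial>lborel)"
      have Tfin: "T < \<infinity>"
      proof -
        have 1: "integrable lborel (\<lambda>t. f t * of_real (w t))"
          using wle by (intro Lp_mult_decay_integrable[OF f p, where x = x and K = "(1 + 1 / d)^2"]) auto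
        have "(\<lambda>t. complex_of_real ((1 + 1 / d) / (1 + \<bar>t - x\<bar>))) \<in> Lp 2"
          by (rule Lp_decay[where K = "1 + 1 / d" and x = x]) (use d in \<open>auto simp del: of_real_divide of_real_add\<close>)
        from Lp_mult_integrable[OF this this]
        have 2: "integrable lborel (\<lambda>t. complex_of_real (w t))"
          by (simp add: w_def power2_eq_square)
        have "integrable lborel (\<lambda>t. f t * of_real (w t) - of_real (w t) * f x)"
          using 1 2 by (intro Bochner_Integration.integrable_diff integrable_mult_left)
        moreover have "ennreal (w t) * ennreal (norm (f t - f x)) = ennreal (norm (f t * of_real (w t) - of_real (w t) * f x))" for t
        proof -
          have "f t * of_real (w t) - of_real (w t) * f x = of_real (w t) * (f t - f x)"
            by (simp add: algebra_simps)
          then show ?thesis using wle(2)[of t] by (simp add: norm_mult ennreal_mult)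
        qed
        ultimately show ?thesis
          unfolding T_def by (simp add: integrable_iff_bounded)
      qed
      have tail: "poisson_kernel s (t - x) \<le> s * w t" if "0 < s" "\<not> (x - d \<le> t \<and> t \<le> x + d)" for s t
      proof -
        have u: "d < \<bar>t - x\<bar>" using that by linarith
        then have "1 < \<bar>t - x\<bar> / d" using d by simp
        then have "1 + \<bar>t - x\<bar> \<le> \<bar>t - x\<bar> / d + \<bar>t - x\<bar>" by simp
        then have "1 + \<bar>t - x\<bar> \<le> (1 + 1 / d) * \<bar>t - x\<bar>" by (simp add: algebra_simps)
        then have "1 \<le> ((1 + 1 / d) * \<bar>t - x\<bar>) / (1 + \<bar>t - x\<bar>)"
          by (subst le_divide_eq_1_pos) auto
        then have "1 \<le> ((1 + 1 / d) / (1 + \<bar>t - x\<bar>)) * \<bar>t - x\<bar>"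
          by simp
        then have "1\<^sup>2 \<le> (((1 + 1 / d) / (1 + \<bar>t - x\<bar>)) * \<bar>t - x\<bar>)\<^sup>2"
          by (intro power_mono) auto
        then have *: "1 \<le> w t * (t - x)\<^sup>2"
          unfolding w_def power_mult_distrib by simp
        have "poisson_kernel s (t - x) \<le> s / (t - x)\<^sup>2"
          unfolding poisson_kernel_def using that u d pi_ge_two
          by (intro divide_left_mono mult_pos_pos add_nonneg_pos order_trans[OF _ mult_mono[of 1 pi "(t - x)\<^sup>2"]]) auto
        also have "\<dots> \<le> s * (w t * (t - x)\<^sup>2) / (t - x)\<^sup>2"
          using * that by (intro divide_right_mono) (auto intro: mult_left_mono[of 1, simplified])
        also have "\<dots> = s * w t"
          using u d by simp
        finally show ?thesis .
      qed
      obtain T' where T': "0 \<le> T'" "T = ennreal T'"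
        using Tfin by (cases T) auto
      have "\<forall>\<^sub>F s in at_right 0. s < e / (2 * (T' + 1))"
        using e T' by (intro eventually_at_rightI[of 0 "e / (2 * (T' + 1))"]) auto
      then show "\<forall>\<^sub>F s in at_right 0.
         (\<integral>\<^sup>+t. ennreal (poisson_kernel s (t - x)) * ennreal (norm (f t - f x)) \<partial>lborel) \<le> ennreal e"
        using eventually_at_right_less[of 0]
      proof eventually_elim
        case (elim s)
        have "(\<integral>\<^sup>+t. ennreal (poisson_kernel s (t - x)) * ennreal (norm (f t - f x)) \<partial>lborel) \<le>
          (\<integral>\<^sup>+t. ennreal (poisson_kernel s (t - x)) * (ennreal (norm (f t - f x)) * indicator {x - d..x + d} t)
             + ennreal s * (ennreal (w t) * ennreal (norm (f t - f x))) \<partial>lborel)"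
        proof (rule nn_integral_mono)
          fix t
          show "ennreal (poisson_kernel s (t - x)) * ennreal (norm (f t - f x)) \<le>
            ennreal (poisson_kernel s (t - x)) * (ennreal (norm (f t - f x)) * indicator {x - d..x + d} t)
             + ennreal s * (ennreal (w t) * ennreal (norm (f t - f x)))"
          proof (cases "x - d \<le> t \<and> t \<le> x + d")
            case False
            have "ennreal (poisson_kernel s (t - x)) \<le> ennreal s * ennreal (w t)"
              using tail[OF elim(2) False] elim wle by (subst ennreal_mult[symmetric]) (auto intro: ennreal_leI)
            from mult_right_mono[OF this, of "ennreal (norm (f t - f x))"] show ?thesis
              using False by (auto simp: mult.assoc)
          qed simp
        qed
        also have "\<dots> = (\<integral>\<^sup>+t. ennreal (poisson_kernel s (t - x)) * (ennreal (norm (f t - f x)) * indicator {x - d..x + d} t) \<partial>lborel) + ennreal s * T"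
          unfolding T_def by (subst nn_integral_add) (auto simp: nn_integral_cmult)
        also have "\<dots> \<le> ennreal (8 * (e / 16)) + ennreal (e / 2)"
        proof (rule add_mono)
          show "(\<integral>\<^sup>+t. ennreal (poisson_kernel s (t - x)) * (ennreal (norm (f t - f x)) * indicator {x - d..x + d} t) \<partial>lborel) \<le> ennreal (8 * (e / 16))"
            using e d d0(2) elim by (intro poisson_near_bound) auto
          have "s * T' \<le> s * (T' + 1)" using elim by simp
          also have "\<dots> \<le> e / (2 * (T' + 1)) * (T' + 1)"
            using elim T' by (intro mult_right_mono) auto
          also have "\<dots> = e / 2"
          proof -
            have "e / (2 * c) * c = e / 2" if "c \<noteq> 0" for c :: real
              using that by simp
            from this[of "T' + 1"] show ?thesis using T' by simp
          qed
          finally show "ennreal s * T \<le> ennreal (e / 2)"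
            using elim T' by (simp add: ennreal_mult[symmetric] ennreal_leI)
        qed
        also have "\<dots> = ennreal e"
          using e by (subst ennreal_plus[symmetric]) auto
        finally show ?case .
      qed
    qed
  qed
qed

text \<open>Subtracting the total mass times \<open>f x\<close> replaces \<open>f t\<close> by
  \<open>f t - f x\<close> under the integral. Kernels merely dominated by the Poisson kernel are
  allowed, to cover also the difference between \<open>conj_kernel\<close> and
  \<open>trunc_kernel\<close>.\<close>

lemma norm_kernel_average_le:
  assumes f: "f \<in> Lp p" "1 < p" and k: "k \<in> borel_measurable borel" "\<And>t. \<bar>k t\<bar> \<le> C * poisson_kernel s (t - x)"
    and s: "0 < s" and C: "0 \<le> C"
  shows "ennreal (norm ((LINT t|lborel. of_real (k t) * f t) - of_real (LINT t|lborel. k t) * f x)) \<le>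
    ennreal C * (\<integral>\<^sup>+t. ennreal (poisson_kernel s (t - x)) * ennreal (norm (f t - f x)) \<partial>lborel)"
    and "integrable lborel (\<lambda>t. of_real (k t) * f t)" and "integrable lborel k"
proof -
  note [measurable] = LpD[OF f(1)] k(1)
  have pk: "0 \<le> poisson_kernel s u" for u using poisson_kernel_nonneg[of s u] s by simp
  show int1: "integrable lborel (\<lambda>t. of_real (k t) * f t)"
  proof (rule Bochner_Integration.integrable_bound)
    show "integrable lborel (\<lambda>t. C * norm (of_real (poisson_kernel s (t - x)) * f t))"
      by (intro integrable_mult_right integrable_norm poisson_integrable[OF f s])
    show "AE t in lborel. norm (of_real (k t) * f t) \<le> norm (C * norm (of_real (poisson_kernel s (t - x)) * f t))"
    proof (rule AE_I2)
      fix t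
      have "\<bar>k t\<bar> * norm (f t) \<le> C * poisson_kernel s (t - x) * norm (f t)"
        by (intro mult_right_mono k) auto
      then show "norm (of_real (k t) * f t) \<le> norm (C * norm (of_real (poisson_kernel s (t - x)) * f t))"
        using C pk by (simp add: norm_mult abs_mult mult.assoc)
    qed
  qed measurable
  show int2: "integrable lborel k"
  proof (rule Bochner_Integration.integrable_bound)
    show "integrable lborel (\<lambda>t. C * poisson_kernel s (t - x))"
      using poisson_kernel_integrable[OF s, of x] by (simp add: poisson_kernel_commute)
    show "AE t in lborel. norm (k t) \<le> norm (C * poisson_kernel s (t - x))"
      using k(2) C pk by (simp add: abs_mult)
  qed measurable
  have int3: "integrable lborel (\<lambda>t. of_real (k t) * f x)"
    using int2 by (intro integrable_mult_left integrable_of_real)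
  have "(LINT t|lborel. of_real (k t) * f t) - of_real (LINT t|lborel. k t) * f x =
      (LINT t|lborel. of_real (k t) * f t) - (LINT t|lborel. of_real (k t) * f x)"
    by (simp only: integral_mult_left_zero integral_complex_of_real)
  also have "\<dots> = (LINT t|lborel. of_real (k t) * f t - of_real (k t) * f x)"
    by (rule Bochner_Integration.integral_diff[OF int1 int3, symmetric])
  finally have eq: "(LINT t|lborel. of_real (k t) * f t) - of_real (LINT t|lborel. k t) * f x = \<dots>" .
  have "ennreal (norm (LINT t|lborel. of_real (k t) * f t - of_real (k t) * f x)) \<le>
      (\<integral>\<^sup>+t. ennreal (norm (of_real (k t) * f t - of_real (k t) * f x)) \<partial>lborel)"
    by (rule integral_norm_bound_ennreal[OF Bochner_Integration.integrable_diff[OF int1 int3]])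
  also have "\<dots> \<le> (\<integral>\<^sup>+t. ennreal C * (ennreal (poisson_kernel s (t - x)) * ennreal (norm (f t - f x))) \<partial>lborel)"
  proof (rule nn_integral_mono)
    fix t
    have "norm (of_real (k t) * f t - of_real (k t) * f x) = \<bar>k t\<bar> * norm (f t - f x)"
      by (simp add: norm_mult flip: right_diff_distrib)
    also have "\<dots> \<le> C * (poisson_kernel s (t - x) * norm (f t - f x))"
      using mult_right_mono[OF k(2)[of t] norm_ge_zero[of "f t - f x"]] by (simp add: mult.assoc)
    finally have "ennreal (norm (of_real (k t) * f t - of_real (k t) * f x)) \<le> ennreal (C * (poisson_kernel s (t - x) * norm (f t - f x)))"
      by (rule ennreal_leI)
    also have "\<dots> = ennreal C * (ennreal (poisson_kernel s (t - x)) * ennreal (norm (f t - f x)))"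
      using C pk by (simp add: ennreal_mult)
    finally show "ennreal (norm (of_real (k t) * f t - of_real (k t) * f x)) \<le> \<dots>" .
  qed
  also have "\<dots> = ennreal C * (\<integral>\<^sup>+t. ennreal (poisson_kernel s (t - x)) * ennreal (norm (f t - f x)) \<partial>lborel)"
    by (rule nn_integral_cmult) measurable
  finally show "ennreal (norm ((LINT t|lborel. of_real (k t) * f t) - of_real (LINT t|lborel. k t) * f x)) \<le> \<dots>"
    unfolding eq .
qed

text \<open>Used with \<open>c = 1\<close> for the Poisson kernel and with \<open>c = 0\<close> for
  the odd difference of the two regularised kernels \<open>1 / u\<close>.\<close>

lemma AE_kernel_average_tendsto:
  assumes f: "f \<in> Lp p" "1 < p"
    and k: "\<And>s x. 0 < s \<Longrightarrow> k s x \<in> borel_measurable borel" "\<And>s x t. 0 < s \<Longrightarrow> \<bar>k s x t\<bar> \<le> C * poisson_kernel s (t - x)"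
    and c: "\<And>s x. 0 < s \<Longrightarrow> (LINT t|lborel. k s x t) = c" and C: "0 \<le> C"
  shows "AE x in lborel. ((\<lambda>s. LINT t|lborel. of_real (k s x t) * f t) \<longlongrightarrow> of_real c * f x) (at_right 0)"
  using AE_poisson_point[OF f]
proof eventually_elim
  case (elim x)
  show ?case
  proof (rule LIM_zero_cancel, rule tendstoI)
    fix e :: real assume e: "0 < e"
    then have "0 < e / (2 * (C + 1))" using C by simp
    with elim have "\<forall>\<^sub>F s in at_right 0.
       (\<integral>\<^sup>+t. ennreal (poisson_kernel s (t - x)) * ennreal (norm (f t - f x)) \<partial>lborel) \<le> ennreal (e / (2 * (C + 1)))"
      by blast
    then show "\<forall>\<^sub>F s in at_right 0. dist ((LINT t|lborel. of_real (k s x t) * f t) - of_real c * f x) 0 < e"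
      using eventually_at_right_less[of 0]
    proof eventually_elim
      case (elim s)
      have "ennreal (norm ((LINT t|lborel. of_real (k s x t) * f t) - of_real c * f x)) \<le>
          ennreal C * (\<integral>\<^sup>+t. ennreal (poisson_kernel s (t - x)) * ennreal (norm (f t - f x)) \<partial>lborel)"
        using norm_kernel_average_le(1)[OF f k(1)[OF elim(2), of x] k(2)[OF elim(2), of x] elim(2) C] c[of s x] elim by simp
      also have "\<dots> \<le> ennreal C * ennreal (e / (2 * (C + 1)))"
        by (intro mult_left_mono elim) auto
      also have "\<dots> = ennreal (C * (e / (2 * (C + 1))))"
        using C e by (subst ennreal_mult) auto
      finally have "norm ((LINT t|lborel. of_real (k s x t) * f t) - of_real c * f x) \<le> C * (e / (2 * (C + 1)))"
        using C e by (subst (asm) ennreal_le_iff) auto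
      also have "\<dots> < e"
        using C e by (simp add: field_simps add_nonneg_pos)
      finally show ?case by simp
    qed
  qed
qed

section \<open>Convergence of Poisson integrals, completeness, and the boundary function\<close>

lemma AE_poisson_tendsto:
  assumes "f \<in> Lp p" "1 < p"
  shows "AE x in lborel. ((\<lambda>s. poisson f s x) \<longlongrightarrow> f x) (at_right 0)"
proof -
  have "AE x in lborel. ((\<lambda>s. LINT t|lborel. of_real (poisson_kernel s (t - x)) * f t) \<longlongrightarrow> of_real 1 * f x) (at_right 0)"
    using poisson_kernel_integral
    by (intro AE_kernel_average_tendsto[OF assms, where k = "\<lambda>s x t. poisson_kernel s (t - x)" and C = 1])
      (auto simp: poisson_kernel_nonneg poisson_kernel_commute)
  then show ?thesis by (simp add: poisson_def)
qed

text \<open>Almost everywhere convergence together with the contraction property forces norm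
  convergence. Fatou's lemma is applied to the nonnegative functions \<open>g n\<close>: their
  integrals are at most \<open>C - d n\<close>, while their pointwise limit has integral
  \<open>C\<close>, so \<open>d n\<close> tends to \<open>0\<close>.\<close>

lemma poisson_tendsto_Lp:
  assumes f: "f \<in> Lp p" "1 < p" and e: "0 < e"
  shows "\<forall>\<^sub>F s in at_right 0. pmass p (\<lambda>x. f x - poisson f s x) \<le> ennreal e"
proof (rule sequentially_imp_eventually_at_right[of 0 1])
  \<comment> \<open>Fatou's lemma concerns sequences, hence an arbitrary sequence of heights
    decreasing to the boundary value \<open>0\<close> in the limit.\<close>
  fix s :: "nat \<Rightarrow> real"
  assume s: "\<And>n. 0 < s n" "s \<longlonglongrightarrow> 0"
  note [measurable] = LpD[OF f(1)]
  define u where "u n = poisson f (s n)" for n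
  have uLp: "u n \<in> Lp p" for n
    unfolding u_def by (rule poisson_Lp[OF f s(1)])
  have [measurable]: "u n \<in> borel_measurable borel" for n
    by (rule LpD[OF uLp])
  have fuLp: "(\<lambda>x. f x - u n x) \<in> Lp p" for n
    using f uLp by (intro Lp_diff) auto
  define g where "g n x = 2 powr p * (norm (f x) powr p + norm (u n x) powr p) - norm (f x - u n x) powr p" for n x
  have g0: "0 \<le> g n x" for n x
  proof -
    have "norm (f x - u n x) powr p \<le> (norm (f x) + norm (u n x)) powr p"
      using f(2) norm_triangle_ineq4 by (intro powr_mono2) auto
    also have "\<dots> \<le> 2 powr p * (norm (f x) powr p + norm (u n x) powr p)"
      using f(2) by (intro powr_add_le) auto
    finally show ?thesis by (simp add: g_def)
  qed
  define m where "m = (LINT x|lborel. norm (f x) powr p)"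
  define d where "d n = (LINT x|lborel. norm (f x - u n x) powr p)" for n
  define C where "C = 2 powr p * (m + m)"
  have pm: "pmass p h = ennreal (LINT x|lborel. norm (h x) powr p)" if "h \<in> Lp p" for h
    unfolding pmass_def using Lp_powr_integrable[OF that] by (intro nn_integral_eq_integral) auto
  have mn: "(LINT x|lborel. norm (u n x) powr p) \<le> m" for n
    using poisson_contraction[OF f s(1)[of n]] unfolding u_def[symmetric] pm[OF uLp] pm[OF f(1)] m_def
    by (subst (asm) ennreal_le_iff) auto
  have int_g: "integrable lborel (g n)" for n
    unfolding g_def using Lp_powr_integrable[OF f(1)] Lp_powr_integrable[OF uLp[of n]] Lp_powr_integrable[OF fuLp[of n]]
    by auto
  have g_le: "(LINT x|lborel. g n x) \<le> C - d n" for n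
  proof -
    have "(LINT x|lborel. g n x) = 2 powr p * (m + (LINT x|lborel. norm (u n x) powr p)) - d n"
      unfolding g_def m_def d_def using Lp_powr_integrable[OF f(1)] Lp_powr_integrable[OF uLp[of n]] Lp_powr_integrable[OF fuLp[of n]]
      by simp
    then show ?thesis
      using mn[of n] by (simp add: C_def)
  qed
  have m0: "0 \<le> m" by (simp add: m_def)
  have d_le: "d n \<le> C" for n
  proof -
    have "0 \<le> (LINT x|lborel. g n x)"
      by (intro integral_nonneg_AE AE_I2 g0)
    then show ?thesis using g_le[of n] by simp
  qed
  have "AE x in lborel. (\<lambda>n. u n x) \<longlonglongrightarrow> f x"
    using AE_poisson_tendsto[OF f]
  proof eventually_elim
    case (elim x)
    have "filterlim s (at_right 0) sequentially"
      using s by (intro tendsto_imp_filterlim_at_right) auto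
    from filterlim_compose[OF elim this] show ?case
      by (simp add: u_def)
  qed
  then have lim: "AE x in lborel. (\<lambda>n. ennreal (g n x)) \<longlonglongrightarrow> ennreal (2 powr p * (norm (f x) powr p + norm (f x) powr p))"
  proof eventually_elim
    case (elim x)
    have "(\<lambda>n. g n x) \<longlonglongrightarrow> 2 powr p * (norm (f x) powr p + norm (f x) powr p) - norm (f x - f x) powr p"
      unfolding g_def using f(2) by (intro tendsto_intros tendsto_powr' elim) auto
    then show ?case by (intro tendsto_ennrealI) simp
  qed
  have "ennreal C = ennreal (LINT x|lborel. 2 powr p * (norm (f x) powr p + norm (f x) powr p))"
    using Lp_powr_integrable[OF f(1)] by (simp add: C_def m_def)
  also have "\<dots> = (\<integral>\<^sup>+x. ennreal (2 powr p * (norm (f x) powr p + norm (f x) powr p)) \<partial>lborel)"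
    using Lp_powr_integrable[OF f(1)] by (intro nn_integral_eq_integral[symmetric]) auto
  also have "\<dots> \<le> (\<integral>\<^sup>+x. liminf (\<lambda>n. ennreal (g n x)) \<partial>lborel)"
  proof (rule nn_integral_mono_AE)
    show "AE x in lborel. ennreal (2 powr p * (norm (f x) powr p + norm (f x) powr p)) \<le> liminf (\<lambda>n. ennreal (g n x))"
      using lim by eventually_elim (metis lim_imp_Liminf order_refl trivial_limit_sequentially)
  qed
  also have "\<dots> \<le> liminf (\<lambda>n. \<integral>\<^sup>+x. ennreal (g n x) \<partial>lborel)"
    by (rule nn_integral_liminf) (unfold g_def, measurable)
  also have "\<dots> \<le> liminf (\<lambda>n. ennreal (C - d n))"
  proof (intro Liminf_mono always_eventually allI)
    fix n
    have "(\<integral>\<^sup>+x. ennreal (g n x) \<partial>lborel) = ennreal (LINT x|lborel. g n x)"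
      using int_g g0 by (intro nn_integral_eq_integral) auto
    then show "(\<integral>\<^sup>+x. ennreal (g n x) \<partial>lborel) \<le> ennreal (C - d n)"
      using g_le[of n] by (simp add: ennreal_leI)
  qed
  finally have C_le: "ennreal C \<le> liminf (\<lambda>n. ennreal (C - d n))" .
  have C0: "0 \<le> C" using m0 by (simp add: C_def)
  have "\<forall>\<^sub>F n in sequentially. d n \<le> e"
  \<comment> \<open>If \<open>C > e\<close> then \<open>C\<close> is positive, as the strict
    inequality in \<open>ennreal\<close> requires; otherwise
    \<open>d n \<le> C \<le> e\<close>.\<close>
  proof (cases "C \<le> e")
    case True
    then show ?thesis using d_le order_trans by (intro always_eventually) blast
  next
    case False
    then have "ennreal (C - e) < ennreal C"
      using e by (intro ennreal_lessI) auto
    with C_le have "ennreal (C - e) < liminf (\<lambda>n. ennreal (C - d n))"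
      by order
    from less_LiminfD[OF this] show ?thesis
    proof eventually_elim
      case (elim n)
      then have "\<not> C - d n \<le> C - e"
        using ennreal_leI[of "C - d n" "C - e"] by auto
      then show ?case by simp
    qed
  qed
  then show "\<forall>\<^sub>F n in sequentially. pmass p (\<lambda>x. f x - poisson f (s n) x) \<le> ennreal e"
    using pm[OF fuLp] unfolding u_def d_def by (auto intro: ennreal_leI elim: eventually_mono)
qed simp

text \<open>The Riesz-Fischer argument: a rapidly converging subsequence has an almost everywhere
  limit, and Fatou's lemma transfers the Cauchy estimate for the whole sequence to that
  limit.\<close>

lemma Lp_complete:
  fixes u :: "nat \<Rightarrow> real \<Rightarrow> complex"
  assumes u: "\<And>n. u n \<in> Lp p" and p: "1 \<le> p"
    and Cauchy: "\<And>e. 0 < e \<Longrightarrow> \<exists>N. \<forall>m\<ge>N. \<forall>n\<ge>N. pmass p (\<lambda>x. u m x - u n x) \<le> ennreal e"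
  obtains h where "h \<in> Lp p" "\<And>e. 0 < e \<Longrightarrow> \<exists>N. \<forall>n\<ge>N. pmass p (\<lambda>x. u n x - h x) \<le> ennreal e"
proof -
  note [measurable] = LpD[OF u]
  \<comment> \<open>With this rate the masses of \<open>2 ^ k * (v (Suc k) - v k)\<close> are
    summable, so almost everywhere these functions tend to \<open>0\<close> and the increments are
    eventually at most \<open>(1 / 2) ^ k\<close>.\<close>
  define e where "e k = (1 / 2) ^ k / (2 ^ k) powr p" for k :: nat
  have e0: "0 < e k" for k by (simp add: e_def)
  obtain N where N: "\<And>k m n. N k \<le> m \<Longrightarrow> N k \<le> n \<Longrightarrow> pmass p (\<lambda>x. u m x - u n x) \<le> ennreal (e k)"
    using Cauchy[OF e0] by metis
  \<comment> \<open>Summing the indices makes \<open>r\<close> monotone and at least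
    \<open>N k\<close>; the summand \<open>k\<close> drives it to infinity.\<close>
  define r where "r k = (\<Sum>i\<le>k. N i) + k" for k
  have r: "N k \<le> r k" "k \<le> r k" "r k \<le> r (Suc k)" for k
    using member_le_sum[of k "{..k}" N] by (auto simp: r_def)
  define v where "v k = u (r k)" for k
  have [measurable]: "v k \<in> borel_measurable borel" for k
    unfolding v_def by measurable
  define g where "g k x = (2 ^ k * norm (v (Suc k) x - v k x)) powr p" for k x
  have "(\<integral>\<^sup>+x. (\<Sum>k. ennreal (g k x)) \<partial>lborel) = (\<Sum>k. \<integral>\<^sup>+x. ennreal (g k x) \<partial>lborel)"
    unfolding g_def by (rule nn_integral_suminf) measurable
  also have "\<dots> \<le> (\<Sum>k. ennreal ((1 / 2) ^ k))"
  proof (intro suminf_le allI)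
    fix k
    have "(\<integral>\<^sup>+x. ennreal (g k x) \<partial>lborel) = pmass p (\<lambda>x. of_real (2 ^ k) * (v (Suc k) x - v k x))"
      unfolding pmass_def g_def norm_mult norm_of_real by simp
    also have "\<dots> = ennreal ((2 ^ k) powr p) * pmass p (\<lambda>x. v (Suc k) x - v k x)"
      by (subst pmass_cmult) (auto simp del: of_real_power)
    also have "\<dots> \<le> ennreal ((2 ^ k) powr p) * ennreal (e k)"
      unfolding v_def using r(1)[of k] r(3)[of k] by (intro mult_left_mono N) auto
    also have "\<dots> = ennreal ((1 / 2) ^ k)"
      by (subst ennreal_mult[symmetric]) (auto simp: e_def)
    finally show "(\<integral>\<^sup>+x. ennreal (g k x) \<partial>lborel) \<le> ennreal ((1 / 2) ^ k)" .
  qed auto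
  also have "\<dots> = ennreal 2"
    using geometric_sums[of "1 / 2 :: real"] by (intro suminf_ennreal_eq) auto
  finally have "(\<integral>\<^sup>+x. (\<Sum>k. ennreal (g k x)) \<partial>lborel) \<noteq> \<infinity>"
    using ennreal_less_top[of 2] by (auto simp: top_unique)
  then have "AE x in lborel. (\<Sum>k. ennreal (g k x)) \<noteq> \<infinity>"
    unfolding g_def by (intro nn_integral_noteq_infinite) measurable
  then have conv: "AE x in lborel. convergent (\<lambda>k. v k x)"
  proof eventually_elim
    case (elim x)
    have "summable (\<lambda>k. g k x)"
      using elim by (intro summable_suminf_not_top) (auto simp: g_def)
    then have "(\<lambda>k. g k x) \<longlonglongrightarrow> 0"
      by (rule summable_LIMSEQ_zero)
    then have "\<forall>\<^sub>F k in sequentially. g k x < 1"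
      by (rule order_tendstoD) simp
    then have "\<forall>\<^sub>F k in sequentially. norm (v (Suc k) x - v k x) \<le> (1 / 2) ^ k"
    proof eventually_elim
      case (elim k)
      have "\<not> 1 < 2 ^ k * norm (v (Suc k) x - v k x)"
      proof
        assume "1 < 2 ^ k * norm (v (Suc k) x - v k x)"
        then have "1 powr p < (2 ^ k * norm (v (Suc k) x - v k x)) powr p"
          using p by (intro powr_less_mono2) auto
        with elim show False by (simp add: g_def)
      qed
      then show ?case by (simp add: power_divide field_simps)
    qed
    then have "summable (\<lambda>k. v (Suc k) x - v k x)"
      by (rule summable_comparison_test_ev) (simp add: summable_geometric)
    then have "convergent (\<lambda>k. (\<Sum>i<k. v (Suc i) x - v i x))"
      by (simp add: summable_iff_convergent)
    then have "convergent (\<lambda>k. v k x - v 0 x)"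
      by (simp add: sum_lessThan_telescope[of "\<lambda>k. v k x"])
    then show ?case
      using convergent_add[OF _ convergent_const[of "v 0 x"]] by fastforce
  qed
  define h where "h x = lim (\<lambda>k. v k x)" for x
  have [measurable]: "h \<in> borel_measurable borel"
    unfolding h_def by measurable
  have lim: "AE x in lborel. (\<lambda>k. v k x) \<longlonglongrightarrow> h x"
    using conv by eventually_elim (simp add: h_def convergent_LIMSEQ_iff)
  have close: "\<exists>N. \<forall>n\<ge>N. pmass p (\<lambda>x. u n x - h x) \<le> ennreal \<epsilon>" if \<epsilon>: "0 < \<epsilon>" for \<epsilon>
  proof -
    obtain M where M: "\<And>m n. M \<le> m \<Longrightarrow> M \<le> n \<Longrightarrow> pmass p (\<lambda>x. u m x - u n x) \<le> ennreal \<epsilon>"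
      using Cauchy[OF \<epsilon>] by blast
    show ?thesis
    proof (intro exI[of _ M] allI impI)
      fix n assume n: "M \<le> n"
      show "pmass p (\<lambda>x. u n x - h x) \<le> ennreal \<epsilon>"
      proof (rule pmass_Fatou)
        show "AE x in lborel. (\<lambda>k. u n x - v (k + M) x) \<longlonglongrightarrow> u n x - h x"
          using lim by eventually_elim (intro tendsto_intros LIMSEQ_ignore_initial_segment)
        show "pmass p (\<lambda>x. u n x - v (k + M) x) \<le> ennreal \<epsilon>" for k
          unfolding v_def using r(2)[of "k + M"] n by (intro M) auto
      qed (use p in auto)
    qed
  qed
  obtain N1 where "pmass p (\<lambda>x. u N1 x - h x) \<le> ennreal 1"
    using close[of 1] by auto
  then have "(\<lambda>x. u N1 x - h x) \<in> Lp p"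
    by (intro LpI) (auto simp: le_less_trans)
  from Lp_diff[OF u[of N1] this] have "(\<lambda>x. u N1 x - (u N1 x - h x)) \<in> Lp p"
    using p by simp
  then have "h \<in> Lp p" by simp
  with close that show ?thesis by blast
qed

text \<open>Evaluation of a Poisson integral at a fixed point of height \<open>s\<close> is
  continuous on \<open>L\<^sup>p\<close>; this turns norm convergence of boundary functions into
  pointwise convergence of their extensions.\<close>

lemma poisson_norm_powr_le:
  assumes "f \<in> Lp p" "1 < p" "0 < s"
  shows "ennreal (norm (poisson f s x) powr p) \<le> ennreal (1 + 1 / s) * pmass p f"
proof -
  have "ennreal (norm (poisson f s x) powr p) \<le> ennreal (LINT t|lborel. poisson_kernel s (t - x) * norm (f t) powr p)"
    by (intro ennreal_leI poisson_powr_le assms)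
  also have "\<dots> \<le> ennreal (LINT t|lborel. (1 + 1 / s) * norm (f t) powr p)"
  proof (intro ennreal_leI integral_mono poisson_powr_le assms)
    show "integrable lborel (\<lambda>t. (1 + 1 / s) * norm (f t) powr p)"
      by (intro integrable_mult_right Lp_powr_integrable assms)
    fix t
    have "poisson_kernel s (t - x) \<le> (1 + 1 / s) / (1 + \<bar>t - x\<bar>)"
      by (rule poisson_kernel_bound[OF assms(3)])
    also have "\<dots> \<le> (1 + 1 / s) / 1"
      using assms by (intro divide_left_mono) auto
    finally show "poisson_kernel s (t - x) * norm (f t) powr p \<le> (1 + 1 / s) * norm (f t) powr p"
      by (intro mult_right_mono) auto
  qed
  also have "\<dots> = ennreal (1 + 1 / s) * pmass p f"
  proof -
    have "pmass p f = ennreal (LINT x|lborel. norm (f x) powr p)"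
      unfolding pmass_def using Lp_powr_integrable[OF assms(1)] by (intro nn_integral_eq_integral) auto
    moreover have "ennreal ((1 + 1 / s) * (LINT x|lborel. norm (f x) powr p)) =
        ennreal (1 + 1 / s) * ennreal (LINT x|lborel. norm (f x) powr p)"
      by (rule ennreal_mult) (use assms in auto)
    ultimately show ?thesis
      by (simp only: integral_mult_right_zero)
  qed
  finally show ?thesis .
qed

lemma poisson_lincomb:
  assumes "f \<in> Lp p" "g \<in> Lp p" "1 < p" "0 < s"
  shows "poisson (\<lambda>t. a * f t + b * g t) s x = a * poisson f s x + b * poisson g s x"
proof -
  note int = poisson_integrable[OF assms(1,3,4), of x] poisson_integrable[OF assms(2,3,4), of x]
  have "poisson (\<lambda>t. a * f t + b * g t) s x =
      (LINT t|lborel. a * (of_real (poisson_kernel s (t - x)) * f t) + b * (of_real (poisson_kernel s (t - x)) * g t))"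
    unfolding poisson_def by (simp add: algebra_simps)
  also have "\<dots> = a * poisson f s x + b * poisson g s x"
    unfolding poisson_def
    by (simp only: Bochner_Integration.integral_add[OF integrable_mult_right[OF int(1)] integrable_mult_right[OF int(2)]]
        integral_mult_right_zero)
  finally show ?thesis .
qed

lemma poisson_diff:
  assumes "f \<in> Lp p" "g \<in> Lp p" "1 < p" "0 < s"
  shows "poisson (\<lambda>t. f t - g t) s x = poisson f s x - poisson g s x"
  using poisson_lincomb[OF assms, of 1 "- 1"] by simp

lemma poisson_cnj: "poisson (\<lambda>t. cnj (f t)) s x = cnj (poisson f s x)"
proof -
  have "cnj (poisson f s x) = (LINT t|lborel. cnj (of_real (poisson_kernel s (t - x)) * f t))"
    unfolding poisson_def by (rule Bochner_Integration.integral_cnj[symmetric])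
  then show ?thesis by (simp add: poisson_def)
qed

text \<open>
  The boundary function is obtained in \<open>L\<^sup>p\<close>: translating \<open>y\<close> by \<open>a\<close> amounts to replacing \<open>f\<close> by its
  Poisson integral, so \<open>C\<^sub>y f - C\<^bsub>y+a\<^esub> f = C\<^sub>y (f - P\<^sub>a f)\<close> is small uniformly in \<open>y\<close>.
\<close>
theorem cauchy_tr_boundary:
  assumes f: "f \<in> Lp p" "1 < p"
  obtains h where "h \<in> Lp p" "\<And>x s. 0 < s \<Longrightarrow> cauchy_tr f (Complex x s) = poisson h s x"
proof -
  obtain K where K: "0 \<le> K" "\<And>f y. f \<in> Lp p \<Longrightarrow> 0 < y \<Longrightarrow>
      pmass p (\<lambda>x. cauchy_tr f (Complex x y)) \<le> ennreal K * pmass p f"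
    using cauchy_tr_bounded[OF f(2)] unfolding cauchy_bounded_def by blast
  note [measurable] = LpD[OF f(1)]
  define u where "u n x = cauchy_tr f (Complex x (1 / real (Suc n)))" for n x
  have uLp: "u n \<in> Lp p" for n
  proof (rule LpI)
    have "pmass p (u n) \<le> ennreal K * pmass p f"
      unfolding u_def by (rule K(2)[OF f(1)]) simp
    also have "\<dots> < \<infinity>" using Lp_finite[OF f(1)] by (simp add: ennreal_mult_less_top)
    finally show "pmass p (u n) < \<infinity>" .
    show "u n \<in> borel_measurable borel"
      unfolding u_def by measurable
  qed
  have shift: "pmass p (\<lambda>x. cauchy_tr f (Complex x y) - cauchy_tr f (Complex x (y + a))) \<le> ennreal K * pmass p (\<lambda>x. f x - poisson f a x)"
    if "0 < y" "0 < a" for y a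
  proof -
    have P: "poisson f a \<in> Lp p" by (rule poisson_Lp[OF f that(2)])
    have "cauchy_tr f (Complex x y) - cauchy_tr f (Complex x (y + a)) = cauchy_tr (\<lambda>t. f t - poisson f a t) (Complex x y)" for x
    proof -
      have "Complex x (y + a) = Complex x y + \<i> * of_real a" by (simp add: complex_eq_iff)
      then have "cauchy_tr f (Complex x (y + a)) = cauchy_tr (poisson f a) (Complex x y)"
        using cauchy_tr_poisson[OF f that(2), of "Complex x y"] that by simp
      moreover have "cauchy_tr (\<lambda>t. f t + (- 1) * poisson f a t) (Complex x y) =
          cauchy_tr f (Complex x y) + (- 1) * cauchy_tr (poisson f a) (Complex x y)"
        using that by (intro cauchy_tr_lincomb[OF f(1) P f(2)]) simp
      ultimately show ?thesis by simp
    qed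
    moreover have "(\<lambda>t. f t - poisson f a t) \<in> Lp p"
      using f P by (intro Lp_diff) auto
    ultimately show ?thesis
      using K(2) that by simp
  qed
  have Cauchy: "\<exists>N. \<forall>m\<ge>N. \<forall>n\<ge>N. pmass p (\<lambda>x. u m x - u n x) \<le> ennreal e" if e: "0 < e" for e
  proof -
    have "0 < e / (K + 1)" using e K by simp
    from poisson_tendsto_Lp[OF f this] obtain d where d: "0 < d" "\<And>s. 0 < s \<Longrightarrow> s < d \<Longrightarrow> pmass p (\<lambda>x. f x - poisson f s x) \<le> ennreal (e / (K + 1))"
      unfolding eventually_at_right_field by auto
    obtain N :: nat where N: "1 / real (Suc N) < d"
      using nat_approx_posE[OF d(1)] by auto
    have main: "pmass p (\<lambda>x. u n x - u m x) \<le> ennreal e" if "N \<le> m" "m \<le> n" for m n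
    proof (cases "m = n")
      case False
      \<comment> \<open>\<open>a\<close> is the difference of the two heights; it is below
        \<open>d\<close>, so \<open>shift\<close> and the norm convergence of Poisson integrals
        apply.\<close>
      define a where "a = 1 / real (Suc m) - 1 / real (Suc n)"
      have "1 / real (Suc m) \<le> 1 / real (Suc N)"
        using that by (intro divide_left_mono) auto
      moreover have "1 / real (Suc n) < 1 / real (Suc m)"
        using that False by (intro divide_strict_left_mono) auto
      moreover have "0 < 1 / real (Suc n)" by simp
      ultimately have a: "0 < a" "a < d"
        using N by (auto simp only: a_def)
      have "pmass p (\<lambda>x. u n x - u m x) \<le> ennreal K * pmass p (\<lambda>x. f x - poisson f a x)"
        using shift[of "1 / real (Suc n)" a] a unfolding u_def a_def by simp
      also have "\<dots> \<le> ennreal K * ennreal (e / (K + 1))"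
        by (intro mult_left_mono d a) auto
      also have "\<dots> = ennreal (K * (e / (K + 1)))"
        using K e by (intro ennreal_mult[symmetric]) auto
      also have "\<dots> \<le> ennreal e"
        using K e by (intro ennreal_leI) (simp add: field_simps)
      finally show ?thesis .
    qed (simp add: pmass_def)
    have "pmass p (\<lambda>x. u m x - u n x) \<le> ennreal e" if "N \<le> m" "N \<le> n" for m n
      using main[of m n] main[of n m] that by (cases "m \<le> n") (auto simp: pmass_def norm_minus_commute)
    then show ?thesis by blast
  qed
  obtain h where h: "h \<in> Lp p" "\<And>e. 0 < e \<Longrightarrow> \<exists>N. \<forall>n\<ge>N. pmass p (\<lambda>x. u n x - h x) \<le> ennreal e"
    using Lp_complete[OF uLp less_imp_le[OF f(2)] Cauchy] by blast
  \<comment> \<open>The Poisson integrals of \<open>u n\<close> at height \<open>s\<close> have two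
    limits: that of \<open>h\<close>, by continuity of evaluation, and the transform at height
    \<open>s\<close>, since they equal the transform at height \<open>1 / Suc n + s\<close>.\<close>
  have repr: "cauchy_tr f (Complex x s) = poisson h s x" if s: "0 < s" for x s
  proof -
    have "(\<lambda>n. poisson (u n) s x) \<longlonglongrightarrow> poisson h s x"
    proof (rule LIM_zero_cancel, rule tendstoI)
      fix e :: real assume e: "0 < e"
      define e' where "e' = e powr p / (2 * (1 + 1 / s))"
      have e': "0 < e'" using e s by (simp add: e'_def add_pos_pos)
      from h(2)[OF this] obtain N where N: "\<And>n. N \<le> n \<Longrightarrow> pmass p (\<lambda>x. u n x - h x) \<le> ennreal e'"
        by blast
      have "dist (poisson (u n) s x - poisson h s x) 0 < e" if n: "N \<le> n" for n
      proof -
        have "(\<lambda>x. u n x - h x) \<in> Lp p"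
          using f by (intro Lp_diff uLp h) auto
        from poisson_norm_powr_le[OF this f(2) s, of x]
        have "ennreal (norm (poisson (u n) s x - poisson h s x) powr p) \<le> ennreal (1 + 1 / s) * pmass p (\<lambda>x. u n x - h x)"
          by (simp only: poisson_diff[OF uLp h(1) f(2) s])
        also have "\<dots> \<le> ennreal (1 + 1 / s) * ennreal e'"
          by (intro mult_left_mono N n) auto
        also have "\<dots> = ennreal ((1 + 1 / s) * e')"
          using s e' by (intro ennreal_mult[symmetric]) auto
        also have "(1 + 1 / s) * e' = e powr p / 2"
        proof -
          have "1 + 1 / s \<noteq> 0" using s by (simp add: add_pos_pos less_imp_neq[symmetric])
          then have "(1 + 1 / s) * (c / (2 * (1 + 1 / s))) = c / 2" for c
            by (metis mult.commute nonzero_mult_div_cancel_left times_divide_eq_right mult_divide_mult_cancel_left)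
          then show ?thesis by (simp only: e'_def)
        qed
        finally have le: "norm (poisson (u n) s x - poisson h s x) powr p \<le> e powr p / 2"
          using e by (subst (asm) ennreal_le_iff) auto
        have "\<not> e \<le> norm (poisson (u n) s x - poisson h s x)"
        proof
          assume "e \<le> norm (poisson (u n) s x - poisson h s x)"
          then have "e powr p \<le> norm (poisson (u n) s x - poisson h s x) powr p"
            using e f(2) by (intro powr_mono2) auto
          moreover have "0 < e powr p" using e by simp
          ultimately show False using le by linarith
        qed
        then show ?thesis by simp
      qed
      then show "\<forall>\<^sub>F n in sequentially. dist (poisson (u n) s x - poisson h s x) 0 < e"
        unfolding eventually_sequentially by blast
    qed
    moreover have "(\<lambda>n. poisson (u n) s x) \<longlonglongrightarrow> cauchy_tr f (Complex x s)"
    proof -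
      have eq: "poisson (u n) s x = cauchy_tr f (Complex x (1 / real (Suc n) + s))" for n
        unfolding u_def using poisson_cauchy_tr[OF f s, of "1 / real (Suc n)" x] by simp
      have lim: "(\<lambda>n. Complex x (1 / real (Suc n) + s)) \<longlonglongrightarrow> Complex x (0 + s)"
        by (intro tendsto_intros LIMSEQ_Suc[OF lim_1_over_n])
      have "isCont (cauchy_tr f) (Complex x s)"
        using cauchy_tr_has_field_derivative[OF f, of "Complex x s"] s DERIV_isCont by auto
      then show ?thesis
        unfolding eq using isCont_tendsto_compose[OF _ lim] by simp
    qed
    ultimately show ?thesis by (rule LIMSEQ_unique[THEN sym])
  qed
  with h(1) that show ?thesis by blast
qed

subsection \<open>Principal values\<close>

definition conj_kernel :: "real \<Rightarrow> real \<Rightarrow> real" where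
  "conj_kernel s u = u / (u\<^sup>2 + s\<^sup>2)"

definition conj_poisson :: "(real \<Rightarrow> complex) \<Rightarrow> real \<Rightarrow> real \<Rightarrow> complex" where
  "conj_poisson f s x = (LINT t|lborel. of_real (conj_kernel s (t - x)) * f t)"

definition trunc_kernel :: "real \<Rightarrow> real \<Rightarrow> real" where
  "trunc_kernel s u = (if s < \<bar>u\<bar> then 1 / u else 0)"

lemma conj_kernel_measurable [measurable]: "conj_kernel s \<in> borel_measurable borel"
  unfolding conj_kernel_def by measurable

lemma trunc_kernel_measurable [measurable]: "trunc_kernel s \<in> borel_measurable borel"
  unfolding trunc_kernel_def by measurable

lemma conj_kernel_minus: "conj_kernel s (- u) = - conj_kernel s u"
  by (simp add: conj_kernel_def)

lemma trunc_kernel_minus: "trunc_kernel s (- u) = - trunc_kernel s u"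
  by (simp add: trunc_kernel_def)

lemma conj_kernel_eq_Re: "conj_kernel s (t - x) = Re (1 / (of_real t - Complex x s))"
  by (simp add: conj_kernel_def Re_divide power2_eq_square)

lemma conj_kernel_bound:
  assumes "0 < s"
  shows "\<bar>conj_kernel s (t - x)\<bar> \<le> (1 + 1 / s) / (1 + \<bar>t - x\<bar>)"
  unfolding conj_kernel_eq_Re
  using order_trans[OF abs_Re_le_cmod cauchy_kernel_bound[of "Complex x s" t]] assms by simp

lemma conj_poisson_integrable:
  assumes "f \<in> Lp p" "1 < p" "0 < s"
  shows "integrable lborel (\<lambda>t. of_real (conj_kernel s (t - x)) * f t)"
proof -
  have "integrable lborel (\<lambda>t. f t * of_real (conj_kernel s (t - x)))"
    using assms conj_kernel_bound[OF assms(3)]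
    by (intro Lp_mult_decay_integrable[OF assms(1,2), where x = x]) auto
  then show ?thesis by (simp add: mult.commute)
qed

text \<open>Since \<open>f\<close> is complex, the real part must be taken of the kernel and not of
  the transform; hence the mean of the values at conjugate points.\<close>

lemma conj_poisson_eq_cauchy_tr:
  assumes "f \<in> Lp p" "1 < p" "0 < s"
  shows "conj_poisson f s x = (cauchy_tr f (Complex x s) + cauchy_tr f (cnj (Complex x s))) / 2"
proof -
  have eq: "of_real (conj_kernel s (t - x)) * f t =
      (f t / (of_real t - Complex x s) + f t / (of_real t - cnj (Complex x s))) / 2" for t
  proof -
    define w where "w = 1 / (of_real t - Complex x s)"
    have "1 / (of_real t - cnj (Complex x s)) = cnj w"
      by (simp add: w_def)
    moreover have "complex_of_real (conj_kernel s (t - x)) = (w + cnj w) / 2"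
      unfolding conj_kernel_eq_Re w_def[symmetric] by (simp add: complex_add_cnj)
    ultimately have "of_real (conj_kernel s (t - x)) * f t = (f t * w + f t * (1 / (of_real t - cnj (Complex x s)))) / 2"
      by (simp add: algebra_simps)
    then show ?thesis by (simp add: w_def)
  qed
  have int: "integrable lborel (\<lambda>t. f t / (of_real t - Complex x s))"
    "integrable lborel (\<lambda>t. f t / (of_real t - cnj (Complex x s)))"
    using assms by (auto intro!: cauchy_integrable)
  show ?thesis
    unfolding conj_poisson_def eq cauchy_tr_def using int by simp
qed

text \<open>\<open>v\<close> is the conjugate function of \<open>f\<close>, soon identified with the
  principal value. The contribution of the lower half-plane comes from the boundary function of
  \<open>cnj f\<close>.\<close>

theorem conj_poisson_boundary:
  assumes f: "f \<in> Lp p" "1 < p"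
  obtains v where "v \<in> Lp p" "\<And>x s. 0 < s \<Longrightarrow> conj_poisson f s x = poisson v s x"
proof -
  obtain h where h: "h \<in> Lp p" "\<And>x s. 0 < s \<Longrightarrow> cauchy_tr f (Complex x s) = poisson h s x"
    using cauchy_tr_boundary[OF f] by blast
  obtain h' where h': "h' \<in> Lp p" "\<And>x s. 0 < s \<Longrightarrow> cauchy_tr (\<lambda>t. cnj (f t)) (Complex x s) = poisson h' s x"
    using cauchy_tr_boundary[OF Lp_cnj[OF f(1)] f(2)] by blast
  define v where "v t = 1 / 2 * h t + 1 / 2 * cnj (h' t)" for t
  have "v \<in> Lp p"
    unfolding v_def using f h h' by (intro Lp_add Lp_cmult Lp_cnj) auto
  moreover have "conj_poisson f s x = poisson v s x" if s: "0 < s" for x s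
  proof -
    have "poisson v s x = 1 / 2 * poisson h s x + 1 / 2 * poisson (\<lambda>t. cnj (h' t)) s x"
      unfolding v_def by (rule poisson_lincomb[OF h(1) Lp_cnj[OF h'(1)] f(2) s])
    then show ?thesis
      using h(2)[OF s] h'(2)[OF s] by (simp add: conj_poisson_eq_cauchy_tr[OF f s] cauchy_tr_cnj poisson_cnj add_divide_distrib)
  qed
  ultimately show ?thesis using that by blast
qed

text \<open>Where \<open>\<bar>u\<bar> > s\<close> the difference is
  \<open>- (s\<^sup>2 / u) / (u\<^sup>2 + s\<^sup>2)\<close>, elsewhere it is
  \<open>u / (u\<^sup>2 + s\<^sup>2)\<close>; in both cases the numerator is at most
  \<open>s\<close> in absolute value.\<close>

lemma conj_kernel_diff_trunc_kernel:
  assumes "0 < s"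
  shows "\<bar>conj_kernel s u - trunc_kernel s u\<bar> \<le> pi * poisson_kernel s u"
proof -
  have pos: "0 < u\<^sup>2 + s\<^sup>2" using assms by (intro add_nonneg_pos) auto
  have pk: "pi * poisson_kernel s u = s / (u\<^sup>2 + s\<^sup>2)"
    by (simp add: poisson_kernel_def)
  show ?thesis
  proof (cases "s < \<bar>u\<bar>")
    case True
    have u: "u \<noteq> 0" using True assms by auto
    have "conj_kernel s u - trunc_kernel s u = - (s * (s / u)) / (u\<^sup>2 + s\<^sup>2)"
      using True u pos by (simp add: conj_kernel_def trunc_kernel_def field_simps power2_eq_square)
    then have "\<bar>conj_kernel s u - trunc_kernel s u\<bar> = s * (s / \<bar>u\<bar>) / (u\<^sup>2 + s\<^sup>2)"
      using pos assms by (simp add: abs_mult)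
    also have "\<dots> \<le> s * 1 / (u\<^sup>2 + s\<^sup>2)"
      using pos assms True by (intro divide_right_mono mult_left_mono) auto
    finally show ?thesis using pk by simp
  next
    case False
    then have "\<bar>conj_kernel s u - trunc_kernel s u\<bar> = \<bar>u\<bar> / (u\<^sup>2 + s\<^sup>2)"
      using pos by (simp add: conj_kernel_def trunc_kernel_def)
    also have "\<dots> \<le> s / (u\<^sup>2 + s\<^sup>2)"
      using pos False by (intro divide_right_mono) auto
    finally show ?thesis using pk by simp
  qed
qed

lemma odd_integral_eq_0:
  fixes k :: "real \<Rightarrow> real"
  assumes "\<And>u. k (- u) = - k u"
  shows "(LINT t|lborel. k (t - x)) = 0"
proof -
  have "(LINT t|lborel. k (t - x)) = (LINT t|lborel. k (2 * x + (- 1) * t - x))"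
    by (subst lborel_integral_real_affine[where c = "- 1" and t = "2 * x"]) simp_all
  also have "\<dots> = (LINT t|lborel. - k (t - x))"
    using assms[of "t - x" for t] by (intro Bochner_Integration.integral_cong refl) (simp add: algebra_simps)
  finally show ?thesis by simp
qed

text \<open>The truncated kernel is \<open>conj_kernel\<close> minus a kernel dominated by the
  Poisson kernel and, being odd, of mass zero. The first gives Poisson integrals of
  \<open>v\<close>, the second vanishes in the limit.\<close>

lemma AE_trunc_tendsto:
  assumes f: "f \<in> Lp p" "1 < p" and v: "v \<in> Lp p" "\<And>x s. 0 < s \<Longrightarrow> conj_poisson f s x = poisson v s x"
  shows "AE x in lborel. ((\<lambda>s. LINT t|lborel. of_real (trunc_kernel s (t - x)) * f t) \<longlongrightarrow> v x) (at_right 0)"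
proof -
  let ?k = "\<lambda>s x t. conj_kernel s (t - x) - trunc_kernel s (t - x)"
  have kb: "\<bar>?k s x t\<bar> \<le> pi * poisson_kernel s (t - x)" if "0 < s" for s x t
    by (rule conj_kernel_diff_trunc_kernel[OF that])
  have k0: "(LINT t|lborel. ?k s x t) = 0" for s x
    by (rule odd_integral_eq_0[where k = "\<lambda>u. conj_kernel s u - trunc_kernel s u"])
       (simp add: conj_kernel_minus trunc_kernel_minus)
  have "AE x in lborel. ((\<lambda>s. LINT t|lborel. of_real (?k s x t) * f t) \<longlongrightarrow> of_real 0 * f x) (at_right 0)"
    using kb k0 by (intro AE_kernel_average_tendsto[OF f, where C = pi]) auto
  with AE_poisson_tendsto[OF v(1) f(2)] show ?thesis
  proof eventually_elim
    case (elim x)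
    have "((\<lambda>s. poisson v s x - (LINT t|lborel. of_real (?k s x t) * f t)) \<longlongrightarrow> v x - of_real 0 * f x) (at_right 0)"
      by (intro tendsto_diff elim)
    moreover have "\<forall>\<^sub>F s in at_right 0. poisson v s x - (LINT t|lborel. of_real (?k s x t) * f t) =
        (LINT t|lborel. of_real (trunc_kernel s (t - x)) * f t)"
      using eventually_at_right_less[of 0]
    proof eventually_elim
      case (elim s)
      have int: "integrable lborel (\<lambda>t. of_real (?k s x t) * f t)"
        by (rule norm_kernel_average_le(2)[OF f _ kb[OF elim] elim]) auto
      have "(LINT t|lborel. of_real (trunc_kernel s (t - x)) * f t) =
          (LINT t|lborel. of_real (conj_kernel s (t - x)) * f t - of_real (?k s x t) * f t)"
        by (intro Bochner_Integration.integral_cong refl) (simp add: algebra_simps)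
      also have "\<dots> = conj_poisson f s x - (LINT t|lborel. of_real (?k s x t) * f t)"
        unfolding conj_poisson_def
        by (rule Bochner_Integration.integral_diff[OF conj_poisson_integrable[OF f elim] int])
      finally show ?case using v(2)[OF elim] by simp
    qed
    ultimately show ?case
      using Lim_transform_eventually by fastforce
  qed
qed

section \<open>From Lebesgue measurable functions on the half-line to Borel functions on the
  line\<close>

text \<open>A Borel version extended by \<open>0\<close>: the given functions are only Lebesgue
  measurable on the half-line and arbitrary elsewhere, whereas Fubini is applied on products of
  \<open>lborel\<close>.\<close>

definition represents :: "(real \<Rightarrow> complex) \<Rightarrow> (real \<Rightarrow> complex) \<Rightarrow> bool" where
  "represents f F \<longleftrightarrow> f \<in> borel_measurable borel \<and> (\<forall>x\<le>0. f x = 0) \<and> (AE x in lebesgue. 0 < x \<longrightarrow> F x = f x)"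

lemma representsD:
  assumes "represents f F"
  shows "f \<in> borel_measurable borel" "x \<le> 0 \<Longrightarrow> f x = 0" "AE x in lebesgue. 0 < x \<longrightarrow> F x = f x"
  using assms by (auto simp: represents_def)

lemma represents_AE:
  assumes "represents f F"
  shows "AE x in lebesgue. (if x \<in> {0<..} then F x else 0) = f x"
  using representsD(3)[OF assms] by eventually_elim (use representsD(2)[OF assms] in auto)

lemma represents_measurable:
  assumes "represents f F"
  shows "F \<in> borel_measurable (lebesgue_on {0<..})"
proof (rule borel_measurable_if_D)
  show "(\<lambda>x. if x \<in> {0<..} then F x else 0) \<in> borel_measurable lebesgue"
  proof (rule borel_measurable_AE)
    show "f \<in> borel_measurable lebesgue"
      using representsD(1)[OF assms] by (intro measurable_completion) simp
    show "AE x in lebesgue. f x = (if x \<in> {0<..} then F x else 0)"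
      using represents_AE[OF assms] by eventually_elim simp
  qed
qed

lemma represents_exists:
  assumes "F \<in> borel_measurable (lebesgue_on {0<..})"
  obtains f where "represents f F"
proof -
  define F0 where "F0 x = (if x \<in> {0<..} then F x else 0)" for x
  have [measurable]: "F0 \<in> borel_measurable (completion lborel)"
    unfolding F0_def by (rule borel_measurable_if_I[OF assms]) auto
  have "(\<lambda>x. Re (F0 x)) \<in> borel_measurable (completion lborel)" "(\<lambda>x. Im (F0 x)) \<in> borel_measurable (completion lborel)"
    by measurable
  from this[THEN completion_ex_borel_measurable_real] obtain a b
    where ab: "a \<in> borel_measurable lborel" "AE x in lborel. Re (F0 x) = a x"
      "b \<in> borel_measurable lborel" "AE x in lborel. Im (F0 x) = b x"
    by blast
  note [measurable] = ab(1,3)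
  define f where "f x = (if 0 < x then of_real (a x) + \<i> * of_real (b x) else 0)" for x
  have "f \<in> borel_measurable borel"
  proof -
    have "f \<in> borel_measurable lborel" unfolding f_def by measurable
    then show ?thesis by simp
  qed
  moreover have "AE x in lborel. 0 < x \<longrightarrow> F x = f x"
    using ab(2,4) by eventually_elim (auto simp: f_def F0_def complex_eq_iff)
  ultimately have "represents f F"
    unfolding represents_def by (auto simp: f_def intro: AE_completion)
  then show ?thesis by (rule that)
qed

lemma represents_integral:
  assumes fF: "represents f F" and [measurable]: "k \<in> borel_measurable borel" "A \<in> sets borel" and A: "A \<subseteq> {0<..}"
  shows "(LINT s:A|lebesgue. k s * F s) = (LINT s|lborel. indicator A s *\<^sub>R (k s * f s))"
proof -
  note [measurable] = representsD(1)[OF fF]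
  let ?F0 = "\<lambda>x. if x \<in> {0<..} then F x else 0"
  have m0: "?F0 \<in> borel_measurable lebesgue"
    by (rule borel_measurable_if_I[OF represents_measurable[OF fF]]) auto
  have k: "k \<in> borel_measurable lebesgue" and i: "indicator A \<in> borel_measurable (lebesgue :: real measure)"
    by (auto intro!: measurable_completion)
  have m1: "(\<lambda>s. indicator A s *\<^sub>R (k s * f s)) \<in> borel_measurable lborel"
    by simp
  have "(LINT s:A|lebesgue. k s * F s) = (LINT s|lebesgue. indicator A s *\<^sub>R (k s * ?F0 s))"
    unfolding set_lebesgue_integral_def using A
    by (intro Bochner_Integration.integral_cong refl) (auto split: split_indicator)
  also have "\<dots> = (LINT s|lebesgue. indicator A s *\<^sub>R (k s * f s))"
  proof (rule integral_cong_AE)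
    show "(\<lambda>s. indicator A s *\<^sub>R (k s * ?F0 s)) \<in> borel_measurable lebesgue"
      using m0 k i by (intro borel_measurable_scaleR borel_measurable_times)
    show "(\<lambda>s. indicator A s *\<^sub>R (k s * f s)) \<in> borel_measurable lebesgue"
      by (rule measurable_completion[OF m1])
    show "AE s in lebesgue. indicator A s *\<^sub>R (k s * ?F0 s) = indicator A s *\<^sub>R (k s * f s)"
      using represents_AE[OF fF] by eventually_elim simp
  qed
  also have "\<dots> = (LINT s|lborel. indicator A s *\<^sub>R (k s * f s))"
    by (rule integral_completion[OF m1])
  finally show ?thesis .
qed

lemma represents_Lp_iff:
  assumes fF: "represents f F"
  shows "F \<in> Lp_half_line p \<longleftrightarrow> f \<in> Lp p"
proof -
  note [measurable] = representsD(1)[OF fF]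
  let ?F0 = "\<lambda>x. if x \<in> {0<..} then F x else 0"
  have m0: "?F0 \<in> borel_measurable lebesgue"
    by (rule borel_measurable_if_I[OF represents_measurable[OF fF]]) auto
  have m1: "(\<lambda>x. norm (f x) powr p) \<in> borel_measurable lborel"
    by simp
  have "integrable (lebesgue_on {0<..}) (\<lambda>s. norm (F s) powr p) \<longleftrightarrow> integrable lebesgue (\<lambda>s. indicator {0<..} s *\<^sub>R (norm (F s) powr p))"
    by (rule integrable_restrict_space) auto
  also have "\<dots> \<longleftrightarrow> integrable lebesgue (\<lambda>s. norm (?F0 s) powr p)"
    by (intro Bochner_Integration.integrable_cong refl) (auto split: split_indicator)
  also have "\<dots> \<longleftrightarrow> integrable lebesgue (\<lambda>s. norm (f s) powr p)"
  proof (rule integrable_cong_AE)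
    show "(\<lambda>s. norm (?F0 s) powr p) \<in> borel_measurable lebesgue"
      using measurable_compose[OF m0, of "\<lambda>z. norm z powr p" borel] by simp
    show "(\<lambda>s. norm (f s) powr p) \<in> borel_measurable lebesgue"
      by (rule measurable_completion[OF m1])
    show "AE s in lebesgue. norm (?F0 s) powr p = norm (f s) powr p"
      using represents_AE[OF fF] by eventually_elim simp
  qed
  also have "\<dots> \<longleftrightarrow> integrable lborel (\<lambda>s. norm (f s) powr p)"
    by (rule integrable_completion[OF m1])
  finally show ?thesis
    using represents_measurable[OF fF] by (simp add: Lp_half_line_def Lp_iff_integrable)
qed

lemma truncated_transform_eq:
  assumes fF: "represents f F" and t: "0 < t" and e: "0 < \<epsilon>"
  shows "truncated_transform F t \<epsilon> = (LINT s|lborel. of_real (trunc_kernel \<epsilon> (s - t)) * f s)"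
proof -
  have "truncated_transform F t \<epsilon> = (LINT s:{0<..<t - \<epsilon>} \<union> {t + \<epsilon><..}|lebesgue. (1 / of_real (s - t)) * F s)"
    unfolding truncated_transform_def by simp
  also have "\<dots> = (LINT s|lborel. indicator ({0<..<t - \<epsilon>} \<union> {t + \<epsilon><..}) s *\<^sub>R ((1 / of_real (s - t)) * f s))"
    by (rule represents_integral[OF fF]) (use t e in auto)
  also have "\<dots> = (LINT s|lborel. of_real (trunc_kernel \<epsilon> (s - t)) * f s)"
  proof (intro Bochner_Integration.integral_cong refl)
    fix s
    show "indicator ({0<..<t - \<epsilon>} \<union> {t + \<epsilon><..}) s *\<^sub>R ((1 / of_real (s - t)) * f s) = of_real (trunc_kernel \<epsilon> (s - t)) * f s"
    proof (cases "s \<le> 0")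
      case True
      then show ?thesis using representsD(2)[OF fF] by simp
    next
      case False
      then have "s \<in> {0<..<t - \<epsilon>} \<union> {t + \<epsilon><..} \<longleftrightarrow> \<epsilon> < \<bar>s - t\<bar>"
        using e by auto
      then show ?thesis by (simp add: trunc_kernel_def indicator_def)
    qed
  qed
  finally show ?thesis .
qed

theorem pv_transform_boundary:
  assumes fF: "represents f F" and f: "f \<in> Lp p" "1 < p"
    and v: "v \<in> Lp p" "\<And>x s. 0 < s \<Longrightarrow> conj_poisson f s x = poisson v s x"
  shows "AE x in lebesgue. 0 < x \<longrightarrow> pv_exists F x \<and> pv_transform F x = v x"
proof -
  have "AE x in lborel. ((\<lambda>s. LINT t|lborel. of_real (trunc_kernel s (t - x)) * f t) \<longlongrightarrow> v x) (at_right 0)"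
    by (rule AE_trunc_tendsto[OF f v])
  from AE_completion[OF this] show ?thesis
  proof eventually_elim
    case (elim x)
    show ?case
    proof
      assume x: "0 < x"
      have "(truncated_transform F x \<longlongrightarrow> v x) (at_right 0)"
        by (rule Lim_transform_eventually[OF elim])
           (use truncated_transform_eq[OF fF x] in \<open>auto intro!: eventually_mono[OF eventually_at_right_less]\<close>)
      then show "pv_exists F x \<and> pv_transform F x = v x"
        unfolding pv_exists_def pv_transform_def by (auto intro: tendsto_Lim)
    qed
  qed
qed

subsection \<open>The bilinear identity\<close>

text \<open>Hoelder's inequality in qualitative form: Young's inequality for the \<open>r\<close>-th
  powers of the norms, with the conjugate exponents \<open>p / r\<close> and
  \<open>q / r\<close>.\<close>

lemma Lp_mult:
  assumes "f \<in> Lp p" "g \<in> Lp q" "0 < p" "0 < q" "0 < r" "1 / p + 1 / q = 1 / (r :: real)"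
  shows "(\<lambda>x. f x * g x) \<in> Lp r"
proof (rule LpI)
  note [measurable] = LpD[OF assms(1)] LpD[OF assms(2)]
  show "(\<lambda>x. f x * g x) \<in> borel_measurable borel"
    by measurable
  have "1 / p < 1 / r" "1 / q < 1 / r"
    using assms(3-6) by (auto simp flip: assms(6))
  then have "r < p" "r < q"
    using assms(3-5) by (auto simp: field_simps)
  moreover have "r / p + r / q = 1"
  proof -
    have "r / p + r / q = r * (1 / p + 1 / q)" by (simp add: field_simps)
    then show ?thesis using assms by simp
  qed
  ultimately have e: "1 < p / r" "1 < q / r" "1 / (p / r) + 1 / (q / r) = 1"
    using assms(3-5) by auto
  have "pmass r (\<lambda>x. f x * g x) =
      (\<integral>\<^sup>+x. ennreal (norm (complex_of_real (norm (f x) powr r)) * norm (complex_of_real (norm (g x) powr r))) \<partial>lborel)"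
    unfolding pmass_def by (simp add: norm_mult powr_mult)
  also have "\<dots> \<le> pmass (p / r) (\<lambda>x. complex_of_real (norm (f x) powr r)) + pmass (q / r) (\<lambda>x. complex_of_real (norm (g x) powr r))"
    by (rule Young_pmass[OF _ _ e]) measurable
  also have "\<dots> = pmass p f + pmass q g"
    using assms(3-5) unfolding pmass_def by (simp add: powr_powr)
  also have "\<dots> < \<infinity>"
    using Lp_finite[OF assms(1)] Lp_finite[OF assms(2)] by simp
  finally show "pmass r (\<lambda>x. f x * g x) < \<infinity>" .
qed

lemma poisson_weak_limit:
  assumes \<psi>: "\<psi> \<in> Lp p" and v: "v \<in> Lp q" and pq: "1 < p" "1 < q" "1 / p + 1 / q = (1 :: real)"
  shows "((\<lambda>s. LINT x|lborel. \<psi> x * poisson v s x) \<longlongrightarrow> (LINT x|lborel. \<psi> x * v x)) (at_right 0)"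
proof (rule LIM_zero_cancel, rule tendstoI)
  fix e :: real assume e: "0 < e"
  note [measurable] = LpD[OF \<psi>] LpD[OF v]
  obtain A where A: "0 \<le> A" "pmass p \<psi> = ennreal A"
    using Lp_finite[OF \<psi>] by (cases "pmass p \<psi>") auto
  \<comment> \<open>\<eta> makes the first Young term at most \<open>e / 2\<close>, with
    \<open>A + 1\<close> avoiding division by \<open>0\<close>; then \<delta> makes the second term
    \<open>e / 3\<close>, so the sum stays strictly below \<open>e\<close>.\<close>
  define \<eta> where "\<eta> = (e / (2 * (A + 1))) powr (1 / p)"
  have \<eta>: "0 < \<eta>" using e A by (simp add: \<eta>_def)
  have \<eta>A: "\<eta> powr p * A \<le> e / 2"
  proof -
    have "\<eta> powr p * A = e / (2 * (A + 1)) * A"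
      using e A pq by (simp add: \<eta>_def powr_powr)
    also have "\<dots> \<le> e / 2"
      using e A by (simp add: field_simps)
    finally show ?thesis .
  qed
  define \<delta> where "\<delta> = e / 3 / (1 / \<eta>) powr q"
  have \<delta>: "0 < \<delta>" using e \<eta> by (simp add: \<delta>_def)
  show "\<forall>\<^sub>F s in at_right 0. dist ((LINT x|lborel. \<psi> x * poisson v s x) - (LINT x|lborel. \<psi> x * v x)) 0 < e"
    using poisson_tendsto_Lp[OF v pq(2) \<delta>] eventually_at_right_less[of 0]
  proof eventually_elim
    case (elim s)
    have P: "poisson v s \<in> Lp q" by (rule poisson_Lp[OF v pq(2) elim(2)])
    note [measurable] = LpD[OF P]
    let ?d = "\<lambda>x. v x - poisson v s x"
    have d: "?d \<in> Lp q" using v P pq by (intro Lp_diff) auto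
    have "(LINT x|lborel. \<psi> x * poisson v s x) - (LINT x|lborel. \<psi> x * v x) = (LINT x|lborel. \<psi> x * poisson v s x - \<psi> x * v x)"
      by (rule Bochner_Integration.integral_diff[symmetric, OF Lp_mult_integrable[OF \<psi> P pq] Lp_mult_integrable[OF \<psi> v pq]])
    also have "\<dots> = - (LINT x|lborel. \<psi> x * ?d x)"
      by (subst integral_minus[symmetric]) (simp add: algebra_simps)
    finally have eq: "norm ((LINT x|lborel. \<psi> x * poisson v s x) - (LINT x|lborel. \<psi> x * v x)) = norm (LINT x|lborel. \<psi> x * ?d x)"
      by simp
    have "ennreal (norm (LINT x|lborel. \<psi> x * ?d x)) \<le> (\<integral>\<^sup>+x. ennreal (norm (\<psi> x * ?d x)) \<partial>lborel)"
      by (rule integral_norm_bound_ennreal[OF Lp_mult_integrable[OF \<psi> d pq]])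
    also have "\<dots> = (\<integral>\<^sup>+x. ennreal (norm (of_real \<eta> * \<psi> x) * norm (of_real (1 / \<eta>) * ?d x)) \<partial>lborel)"
      using \<eta> by (simp add: norm_mult norm_divide)
    also have "\<dots> \<le> pmass p (\<lambda>x. of_real \<eta> * \<psi> x) + pmass q (\<lambda>x. of_real (1 / \<eta>) * ?d x)"
      by (rule Young_pmass[OF _ _ pq]) measurable
    also have "\<dots> = ennreal (\<eta> powr p) * pmass p \<psi> + ennreal ((1 / \<eta>) powr q) * pmass q ?d"
      using \<eta> by (subst (1 2) pmass_cmult) (auto simp del: of_real_divide)
    also have "\<dots> \<le> ennreal (\<eta> powr p) * ennreal A + ennreal ((1 / \<eta>) powr q) * ennreal \<delta>"
      unfolding A(2) by (intro add_left_mono mult_left_mono elim) auto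
    also have "\<dots> = ennreal (\<eta> powr p * A) + ennreal ((1 / \<eta>) powr q * \<delta>)"
    proof -
      have "ennreal (\<eta> powr p * A) = ennreal (\<eta> powr p) * ennreal A"
        by (rule ennreal_mult) (use A in auto)
      moreover have "ennreal ((1 / \<eta>) powr q * \<delta>) = ennreal ((1 / \<eta>) powr q) * ennreal \<delta>"
        by (rule ennreal_mult) (use \<delta> in auto)
      ultimately show ?thesis by (simp only:)
    qed
    also have "(1 / \<eta>) powr q * \<delta> = e / 3"
      using \<eta> by (simp add: \<delta>_def)
    also have "ennreal (\<eta> powr p * A) + ennreal (e / 3) = ennreal (\<eta> powr p * A + e / 3)"
      by (rule ennreal_plus[symmetric]) (use A e in auto)
    finally have "norm (LINT x|lborel. \<psi> x * ?d x) \<le> \<eta> powr p * A + e / 3"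
      using A e by (subst (asm) ennreal_le_iff) auto
    also have "\<dots> < e" using \<eta>A e by simp
    finally show ?case using eq by simp
  qed
qed

text \<open>For fixed \<open>s > 0\<close> the kernel has no singularity and its rows against
  \<open>g\<close> are uniformly bounded, so the double integral converges absolutely.\<close>

lemma conj_poisson_pairing:
  assumes a: "integrable lborel a" and g: "g \<in> Lp q" "1 < q" and s: "0 < s"
  shows "integrable (lborel \<Otimes>\<^sub>M lborel) (\<lambda>(x, u). a x * (of_real (conj_kernel s (u - x)) * g u))"
    and "(LINT z|(lborel \<Otimes>\<^sub>M lborel). (case z of (x, u) \<Rightarrow> a x * (of_real (conj_kernel s (u - x)) * g u))) =
      (LINT x|lborel. a x * conj_poisson g s x)"
proof -
  note [measurable] = LpD[OF g(1)]
  have [measurable]: "a \<in> borel_measurable borel"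
    using borel_measurable_integrable[OF a] by simp
  let ?F = "\<lambda>x u. a x * (of_real (conj_kernel s (u - x)) * g u)"
  have K: "0 \<le> 1 + 1 / s" using s by simp
  obtain B where B: "0 \<le> B" "\<And>(h :: real \<Rightarrow> complex) x. h \<in> borel_measurable borel \<Longrightarrow>
      (\<And>t. norm (h t) \<le> (1 + 1 / s) / (1 + \<bar>t - x\<bar>)) \<Longrightarrow> (LINT t|lborel. norm (g t * h t)) \<le> B"
    using Lp_mult_decay_bound[OF g K] by blast
  have bd: "(LINT u|lborel. norm (of_real (conj_kernel s (u - x)) * g u)) \<le> B" for x
    using B(2)[of "\<lambda>u. of_real (conj_kernel s (u - x))" x] conj_kernel_bound[OF s] by (simp add: mult.commute)
  show int: "integrable (lborel \<Otimes>\<^sub>M lborel) (case_prod ?F)"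
    by (rule integrable_kernel_product[OF a _ conj_poisson_integrable[OF g s] bd]) measurable
  have "(LINT x|lborel. a x * conj_poisson g s x) = (LINT x|lborel. LINT u|lborel. ?F x u)"
    unfolding conj_poisson_def by (simp only: integral_mult_right_zero)
  then show "(LINT z|(lborel \<Otimes>\<^sub>M lborel). (case z of (x, u) \<Rightarrow> ?F x u)) = (LINT x|lborel. a x * conj_poisson g s x)"
    using lborel_pair.integral_fst[OF int] by simp
qed

lemma has_bochner_integral_product:
  fixes A B :: "real \<Rightarrow> complex"
  assumes A: "integrable lborel A" and B: "integrable lborel B"
  shows "has_bochner_integral (lborel \<Otimes>\<^sub>M lborel) (\<lambda>(x, u). A x * B u) ((LINT x|lborel. A x) * (LINT u|lborel. B u))"
proof -
  have [measurable]: "A \<in> borel_measurable borel" "B \<in> borel_measurable borel"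
    using A B by (auto dest: borel_measurable_integrable)
  have int: "integrable (lborel \<Otimes>\<^sub>M lborel) (case_prod (\<lambda>x u. A x * B u))"
  proof (rule lborel_pair.Fubini_integrable)
    show "integrable lborel (\<lambda>x. LINT u|lborel. norm (case_prod (\<lambda>x u. A x * B u) (x, u)))"
      using A B by (simp add: norm_mult)
  qed (use A B in auto)
  have "(LINT z|(lborel \<Otimes>\<^sub>M lborel). case_prod (\<lambda>x u. A x * B u) z) = (LINT x|lborel. LINT u|lborel. A x * B u)"
    by (rule lborel_pair.integral_fst[OF int, symmetric])
  also have "\<dots> = (LINT x|lborel. A x) * (LINT u|lborel. B u)"
    by (simp only: integral_mult_right_zero integral_mult_left_zero)
  finally show ?thesis
    using int by (simp add: has_bochner_integral_iff)
qed

text \<open>The diagonal, where the regularised quotient does not converge to \<open>1\<close>, is a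
  null set.\<close>

lemma AE_pair_neq: "AE z in (lborel \<Otimes>\<^sub>M (lborel :: real measure)). fst z \<noteq> snd z"
proof (rule lborel_pair.AE_pair_measure)
  show "{z \<in> space (lborel \<Otimes>\<^sub>M lborel). fst z \<noteq> snd z} \<in> sets (lborel \<Otimes>\<^sub>M (lborel :: real measure))"
    by measurable
  show "AE x in lborel. AE y in lborel. fst (x :: real, y) \<noteq> snd (x, y)"
  proof (rule AE_I2)
    fix x :: real
    show "AE y in lborel. fst (x, y) \<noteq> snd (x, y)"
      using AE_lborel_singleton[of x] by eventually_elim auto
  qed
qed

text \<open>
  Exchanging the roles of the two variables turns the two principal value terms into a single double
  integral whose kernel \<open>(\<phi> x - \<phi> u) / (u - x)\<close> is no longer singular.
\<close>
lemma conj_poisson_bilinear: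
  fixes \<phi> :: "real \<Rightarrow> real"
  assumes f: "f \<in> Lp p" "1 < p" "\<And>x. x \<le> 0 \<Longrightarrow> f x = 0"
    and g: "g \<in> Lp q" "1 < q" "\<And>x. x \<le> 0 \<Longrightarrow> g x = 0"
    and vf: "vf \<in> Lp p" "\<And>x s. 0 < s \<Longrightarrow> conj_poisson f s x = poisson vf s x"
    and vg: "vg \<in> Lp q" "\<And>x s. 0 < s \<Longrightarrow> conj_poisson g s x = poisson vg s x"
    and \<phi>: "\<phi> \<in> borel_measurable borel" "\<And>x. \<bar>\<phi> x\<bar> \<le> K / (1 + \<bar>x\<bar>)"
    and \<phi>f: "(\<lambda>x. of_real (\<phi> x) * f x) \<in> Lp q'" "1 < q'" "1 / q' + 1 / q = 1"
    and \<phi>g: "(\<lambda>x. of_real (\<phi> x) * g x) \<in> Lp p'" "1 < p'" "1 / p' + 1 / p = 1"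
    and D: "\<And>x u. 0 < x \<Longrightarrow> 0 < u \<Longrightarrow> \<phi> x - \<phi> u = (u - x) * D x u"
    and I: "has_bochner_integral (lborel \<Otimes>\<^sub>M lborel) (\<lambda>(x, u). of_real (D x u) * (f x * g u)) I"
  shows "(LINT x|lborel. of_real (\<phi> x) * f x * vg x) + (LINT x|lborel. of_real (\<phi> x) * g x * vf x) = I"
proof -
  note [measurable] = LpD[OF f(1)] LpD[OF g(1)] \<phi>(1)
  define s where "s n = 1 / real (Suc n)" for n
  have s: "0 < s n" for n by (simp add: s_def)
  have s0: "s \<longlonglongrightarrow> 0"
    unfolding s_def by (rule LIMSEQ_Suc[OF lim_1_over_n])
  have sr: "filterlim s (at_right 0) sequentially"
    using s s0 by (intro tendsto_imp_filterlim_at_right) auto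
  have decay: "integrable lborel (\<lambda>x. of_real (\<phi> x) * h x)" if "h \<in> Lp r" "1 < r" for h r
  proof -
    have "integrable lborel (\<lambda>x. h x * of_real (\<phi> x))"
      using \<phi> by (intro Lp_mult_decay_integrable[OF that, where x = 0]) auto
    then show ?thesis by (simp add: mult.commute)
  qed
  define S where "S n = (LINT x|lborel. of_real (\<phi> x) * f x * conj_poisson g (s n) x)
      + (LINT x|lborel. of_real (\<phi> x) * g x * conj_poisson f (s n) x)" for n
  have "S \<longlonglongrightarrow> (LINT x|lborel. of_real (\<phi> x) * f x * vg x) + (LINT x|lborel. of_real (\<phi> x) * g x * vf x)"
    unfolding S_def using vf(2)[OF s] vg(2)[OF s]
    by (simp only:) (intro tendsto_add filterlim_compose[OF poisson_weak_limit[OF \<phi>f(1) vg(1) \<phi>f(2) g(2) \<phi>f(3)] sr]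
          filterlim_compose[OF poisson_weak_limit[OF \<phi>g(1) vf(1) \<phi>g(2) f(2) \<phi>g(3)] sr])
  moreover have "S \<longlonglongrightarrow> I"
  proof -
    let ?G = "\<lambda>n x u. of_real (\<phi> x) * f x * (of_real (conj_kernel (s n) (u - x)) * g u)"
    let ?H = "\<lambda>n u x. of_real (\<phi> u) * g u * (of_real (conj_kernel (s n) (x - u)) * f x)"
    \<comment> \<open>The factor is
      \<open>(u - x)\<^sup>2 / ((u - x)\<^sup>2 + (s n)\<^sup>2)\<close>: it lies between
      \<open>0\<close> and \<open>1\<close> and tends to \<open>1\<close> off the diagonal, so
      \<open>?F\<close> dominates.\<close>
    let ?\<theta> = "\<lambda>n x u. (u - x) * conj_kernel (s n) (u - x)"
    let ?F = "\<lambda>z. case z of (x, u) \<Rightarrow> of_real (D x u) * (f x * g u)"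
    \<comment> \<open>Renaming the variables in the second pairing and using that the kernel is odd
      puts \<open>\<phi> x - \<phi> u\<close> in front of it; by \<open>D\<close> this cancels the
      singularity.\<close>
    have S: "S n = (LINT z|(lborel \<Otimes>\<^sub>M lborel). of_real (case z of (x, u) \<Rightarrow> ?\<theta> n x u) * ?F z)" for n
    proof -
      note G = conj_poisson_pairing[OF decay[OF f(1,2)] g(1,2) s[of n]]
      note H = conj_poisson_pairing[OF decay[OF g(1,2)] f(1,2) s[of n]]
      have H1: "integrable (lborel \<Otimes>\<^sub>M lborel) (\<lambda>(x, u). ?H n u x)"
        using lborel_pair.integrable_product_swap[OF H(1)] by simp
      have H2: "(LINT z|(lborel \<Otimes>\<^sub>M lborel). (case z of (x, u) \<Rightarrow> ?H n u x)) = (LINT x|lborel. of_real (\<phi> x) * g x * conj_poisson f (s n) x)"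
        using lborel_pair.integral_product_swap[OF borel_measurable_integrable[OF H(1)]] H(2) by simp
      have "S n = (LINT z|(lborel \<Otimes>\<^sub>M lborel). (case z of (x, u) \<Rightarrow> ?G n x u) + (case z of (x, u) \<Rightarrow> ?H n u x))"
        unfolding S_def G(2)[symmetric] H2[symmetric]
        by (rule Bochner_Integration.integral_add[symmetric, OF G(1) H1])
      also have "\<dots> = (LINT z|(lborel \<Otimes>\<^sub>M lborel). of_real (case z of (x, u) \<Rightarrow> ?\<theta> n x u) * ?F z)"
      proof (intro Bochner_Integration.integral_cong refl)
        fix z :: "real \<times> real"
        obtain x u where z: "z = (x, u)" by (cases z)
        show "(case z of (x, u) \<Rightarrow> ?G n x u) + (case z of (x, u) \<Rightarrow> ?H n u x) = of_real (case z of (x, u) \<Rightarrow> ?\<theta> n x u) * ?F z"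
        proof (cases "0 < x \<and> 0 < u")
          case True
          have "conj_kernel (s n) (x - u) = - conj_kernel (s n) (u - x)"
            using conj_kernel_minus[of "s n" "u - x"] by simp
          then have "?G n x u + ?H n u x = of_real ((\<phi> x - \<phi> u) * conj_kernel (s n) (u - x)) * (f x * g u)"
            by (simp add: algebra_simps)
          also have "\<dots> = of_real (?\<theta> n x u) * (of_real (D x u) * (f x * g u))"
            unfolding D[OF conjunct1[OF True] conjunct2[OF True]] of_real_mult by (simp only: mult_ac)
          finally show ?thesis by (simp add: z)
        qed (use f(3) g(3) in \<open>auto simp: z not_less\<close>)
      qed
      finally show ?thesis .
    qed
    have Iint: "integrable (lborel \<Otimes>\<^sub>M lborel) ?F" "(LINT z|(lborel \<Otimes>\<^sub>M lborel). ?F z) = I"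
      using I by (auto simp: has_bochner_integral_iff)
    have F[measurable]: "?F \<in> borel_measurable (lborel \<Otimes>\<^sub>M lborel)"
      by (rule borel_measurable_integrable[OF Iint(1)])
    have \<theta>: "0 \<le> ?\<theta> n x u" "?\<theta> n x u \<le> 1" for n x u
    proof -
      have "0 < (u - x)\<^sup>2 + (s n)\<^sup>2"
        using s[of n] by (intro add_nonneg_pos) auto
      moreover have "?\<theta> n x u = (u - x)\<^sup>2 / ((u - x)\<^sup>2 + (s n)\<^sup>2)"
        by (simp add: conj_kernel_def power2_eq_square)
      ultimately show "0 \<le> ?\<theta> n x u" "?\<theta> n x u \<le> 1"
        by (auto simp: divide_le_eq_1)
    qed
    have "(\<lambda>n. LINT z|(lborel \<Otimes>\<^sub>M lborel). of_real (case z of (x, u) \<Rightarrow> ?\<theta> n x u) * ?F z) \<longlonglongrightarrow> (LINT z|(lborel \<Otimes>\<^sub>M lborel). ?F z)"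
    proof (rule integral_dominated_convergence)
      show "(\<lambda>z. of_real (case z of (x, u) \<Rightarrow> ?\<theta> n x u) * ?F z) \<in> borel_measurable (lborel \<Otimes>\<^sub>M lborel)" for n
      proof -
        have "(\<lambda>z. complex_of_real (case z of (x, u) \<Rightarrow> ?\<theta> n x u)) \<in> borel_measurable (lborel \<Otimes>\<^sub>M lborel)"
          by measurable
        then show ?thesis using F by (rule borel_measurable_times)
      qed
      show "integrable (lborel \<Otimes>\<^sub>M lborel) (\<lambda>z. norm (?F z))"
        by (rule integrable_norm[OF Iint(1)])
      show "AE z in (lborel \<Otimes>\<^sub>M lborel). norm (of_real (case z of (x, u) \<Rightarrow> ?\<theta> n x u) * ?F z) \<le> norm (?F z)" for n
      proof (rule AE_I2)
        fix z :: "real \<times> real"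
        obtain x u where z: "z = (x, u)" by (cases z)
        show "norm (of_real (case z of (x, u) \<Rightarrow> ?\<theta> n x u) * ?F z) \<le> norm (?F z)"
          unfolding norm_mult norm_of_real z prod.case
          using \<theta>[of u x n] by (intro mult_left_le_one_le mult_nonneg_nonneg) auto
      qed
      show "AE z in (lborel \<Otimes>\<^sub>M lborel). (\<lambda>n. of_real (case z of (x, u) \<Rightarrow> ?\<theta> n x u) * ?F z) \<longlonglongrightarrow> ?F z"
        using AE_pair_neq
      proof eventually_elim
        case (elim z)
        obtain x u where z: "z = (x, u)" by (cases z)
        have "u - x \<noteq> 0" using elim z by simp
        then have "(\<lambda>n. (u - x) * ((u - x) / ((u - x)\<^sup>2 + (s n)\<^sup>2))) \<longlonglongrightarrow> (u - x) * ((u - x) / ((u - x)\<^sup>2 + 0\<^sup>2))"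
          by (intro tendsto_intros s0) auto
        also have "(u - x) * ((u - x) / ((u - x)\<^sup>2 + 0\<^sup>2)) = 1"
          using \<open>u - x \<noteq> 0\<close> by (simp add: power2_eq_square)
        finally have "(\<lambda>n. of_real (?\<theta> n x u) * ?F z) \<longlonglongrightarrow> of_real 1 * ?F z"
          unfolding conj_kernel_def by (intro tendsto_mult tendsto_of_real tendsto_const)
        then show ?case by (simp add: z)
      qed
    qed (rule F)
    then show ?thesis by (simp only: S[symmetric] Iint(2))
  qed
  ultimately show ?thesis by (rule LIMSEQ_unique)
qed

section \<open>Stieltjes kernels and the algebraic identity\<close>

text \<open>The prefactor \<open>t ^ (m - k)\<close> is left out and the index is natural: all
  indices in the identity lie between \<open>1\<close> and \<open>m\<close>, where
  \<open>powi\<close> is an ordinary power.\<close>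

definition stieltjes_kernel :: "real \<Rightarrow> nat \<Rightarrow> nat \<Rightarrow> real \<Rightarrow> real" where
  "stieltjes_kernel t m k s = (if 0 < s then s ^ (k - 1) / (s + t) ^ m else 0)"

lemma stieltjes_kernel_measurable [measurable]: "stieltjes_kernel t m k \<in> borel_measurable borel"
  unfolding stieltjes_kernel_def by measurable

text \<open>Split \<open>(s + t) ^ m\<close> into three factors with exponents \<open>k - 1\<close>,
  \<open>m - k\<close> and \<open>1\<close>, and bound them below by powers of \<open>s\<close>,
  powers of \<open>t\<close>, and \<open>min 1 t * (1 + s)\<close>.\<close>

lemma stieltjes_kernel_bound:
  assumes t: "0 < t" and k: "1 \<le> k" "k \<le> m"
  shows "\<bar>stieltjes_kernel t m k s\<bar> \<le> (1 / (t ^ (m - k) * min 1 t)) / (1 + \<bar>s\<bar>)"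
proof (cases "0 < s")
  case True
  have "(s + t) ^ m = (s + t) ^ (k - 1) * (s + t) ^ (m - k) * (s + t)"
  proof -
    have "m = (k - 1) + (m - k) + 1" using k by simp
    then show ?thesis by (metis power_add power_one_right)
  qed
  moreover have "s ^ (k - 1) * t ^ (m - k) * (min 1 t * (1 + s)) \<le> (s + t) ^ (k - 1) * (s + t) ^ (m - k) * (s + t)"
  proof (intro mult_mono power_mono)
    have "min 1 t * (1 + s) = min 1 t + min 1 t * s" by (simp add: algebra_simps)
    also have "\<dots> \<le> t + 1 * s" using True by (intro add_mono mult_right_mono) auto
    finally show "min 1 t * (1 + s) \<le> s + t" by simp
  qed (use True t in auto)
  ultimately have "s ^ (k - 1) * (t ^ (m - k) * min 1 t * (1 + s)) \<le> (s + t) ^ m"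
    by (simp add: mult_ac)
  moreover have "0 < t ^ (m - k) * min 1 t * (1 + s)" "0 < (s + t) ^ m"
    using True t by auto
  ultimately have "s ^ (k - 1) / (s + t) ^ m \<le> 1 / (t ^ (m - k) * min 1 t * (1 + s))"
    by (simp add: divide_le_eq le_divide_eq mult_ac)
  then show ?thesis
    using True t by (simp add: stieltjes_kernel_def)
next
  case False
  then show ?thesis using t by (simp add: stieltjes_kernel_def)
qed

lemma stieltjes_eq:
  assumes fF: "represents f F" and k: "1 \<le> k" "k \<le> m"
  shows "stieltjes (int k) m F t = of_real (t ^ (m - k)) * (LINT s|lborel. of_real (stieltjes_kernel t m k s) * f s)"
proof -
  have "(LINT s:{0<..}|lebesgue. of_real (s powi (int k - 1) / (s + t) ^ m) * F s) =
      (LINT s:{0<..}|lebesgue. of_real (stieltjes_kernel t m k s) * F s)"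
    unfolding set_lebesgue_integral_def
  proof (intro Bochner_Integration.integral_cong refl)
    fix s :: real
    have "int k - 1 = int (k - 1)" using k by simp
    then have "s powi (int k - 1) = s ^ (k - 1)" by (simp only: power_int_of_nat)
    then show "indicator {0<..} s *\<^sub>R (of_real (s powi (int k - 1) / (s + t) ^ m) * F s) =
       indicator {0<..} s *\<^sub>R (of_real (stieltjes_kernel t m k s) * F s)"
      by (simp add: stieltjes_kernel_def indicator_def)
  qed
  also have "\<dots> = (LINT s|lborel. indicator {0<..} s *\<^sub>R (of_real (stieltjes_kernel t m k s) * f s))"
    by (rule represents_integral[OF fF]) auto
  also have "\<dots> = (LINT s|lborel. of_real (stieltjes_kernel t m k s) * f s)"
    by (intro Bochner_Integration.integral_cong refl) (auto simp: stieltjes_kernel_def split: split_indicator)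
  finally have "(LINT s:{0<..}|lebesgue. of_real (s powi (int k - 1) / (s + t) ^ m) * F s) =
      (LINT s|lborel. of_real (stieltjes_kernel t m k s) * f s)" .
  moreover have "t powi (int m - int k) = t ^ (m - k)"
    using k by (simp only: of_nat_diff[symmetric] power_int_of_nat)
  ultimately show ?thesis
    unfolding stieltjes_def by (simp only:)
qed

text \<open>The binomial theorem reduces this to
  \<open>E i = x ^ (n - 1) * u ^ i - u ^ (n - 1) * x ^ i\<close>. Taking out the common power of
  \<open>x * u\<close> leaves a difference of equal powers, a geometric sum. Indices
  \<open>i \<ge> n\<close> and \<open>i < n - 1\<close> give opposite signs, and
  \<open>E (n - 1) = 0\<close>, which is why that index occurs in neither sum. Exponents are written
  as an index minus one to match \<open>stieltjes_kernel\<close>.\<close>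

lemma polynomial_difference:
  fixes x u t :: real
  assumes n: "1 \<le> n" "n \<le> m"
  shows "x ^ (n - 1) * (u + t) ^ m - u ^ (n - 1) * (x + t) ^ m = (u - x) *
    ((\<Sum>i=n..m. real (m choose i) * t ^ (m - i) * (\<Sum>j<i + 1 - n. x ^ (i - j - 1) * u ^ (n + j - 1))) -
     (\<Sum>i<n - 1. real (m choose i) * t ^ (m - i) * (\<Sum>j<n - 1 - i. x ^ (n - 1 - j - 1) * u ^ (i + j + 1 - 1))))"
proof -
  define c where "c i = real (m choose i) * t ^ (m - i)" for i
  define E where "E i = x ^ (n - 1) * u ^ i - u ^ (n - 1) * x ^ i" for i
  have hi: "E i = (u - x) * (\<Sum>j<i + 1 - n. x ^ (i - j - 1) * u ^ (n + j - 1))" if i: "n \<le> i" for i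
  proof -
    have "E i = x ^ (n - 1) * u ^ (n - 1) * (u ^ (i + 1 - n) - x ^ (i + 1 - n))"
    proof -
      have "i = (n - 1) + (i + 1 - n)" using i n by simp
      then have "u ^ i = u ^ (n - 1) * u ^ (i + 1 - n)" "x ^ i = x ^ (n - 1) * x ^ (i + 1 - n)"
        by (metis power_add)+
      then show ?thesis by (simp add: E_def algebra_simps)
    qed
    also have "u ^ (i + 1 - n) - x ^ (i + 1 - n) = (u - x) * (\<Sum>j<i + 1 - n. x ^ (i + 1 - n - Suc j) * u ^ j)"
      by (rule power_diff_sumr2)
    also have "x ^ (n - 1) * u ^ (n - 1) * \<dots> = (u - x) * (\<Sum>j<i + 1 - n. (x ^ (n - 1) * x ^ (i + 1 - n - Suc j)) * (u ^ (n - 1) * u ^ j))"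
      by (simp add: sum_distrib_left mult_ac)
    also have "(\<Sum>j<i + 1 - n. (x ^ (n - 1) * x ^ (i + 1 - n - Suc j)) * (u ^ (n - 1) * u ^ j)) = (\<Sum>j<i + 1 - n. x ^ (i - j - 1) * u ^ (n + j - 1))"
    proof (intro sum.cong refl)
      fix j assume "j \<in> {..<i + 1 - n}"
      then have "(n - 1) + (i + 1 - n - Suc j) = i - j - 1" "(n - 1) + j = n + j - 1"
        using n by auto
      then show "(x ^ (n - 1) * x ^ (i + 1 - n - Suc j)) * (u ^ (n - 1) * u ^ j) = x ^ (i - j - 1) * u ^ (n + j - 1)"
        by (simp only: power_add[symmetric])
    qed
    finally show ?thesis .
  qed
  have lo: "E i = - ((u - x) * (\<Sum>j<n - 1 - i. x ^ (n - 1 - j - 1) * u ^ (i + j + 1 - 1)))" if i: "i < n - 1" for i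
  proof -
    have "E i = - (x ^ i * u ^ i * (u ^ (n - 1 - i) - x ^ (n - 1 - i)))"
    proof -
      have "n - 1 = i + (n - 1 - i)" using i by simp
      then have "u ^ (n - 1) = u ^ i * u ^ (n - 1 - i)" "x ^ (n - 1) = x ^ i * x ^ (n - 1 - i)"
        by (metis power_add)+
      then show ?thesis by (simp add: E_def algebra_simps)
    qed
    also have "u ^ (n - 1 - i) - x ^ (n - 1 - i) = (u - x) * (\<Sum>j<n - 1 - i. x ^ (n - 1 - i - Suc j) * u ^ j)"
      by (rule power_diff_sumr2)
    also have "x ^ i * u ^ i * \<dots> = (u - x) * (\<Sum>j<n - 1 - i. (x ^ i * x ^ (n - 1 - i - Suc j)) * (u ^ i * u ^ j))"
      by (simp add: sum_distrib_left mult_ac)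
    also have "(\<Sum>j<n - 1 - i. (x ^ i * x ^ (n - 1 - i - Suc j)) * (u ^ i * u ^ j)) = (\<Sum>j<n - 1 - i. x ^ (n - 1 - j - 1) * u ^ (i + j + 1 - 1))"
    proof (intro sum.cong refl)
      fix j assume "j \<in> {..<n - 1 - i}"
      then have "i + (n - 1 - i - Suc j) = n - 1 - j - 1" "i + j = i + j + 1 - 1"
        using n by auto
      then show "(x ^ i * x ^ (n - 1 - i - Suc j)) * (u ^ i * u ^ j) = x ^ (n - 1 - j - 1) * u ^ (i + j + 1 - 1)"
        by (simp only: power_add[symmetric])
    qed
    finally show ?thesis .
  qed
  have "x ^ (n - 1) * (u + t) ^ m - u ^ (n - 1) * (x + t) ^ m = (\<Sum>i\<le>m. c i * E i)"
    unfolding binomial_ring E_def c_def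
    by (simp add: sum_distrib_left sum_subtractf[symmetric] algebra_simps)
  also have "{..m} = {..<n - 1} \<union> ({n - 1} \<union> {n..m})"
    using n by auto
  also have "(\<Sum>i\<in>{..<n - 1} \<union> ({n - 1} \<union> {n..m}). c i * E i) = (\<Sum>i<n - 1. c i * E i) + (c (n - 1) * E (n - 1) + (\<Sum>i=n..m. c i * E i))"
    using n by (subst sum.union_disjoint, auto)+
  also have "E (n - 1) = 0"
    by (simp add: E_def)
  also have "(\<Sum>i<n - 1. c i * E i) = (\<Sum>i<n - 1. - ((u - x) * (c i * (\<Sum>j<n - 1 - i. x ^ (n - 1 - j - 1) * u ^ (i + j + 1 - 1)))))"
    by (intro sum.cong refl) (simp add: lo)
  also have "(\<Sum>i=n..m. c i * E i) = (\<Sum>i=n..m. (u - x) * (c i * (\<Sum>j<i + 1 - n. x ^ (i - j - 1) * u ^ (n + j - 1))))"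
    by (intro sum.cong refl) (simp add: hi)
  finally show ?thesis
    unfolding c_def by (simp only: sum_negf sum_distrib_left[symmetric] right_diff_distrib)
qed

text \<open>Division by \<open>(x + t) ^ m * (u + t) ^ m\<close> turns each monomial into a product
  of two kernels; the bracket is the \<open>D\<close> required by
  \<open>conj_poisson_bilinear\<close>.\<close>

lemma stieltjes_kernel_difference:
  assumes n: "1 \<le> n" "n \<le> m" and t: "0 < t" and xu: "0 < x" "0 < u"
  shows "stieltjes_kernel t m n x - stieltjes_kernel t m n u = (u - x) *
    ((\<Sum>i=n..m. real (m choose i) * t ^ (m - i) * (\<Sum>j<i + 1 - n. stieltjes_kernel t m (i - j) x * stieltjes_kernel t m (n + j) u)) -
     (\<Sum>i<n - 1. real (m choose i) * t ^ (m - i) * (\<Sum>j<n - 1 - i. stieltjes_kernel t m (n - 1 - j) x * stieltjes_kernel t m (i + j + 1) u)))"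
proof -
  define W where "W = (x + t) ^ m * (u + t) ^ m"
  have W: "W \<noteq> 0" "(x + t) ^ m \<noteq> 0" "(u + t) ^ m \<noteq> 0" using t xu by (auto simp: W_def)
  have k: "stieltjes_kernel t m a x * stieltjes_kernel t m b u = x ^ (a - 1) * u ^ (b - 1) / W" for a b
    using xu by (simp add: stieltjes_kernel_def W_def)
  have "stieltjes_kernel t m n x - stieltjes_kernel t m n u = (x ^ (n - 1) * (u + t) ^ m - u ^ (n - 1) * (x + t) ^ m) / W"
    using xu W by (simp add: stieltjes_kernel_def W_def diff_divide_distrib)
  also have "\<dots> = (u - x) *
    ((\<Sum>i=n..m. real (m choose i) * t ^ (m - i) * ((\<Sum>j<i + 1 - n. x ^ (i - j - 1) * u ^ (n + j - 1)) / W)) -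
     (\<Sum>i<n - 1. real (m choose i) * t ^ (m - i) * ((\<Sum>j<n - 1 - i. x ^ (n - 1 - j - 1) * u ^ (i + j + 1 - 1)) / W)))"
    unfolding polynomial_difference[OF n] by (simp only: times_divide_eq_right sum_divide_distrib[symmetric] diff_divide_distrib[symmetric])
  finally show ?thesis
    unfolding k by (simp only: sum_divide_distrib)
qed

text \<open>For \<open>k = 0\<close> the upper limit is \<open>-1\<close> and both sums are empty;
  this occurs for the limit \<open>int n - 2\<close> when \<open>n = 1\<close>.\<close>

lemma sum_int_lessThan: "(\<Sum>j = 0..int k - 1. h j) = (\<Sum>j<k. h (int j))"
proof -
  have "{0..int k - 1} = int ` {..<k}"
    using image_int_atLeastLessThan[of 0 k] by (simp add: atLeast0LessThan atLeastLessThan_def atLeastAtMost_def) auto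
  then show ?thesis
    by (simp add: sum.reindex)
qed

lemma sum_int_atLeastAtMost: "(\<Sum>i = int a..int b. h i) = (\<Sum>i=a..b. h (int i))"
  using image_int_atLeastAtMost[of a b] by (metis sum.reindex_cong inj_on_of_nat)

text \<open>The left side of the identity is an integral of \<open>pv_prod f g\<close>, so it is
  defined at every \<open>t > 0\<close> although the principal values need exist only almost
  everywhere.\<close>

theorem theorem2:
  fixes p q r :: real and n m :: nat and f g :: "real \<Rightarrow> complex"
  assumes "1 < p" and "1 < q" and "1 \<le> r"
    and "1 / p + 1 / q = 1 / r"
    and "0 < real n - 1 / r" and "real n - 1 / r < real m"
    and "f \<in> Lp_half_line p" and "g \<in> Lp_half_line q"
  shows "(AE t in lebesgue_on {0<..}. pv_exists f t \<and> pv_exists g t) \<and>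
    pv_prod f g \<in> Lp_half_line r \<and>
    (\<forall>t>0. stieltjes (int n) m (pv_prod f g) t =
       (\<Sum>i = int n..int m. of_nat (m choose nat i) *
          (\<Sum>j = 0..i - int n. stieltjes (i - j) m f t * stieltjes (int n + j) m g t)) -
       (\<Sum>i = 0..int n - 2. of_nat (m choose nat i) *
          (\<Sum>j = 0..int n - 2 - i. stieltjes (int n - j - 1) m f t * stieltjes (i + j + 1) m g t)))"
proof -
  have r1: "1 / r \<le> 1" "0 < 1 / r" using assms(3) by auto
  have n: "1 \<le> n" "n \<le> m"
  \<comment> \<open>Since \<open>1 / r\<close> lies between \<open>0\<close> (excluded) and
    \<open>1\<close>, the real bounds give \<open>0 < n\<close> and
    \<open>n < m + 1\<close>.\<close>
  proof -
    have "0 < real n" using assms(5) r1 by linarith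
    then show "1 \<le> n" by simp
    have "real n < real m + 1" using assms(6) r1 by linarith
    then show "n \<le> m" by simp
  qed
  obtain f0 where f0: "represents f0 f"
    using represents_exists assms(7) unfolding Lp_half_line_def by blast
  obtain g0 where g0: "represents g0 g"
    using represents_exists assms(8) unfolding Lp_half_line_def by blast
  have fLp: "f0 \<in> Lp p" and gLp: "g0 \<in> Lp q"
    using represents_Lp_iff[OF f0] represents_Lp_iff[OF g0] assms by auto
  obtain vf where vf: "vf \<in> Lp p" "\<And>x s. 0 < s \<Longrightarrow> conj_poisson f0 s x = poisson vf s x"
    using conj_poisson_boundary[OF fLp assms(1)] by blast
  obtain vg where vg: "vg \<in> Lp q" "\<And>x s. 0 < s \<Longrightarrow> conj_poisson g0 s x = poisson vg s x"
    using conj_poisson_boundary[OF gLp assms(2)] by blast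
  have pvf: "AE x in lebesgue. 0 < x \<longrightarrow> pv_exists f x \<and> pv_transform f x = vf x"
    by (rule pv_transform_boundary[OF f0 fLp assms(1) vf])
  have pvg: "AE x in lebesgue. 0 < x \<longrightarrow> pv_exists g x \<and> pv_transform g x = vg x"
    by (rule pv_transform_boundary[OF g0 gLp assms(2) vg])
  have ex: "AE t in lebesgue_on {0<..}. pv_exists f t \<and> pv_exists g t"
  proof -
    have "AE t in lebesgue. t \<in> {0<..} \<longrightarrow> pv_exists f t \<and> pv_exists g t"
      using pvf pvg by eventually_elim auto
    then show ?thesis
      by (subst AE_restrict_space_iff) auto
  qed
  \<comment> \<open>The Borel representative of \<open>pv_prod f g\<close>, with the boundary
    functions \<open>vf\<close> and \<open>vg\<close> in place of the principal values.\<close>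
  define w where "w x = f0 x * vg x + g0 x * vf x" for x
  note [measurable] = LpD[OF fLp] LpD[OF gLp] LpD[OF vf(1)] LpD[OF vg(1)]
  have w: "represents w (pv_prod f g)"
    unfolding represents_def
  proof (intro conjI)
    show "w \<in> borel_measurable borel"
      unfolding w_def by measurable
    show "\<forall>x\<le>0. w x = 0"
      using representsD(2)[OF f0] representsD(2)[OF g0] by (simp add: w_def)
    show "AE x in lebesgue. 0 < x \<longrightarrow> pv_prod f g x = w x"
      using pvf pvg representsD(3)[OF f0] representsD(3)[OF g0]
      by eventually_elim (auto simp: pv_prod_def w_def)
  qed
  have r0: "0 < p" "0 < q" "0 < r" using assms by auto
  have wLp: "w \<in> Lp r"
    unfolding w_def
    using Lp_mult[OF fLp vg(1) r0 assms(4)] Lp_mult[OF gLp vf(1) r0(2,1,3)] assms(3,4)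
    by (intro Lp_add) (auto simp: add.commute)
  have "stieltjes (int n) m (pv_prod f g) t =
       (\<Sum>i = int n..int m. of_nat (m choose nat i) *
          (\<Sum>j = 0..i - int n. stieltjes (i - j) m f t * stieltjes (int n + j) m g t)) -
       (\<Sum>i = 0..int n - 2. of_nat (m choose nat i) *
          (\<Sum>j = 0..int n - 2 - i. stieltjes (int n - j - 1) m f t * stieltjes (i + j + 1) m g t))"
    (is "?lhs = ?rhs") if t: "0 < t" for t
  proof -
    let ?K = "stieltjes_kernel t m"
    define K where "K = 1 / (t ^ (m - n) * min 1 t)"
    have kb: "\<bar>?K n s\<bar> \<le> K / (1 + \<bar>s\<bar>)" for s
      unfolding K_def by (rule stieltjes_kernel_bound[OF t n])
    have K0: "0 \<le> K" using t by (simp add: K_def)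
    have kle: "\<bar>?K n s\<bar> \<le> K" for s
    proof -
      have "K / (1 + \<bar>s\<bar>) \<le> K / 1" using K0 by (intro divide_left_mono) auto
      then show ?thesis using kb[of s] by simp
    qed
    \<comment> \<open>Kernel times \<open>h\<close> must lie in the dual of
      \<open>L\<^sup>b\<close>, the space of the other transform. For \<open>r = 1\<close> the dual
      exponent is \<open>a\<close> and boundedness of the kernel suffices; for \<open>r > 1\<close>
      the kernel lies in the space with exponent \<open>r'\<close> conjugate to \<open>r\<close>,
      and Hoelder gives \<open>1 / r' + 1 / a = 1 / b'\<close>.\<close>
    have dual: "(\<lambda>x. of_real (?K n x) * h x) \<in> Lp b'" "1 < b'" "1 / b' + 1 / b = 1"
      if h: "h \<in> Lp a" "1 < a" "1 < b" "1 / a + 1 / b = 1 / r" "b' = b / (b - 1)" for h a b b'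
    proof -
      note [measurable] = LpD[OF h(1)]
      show b': "1 < b'" "1 / b' + 1 / b = 1"
        using h(3) unfolding h(5) by (auto simp: field_simps)
      show "(\<lambda>x. of_real (?K n x) * h x) \<in> Lp b'"
      proof (cases "r = 1")
        case True
        with h(4) b'(2) have "1 / a + 1 / b = 1 / b' + 1 / b" by simp
        then have "1 / a = 1 / b'" by simp
        then have "a = b'" using h(2) by simp
        have "(\<lambda>x. of_real K * h x) \<in> Lp a" by (rule Lp_cmult[OF h(1)])
        then show ?thesis
          unfolding \<open>a = b'\<close>[symmetric]
        proof (rule Lp_mono[rotated])
          show "norm (of_real (?K n x) * h x) \<le> norm (of_real K * h x)" for x
            using kle[of x] K0 by (simp add: norm_mult mult_right_mono)
        qed (use h(2) in auto)
      next
        case False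
        then have r: "1 < r" using assms(3) by simp
        then obtain r' where r': "1 < r'" "1 / r + 1 / r' = 1"
          using conj_exponent by blast
        have "(\<lambda>x. complex_of_real (?K n x)) \<in> Lp r'"
          using kb by (intro Lp_decay[OF r'(1), where x = 0 and K = K]) auto
        then show ?thesis
        proof (rule Lp_mult[OF _ h(1)])
          show "1 / r' + 1 / a = 1 / b'"
            using h(4) b'(2) r'(2) by linarith
        qed (use r'(1) h(2) b'(1) in auto)
      qed
    qed
    note df = dual[OF fLp assms(1,2,4) refl]
    have sym: "1 / q + 1 / p = 1 / r" using assms(4) by simp
    note dg = dual[OF gLp assms(2,1) sym refl]
    define A where "A k = (LINT s|lborel. of_real (?K k s) * f0 s)" for k
    define B where "B k = (LINT s|lborel. of_real (?K k s) * g0 s)" for k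
    have int: "integrable lborel (\<lambda>s. of_real (?K k s) * h s)" if "h \<in> Lp a" "1 < a" "1 \<le> k" "k \<le> m" for h a k
    proof -
      have "integrable lborel (\<lambda>s. h s * of_real (?K k s))"
      proof (rule Lp_mult_decay_integrable[OF that(1,2), where x = 0])
        show "norm (complex_of_real (?K k s)) \<le> (1 / (t ^ (m - k) * min 1 t)) / (1 + \<bar>s - 0\<bar>)" for s
          using stieltjes_kernel_bound[OF t that(3,4), of s] by (simp only: norm_of_real diff_zero)
      qed measurable
      then show ?thesis by (simp add: mult.commute)
    qed
    have AB: "has_bochner_integral (lborel \<Otimes>\<^sub>M lborel)
        (\<lambda>(x, u). of_real (?K k x * ?K l u) * (f0 x * g0 u)) (A k * B l)"
      if "1 \<le> k" "k \<le> m" "1 \<le> l" "l \<le> m" for k l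
      using has_bochner_integral_product[OF int[OF fLp assms(1) that(1,2)] int[OF gLp assms(2) that(3,4)]]
      unfolding A_def B_def by (simp add: mult_ac)
    define c where "c i = real (m choose i) * t ^ (m - i)" for i
    define D where "D x u = (\<Sum>i=n..m. c i * (\<Sum>j<i + 1 - n. ?K (i - j) x * ?K (n + j) u)) -
       (\<Sum>i<n - 1. c i * (\<Sum>j<n - 1 - i. ?K (n - 1 - j) x * ?K (i + j + 1) u))" for x u
    define I where "I = (\<Sum>i=n..m. of_real (c i) * (\<Sum>j<i + 1 - n. A (i - j) * B (n + j))) -
       (\<Sum>i<n - 1. of_real (c i) * (\<Sum>j<n - 1 - i. A (n - 1 - j) * B (i + j + 1)))"
    have hI: "has_bochner_integral (lborel \<Otimes>\<^sub>M lborel) (\<lambda>(x, u). of_real (D x u) * (f0 x * g0 u)) I"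
    proof -
      let ?T = "\<lambda>k l z. case z of (x, u) \<Rightarrow> of_real (?K k x * ?K l u) * (f0 x * g0 u)"
      have "has_bochner_integral (lborel \<Otimes>\<^sub>M lborel)
        (\<lambda>z. (\<Sum>i=n..m. of_real (c i) * (\<Sum>j<i + 1 - n. ?T (i - j) (n + j) z)) -
             (\<Sum>i<n - 1. of_real (c i) * (\<Sum>j<n - 1 - i. ?T (n - 1 - j) (i + j + 1) z))) I"
        unfolding I_def
        by (intro has_bochner_integral_diff has_bochner_integral_sum has_bochner_integral_mult_right AB)
           (use n in auto)
      also have "(\<lambda>z. (\<Sum>i=n..m. of_real (c i) * (\<Sum>j<i + 1 - n. ?T (i - j) (n + j) z)) -
             (\<Sum>i<n - 1. of_real (c i) * (\<Sum>j<n - 1 - i. ?T (n - 1 - j) (i + j + 1) z))) =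
          (\<lambda>(x, u). of_real (D x u) * (f0 x * g0 u))"
        unfolding D_def
        by (intro ext) (auto simp: sum_distrib_right sum_distrib_left left_diff_distrib mult.assoc)
      finally show ?thesis .
    qed
    have main: "(LINT x|lborel. of_real (?K n x) * f0 x * vg x) + (LINT x|lborel. of_real (?K n x) * g0 x * vf x) = I"
    proof (rule conj_poisson_bilinear[OF fLp assms(1) representsD(2)[OF f0] gLp assms(2) representsD(2)[OF g0] vf vg _ kb df dg _ hI])
      show "?K n x - ?K n u = (u - x) * D x u" if "0 < x" "0 < u" for x u
        unfolding D_def c_def by (rule stieltjes_kernel_difference[OF n t that])
    qed auto
    have "?lhs = of_real (t ^ (m - n)) * (LINT s|lborel. of_real (?K n s) * w s)"
      by (rule stieltjes_eq[OF w n])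
    also have "(LINT s|lborel. of_real (?K n s) * w s) =
        (LINT s|lborel. of_real (?K n s) * f0 s * vg s + of_real (?K n s) * g0 s * vf s)"
      unfolding w_def by (simp add: algebra_simps)
    also have "\<dots> = I"
      unfolding main[symmetric]
      by (rule Bochner_Integration.integral_add[OF Lp_mult_integrable[OF df(1) vg(1) df(2) assms(2) df(3)]
            Lp_mult_integrable[OF dg(1) vf(1) dg(2) assms(1) dg(3)]])
    finally have lhs: "?lhs = of_real (t ^ (m - n)) * I" .
    have S: "stieltjes (int k) m f t = of_real (t ^ (m - k)) * A k" "stieltjes (int k) m g t = of_real (t ^ (m - k)) * B k"
      if "1 \<le> k" "k \<le> m" for k
      unfolding A_def B_def by (rule stieltjes_eq[OF f0 that], rule stieltjes_eq[OF g0 that])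
    \<comment> \<open>In every term the indices add up to \<open>n + i\<close>, so the prefactors
      combine to \<open>t ^ (m - n)\<close>, the prefactor of the left side, times
      \<open>t ^ (m - i)\<close>, the power that accompanies the binomial coefficient in
      \<open>c i\<close>.\<close>
    have prod: "stieltjes (int k) m f t * stieltjes (int l) m g t = of_real (t ^ (m - n) * t ^ (m - i)) * (A k * B l)"
      if "1 \<le> k" "k \<le> m" "1 \<le> l" "l \<le> m" "k + l = n + i" "i \<le> m" for k l i
    proof -
      have "(m - k) + (m - l) = (m - n) + (m - i)" using that n by simp
      then have "t ^ (m - k) * t ^ (m - l) = t ^ (m - n) * t ^ (m - i)"
        by (simp only: power_add[symmetric])
      then have "complex_of_real (t ^ (m - k)) * of_real (t ^ (m - l)) = of_real (t ^ (m - n) * t ^ (m - i))"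
        by (simp only: of_real_mult[symmetric])
      then show ?thesis
        unfolding S(1)[OF that(1,2)] S(2)[OF that(3,4)] by (metis mult.assoc mult.left_commute)
    qed
    have first: "(\<Sum>j = 0..int i - int n. stieltjes (int i - j) m f t * stieltjes (int n + j) m g t) =
        of_real (t ^ (m - n) * t ^ (m - i)) * (\<Sum>j<i + 1 - n. A (i - j) * B (n + j))" if i: "n \<le> i" "i \<le> m" for i
    proof -
      have "int i - int n = int (i + 1 - n) - 1" using i by simp
      then have "(\<Sum>j = 0..int i - int n. stieltjes (int i - j) m f t * stieltjes (int n + j) m g t) =
          (\<Sum>j<i + 1 - n. stieltjes (int i - int j) m f t * stieltjes (int n + int j) m g t)"
        by (simp only: sum_int_lessThan)
      also have "\<dots> = (\<Sum>j<i + 1 - n. of_real (t ^ (m - n) * t ^ (m - i)) * (A (i - j) * B (n + j)))"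
      proof (intro sum.cong refl)
        fix j assume j: "j \<in> {..<i + 1 - n}"
        then have "int i - int j = int (i - j)" "int n + int j = int (n + j)" by auto
        then show "stieltjes (int i - int j) m f t * stieltjes (int n + int j) m g t =
            of_real (t ^ (m - n) * t ^ (m - i)) * (A (i - j) * B (n + j))"
          using j i n by (simp only:) (intro prod, auto)
      qed
      finally show ?thesis by (simp only: sum_distrib_left)
    qed
    have second: "(\<Sum>j = 0..int n - 2 - int i. stieltjes (int n - j - 1) m f t * stieltjes (int i + j + 1) m g t) =
        of_real (t ^ (m - n) * t ^ (m - i)) * (\<Sum>j<n - 1 - i. A (n - 1 - j) * B (i + j + 1))" if i: "i < n - 1" for i
    proof -
      have "int n - 2 - int i = int (n - 1 - i) - 1" using i by simp
      then have "(\<Sum>j = 0..int n - 2 - int i. stieltjes (int n - j - 1) m f t * stieltjes (int i + j + 1) m g t) =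
          (\<Sum>j<n - 1 - i. stieltjes (int n - int j - 1) m f t * stieltjes (int i + int j + 1) m g t)"
        by (simp only: sum_int_lessThan)
      also have "\<dots> = (\<Sum>j<n - 1 - i. of_real (t ^ (m - n) * t ^ (m - i)) * (A (n - 1 - j) * B (i + j + 1)))"
      proof (intro sum.cong refl)
        fix j assume j: "j \<in> {..<n - 1 - i}"
        then have "int n - int j - 1 = int (n - 1 - j)" "int i + int j + 1 = int (i + j + 1)" by auto
        then show "stieltjes (int n - int j - 1) m f t * stieltjes (int i + int j + 1) m g t =
            of_real (t ^ (m - n) * t ^ (m - i)) * (A (n - 1 - j) * B (i + j + 1))"
          using j i n by (simp only:) (intro prod, auto)
      qed
      finally show ?thesis by (simp only: sum_distrib_left)
    qed
    have "?rhs = (\<Sum>i=n..m. of_nat (m choose i) *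
          (\<Sum>j = 0..int i - int n. stieltjes (int i - j) m f t * stieltjes (int n + j) m g t)) -
       (\<Sum>i<n - 1. of_nat (m choose i) *
          (\<Sum>j = 0..int n - 2 - int i. stieltjes (int n - j - 1) m f t * stieltjes (int i + j + 1) m g t))"
    proof -
      have "int n - 2 = int (n - 1) - 1" using n by simp
      then show ?thesis
        unfolding sum_int_atLeastAtMost by (simp only: sum_int_lessThan nat_int)
    qed
    also have "(\<Sum>i=n..m. of_nat (m choose i) *
          (\<Sum>j = 0..int i - int n. stieltjes (int i - j) m f t * stieltjes (int n + j) m g t)) =
        (\<Sum>i=n..m. of_real (t ^ (m - n)) * (of_real (c i) * (\<Sum>j<i + 1 - n. A (i - j) * B (n + j))))"
      by (intro sum.cong refl) (simp add: first c_def)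
    also have "(\<Sum>i<n - 1. of_nat (m choose i) *
          (\<Sum>j = 0..int n - 2 - int i. stieltjes (int n - j - 1) m f t * stieltjes (int i + j + 1) m g t)) =
        (\<Sum>i<n - 1. of_real (t ^ (m - n)) * (of_real (c i) * (\<Sum>j<n - 1 - i. A (n - 1 - j) * B (i + j + 1))))"
      by (intro sum.cong refl) (simp add: second c_def)
    finally have "?rhs = of_real (t ^ (m - n)) * I"
      unfolding I_def by (simp only: sum_distrib_left[symmetric] right_diff_distrib)
    with lhs show ?thesis by simp
  qed
  with ex wLp represents_Lp_iff[OF w] show ?thesis by blast
qed

end
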